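(* Let $\mathfrak a$ be the two-dimensional Anderson form with domain $\mathcal D(\mathfrak a)=e^X\mathcal H^1(\mathbb T^2)$ and norm $\|\cdot\|_{\mathfrak a}$, as defined in the context. Almost surely, the following hold. (1) (Continuity) There exists a random constant $C>0$ such that $$|\mathfrak a(u_1,u_2)|\le C\,\|u_1\|_{\mathfrak a}\,\|u_2\|_{\mathfrak a}\qquad\text{for all }u_1,u_2\in\mathcal D(\mathfrak a).$$ (2) (Quasi-coercivity) There exist random constants $\delta,C'>0$ such that $$\mathfrak a(u,u)+C'\|u\|_{L^2}^2\ge\delta\,\|u\|_{\mathfrak a}^2\qquad\text{for all }u\in\mathcal D(\mathfrak a).$$
   Context: $\mathbb T^2=(\mathbb R/2\pi\mathbb Z)^2$ is the torus with Lebesgue measure $\mathrm dx$ normalized to total mass $1$; functions are real-valued. $\mathcal H^1=\mathcal H^1(\mathbb T^2)$ is the usual Sobolev space. For $\alpha\in\mathbb R$, $\mathcal C^\alpha=\mathcal B^\alpha_{\infty,\infty}$ is the Besov–Hölder space with norm $\sup_{n\ge0}2^{\alpha n}\|\Delta_nu\|_{L^\infty}$, where $(\Delta_n)_{n\ge 0}$ are the Littlewood–Paley projectors. $\langle\cdot,\cdot\rangle$ is the duality bracket extending the $L^2$ inner product. White noise: $\xi=\sum_{k\in\mathbb Z^2}\xi_ke^{ik\cdot x}$, where the $\xi_k$ are centered standard complex Gaussian variables ($\mathbb E|\xi_k|^2=1$, $\xi_0$ real), independent up to the constraint $\xi_{-k}=\overline{\xi_k}$. Thus $\xi$ is the centered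 Gaussian random distribution with $\mathbb E[\langle\xi,\varphi\rangle\langle\xi,\psi\rangle]=\langle\varphi,\psi\rangle_{L^2}$. The random field $X$ is $X(x)=-\sum_{k\ne0}|k|^{-2}\xi_ke^{ik\cdot x}$, so $\Delta X=\xi-\xi_0$; almost surely $X\in\mathcal C^{1-\kappa}$ for every $\kappa>0$. Let $\xi_\varepsilon=\xi*\rho_\varepsilon$ with $\rho_\varepsilon$ a mollifier and let $X_\varepsilon=X*\rho_\varepsilon$ be the corresponding solution of $\Delta X_\varepsilon=\xi_\varepsilon-\langle\xi_\varepsilon,1\rangle$. The Wick square $|\nabla X|^{2\diamond}$ is the random distribution $$|\nabla X|^{2\diamond}=\lim_{\varepsilon\to0}\big(|\nabla X_\varepsilon|^2-\mathbb E[|\nabla X_\varepsilon|^2]\big),$$ the limit being in probability in $\mathcal C^{-2\kappa}(\mathbb T^2)$ for every $\kappa>0$. The Anderson form is $$\mathfrak a(u_1,u_2):=\int_{\mathbb T^2}\nabla v_1\cdot\nabla v_2\,e^{2X}\mathrm dx-\big\langle|\nabla X|^{2\diamond},v_1v_2e^{2X}\big\rangle+\xi_0\int_{\mathbb T^2}v_1v_2\,e^{2X}\mathrm dx,\qquad v_i=e^{-X}u_i,$$ with (random) domain $\mathcal D(\mathfrak a):=e^X\mathcal H^1(\mathbb T^2)=\{e^Xv:v\in\mathcal H^1\}$ and norm $\|u\|_{\mathfrak a}^2:=\|u\|_{L^2}^2+\|e^{-X}u\|_{\mathcal H^1}^2$. *)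

theory Defs
  imports "HOL-Probability.Probability"
begin

section \<open>Smooth functions on the plane\<close>

fun C_k :: "nat \<Rightarrow> (real \<times> real \<Rightarrow> real) \<Rightarrow> bool" where
  "C_k 0 f \<longleftrightarrow> continuous_on UNIV f"
| "C_k (Suc n) f \<longleftrightarrow>
     (\<forall>x. f differentiable at x) \<and> (\<forall>b\<in>Basis. C_k n (\<lambda>x. frechet_derivative f (at x) b))"

definition smooth :: "(real \<times> real \<Rightarrow> real) \<Rightarrow> bool" where
  "smooth f \<longleftrightarrow> (\<forall>n. C_k n f)"

section \<open>Functions and distributions on the torus\<close>

text \<open>
  A class of functions on the torus \<open>(\<real>/2\<pi>\<int>)\<^sup>2\<close> modulo null sets is represented by a function
  on the plane, of which only the values on the fundamental domain \<open>[0,2\<pi>)\<^sup>2\<close> matter; no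
  periodicity is imposed on the representative. The measure below is a probability measure which
  charges the fundamental domain only.
\<close>

definition torus :: "(real \<times> real) measure" where
  "torus = uniform_measure lborel ({0..<2 * pi} \<times> {0..<2 * pi})"

definition freq :: "int \<times> int \<Rightarrow> real \<times> real" where
  "freq k = (real_of_int (fst k), real_of_int (snd k))"

definition fourier_coeff :: "(real \<times> real \<Rightarrow> real) \<Rightarrow> int \<times> int \<Rightarrow> complex" where
  "fourier_coeff f k = (LINT x|torus. complex_of_real (f x) * cis (- (freq k \<bullet> x)))"

definition L2 :: "(real \<times> real \<Rightarrow> real) set" where
  "L2 = {f \<in> borel_measurable borel. integrable torus (\<lambda>x. (f x)\<^sup>2)}"

definition L2_norm :: "(real \<times> real \<Rightarrow> real) \<Rightarrow> real" where
  "L2_norm f = sqrt (LINT x|torus. (f x)\<^sup>2)"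

definition periodic :: "(real \<times> real \<Rightarrow> real) \<Rightarrow> bool" where
  "periodic f \<longleftrightarrow> (\<forall>x. \<forall>b\<in>Basis. f (x + (2 * pi) *\<^sub>R b) = f x)"

definition is_weak_deriv ::
    "real \<times> real \<Rightarrow> (real \<times> real \<Rightarrow> real) \<Rightarrow> (real \<times> real \<Rightarrow> real) \<Rightarrow> bool" where
  "is_weak_deriv b v g \<longleftrightarrow> g \<in> L2 \<and>
     (\<forall>\<psi>. smooth \<psi> \<and> periodic \<psi> \<longrightarrow>
        (LINT x|torus. v x * frechet_derivative \<psi> (at x) b) = - (LINT x|torus. g x * \<psi> x))"

definition H1 :: "(real \<times> real \<Rightarrow> real) set" where
  "H1 = {v \<in> L2. \<forall>b\<in>Basis. \<exists>g. is_weak_deriv b v g}"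

text \<open>A representative of the weak derivative; for \<open>v \<in> H1\<close> it is unique up to null sets.\<close>

definition weak_deriv :: "real \<times> real \<Rightarrow> (real \<times> real \<Rightarrow> real) \<Rightarrow> real \<times> real \<Rightarrow> real" where
  "weak_deriv b v = (SOME g. is_weak_deriv b v g)"

definition H1_norm :: "(real \<times> real \<Rightarrow> real) \<Rightarrow> real" where
  "H1_norm v = sqrt ((L2_norm v)\<^sup>2 + (\<Sum>b\<in>Basis. (L2_norm (weak_deriv b v))\<^sup>2))"

text \<open>
  A distribution on the torus is represented by the family of its Fourier coefficients
  \<open>k \<mapsto> \<langle>T, exp (-\<i>k\<cdot>x)\<rangle>\<close>. It is real-valued iff the coefficients at \<open>k\<close> and \<open>-k\<close> are
  conjugate.
\<close>

type_synonym distribution = "int \<times> int \<Rightarrow> complex"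

definition real_distribution :: "distribution \<Rightarrow> bool" where
  "real_distribution T \<longleftrightarrow> (\<forall>k. T (- k) = cnj (T k))"

text \<open>The real-valued function with an absolutely summable family of Fourier coefficients.\<close>

definition fourier_series :: "distribution \<Rightarrow> real \<times> real \<Rightarrow> real" where
  "fourier_series c x = Re (\<Sum>\<^sub>\<infinity>k. c k * cis (freq k \<bullet> x))"

section \<open>Littlewood--Paley decomposition\<close>

definition dyadic_partition ::
    "(real \<times> real \<Rightarrow> real) \<Rightarrow> (real \<times> real \<Rightarrow> real) \<Rightarrow> bool" where
  "dyadic_partition \<phi> \<theta> \<longleftrightarrow>
     smooth \<phi> \<and> smooth \<theta> \<and>
     (\<forall>x. 0 \<le> \<phi> x \<and> 0 \<le> \<theta> x) \<and>
     (\<forall>x y. norm x = norm y \<longrightarrow> \<phi> x = \<phi> y \<and> \<theta> x = \<theta> y) \<and>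
     (\<exists>R. \<forall>x. R < norm x \<longrightarrow> \<phi> x = 0) \<and>
     (\<exists>r R. 0 < r \<and> (\<forall>x. norm x < r \<or> R < norm x \<longrightarrow> \<theta> x = 0)) \<and>
     (\<forall>x. (\<lambda>j. \<theta> ((1 / 2 ^ j) *\<^sub>R x)) sums (1 - \<phi> x)) \<and>
     (\<forall>j\<ge>1. \<forall>x. \<phi> x = 0 \<or> \<theta> ((1 / 2 ^ j) *\<^sub>R x) = 0) \<and>
     (\<forall>i j. i + 2 \<le> j \<longrightarrow> (\<forall>x. \<theta> ((1 / 2 ^ i) *\<^sub>R x) = 0 \<or> \<theta> ((1 / 2 ^ j) *\<^sub>R x) = 0))"

text \<open>The low-frequency block has index \<open>0\<close>, so the dyadic blocks are shifted by one.\<close>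

fun lp_symbol ::
    "(real \<times> real \<Rightarrow> real) \<Rightarrow> (real \<times> real \<Rightarrow> real) \<Rightarrow> nat \<Rightarrow> int \<times> int \<Rightarrow> real" where
  "lp_symbol \<phi> \<theta> 0 k = \<phi> (freq k)"
| "lp_symbol \<phi> \<theta> (Suc j) k = \<theta> ((1 / 2 ^ j) *\<^sub>R freq k)"

text \<open>The set of frequencies summed over is finite for a dyadic partition.\<close>

definition lp_block ::
    "(real \<times> real \<Rightarrow> real) \<Rightarrow> (real \<times> real \<Rightarrow> real) \<Rightarrow> nat \<Rightarrow> distribution
      \<Rightarrow> real \<times> real \<Rightarrow> complex" where
  "lp_block \<phi> \<theta> n T x =
     (\<Sum>k | lp_symbol \<phi> \<theta> n k \<noteq> 0. complex_of_real (lp_symbol \<phi> \<theta> n k) * T k * cis (freq k \<bullet> x))"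

text \<open>
  The norm of \<open>\<C>\<^sup>\<alpha> = B\<^sup>\<alpha>\<^sub>\<infinity>\<^sub>,\<^sub>\<infinity>\<close>, with value \<open>\<infinity>\<close> outside this space. The blocks are
  trigonometric polynomials, so their essential supremum is a supremum.
\<close>

definition besov_norm ::
    "(real \<times> real \<Rightarrow> real) \<Rightarrow> (real \<times> real \<Rightarrow> real) \<Rightarrow> real \<Rightarrow> distribution \<Rightarrow> ennreal" where
  "besov_norm \<phi> \<theta> \<alpha> T =
     (SUP n. ennreal (2 powr (\<alpha> * real n)) * (SUP x. ennreal (cmod (lp_block \<phi> \<theta> n T x))))"

text \<open>
  The extension of the \<open>L\<^sup>2\<close> inner product to distributions: \<open>\<langle>T, f\<rangle> = \<Sum>n. \<langle>\<Delta>\<^sub>n T, f\<rangle>\<close>, where each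
  \<open>\<Delta>\<^sub>n T\<close> is smooth. The result is real for a real distribution \<open>T\<close>.
\<close>

definition bracket ::
    "(real \<times> real \<Rightarrow> real) \<Rightarrow> (real \<times> real \<Rightarrow> real) \<Rightarrow> distribution \<Rightarrow> (real \<times> real \<Rightarrow> real)
      \<Rightarrow> real" where
  "bracket \<phi> \<theta> T f = Re (\<Sum>n. LINT x|torus. lp_block \<phi> \<theta> n T x * complex_of_real (f x))"

section \<open>White noise, the field \<open>X\<close> and its Wick square\<close>

definition std_complex_gaussian :: "'w measure \<Rightarrow> ('w \<Rightarrow> complex) \<Rightarrow> bool" where
  "std_complex_gaussian M Z \<longleftrightarrow>
     distributed M lborel (\<lambda>\<omega>. Re (Z \<omega>)) (normal_density 0 (1 / sqrt 2)) \<and>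
     distributed M lborel (\<lambda>\<omega>. Im (Z \<omega>)) (normal_density 0 (1 / sqrt 2)) \<and>
     prob_space.indep_var M borel (\<lambda>\<omega>. Re (Z \<omega>)) borel (\<lambda>\<omega>. Im (Z \<omega>))"

text \<open>
  The independence ``up to the constraint'' is independence over \<open>0\<close> and one representative of
  each pair \<open>{k, -k}\<close>.
\<close>

definition white_noise :: "'w measure \<Rightarrow> (int \<times> int \<Rightarrow> 'w \<Rightarrow> complex) \<Rightarrow> bool" where
  "white_noise M \<xi> \<longleftrightarrow>
     (\<forall>k. \<xi> k \<in> borel_measurable M) \<and>
     (AE \<omega> in M. real_distribution (\<lambda>k. \<xi> k \<omega>)) \<and>
     distributed M lborel (\<lambda>\<omega>. Re (\<xi> 0 \<omega>)) std_normal_density \<and>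
     (\<forall>k. k \<noteq> 0 \<longrightarrow> std_complex_gaussian M (\<xi> k)) \<and>
     prob_space.indep_vars M (\<lambda>_. borel) \<xi> {k. k = 0 \<or> 0 < fst k \<or> fst k = 0 \<and> 0 < snd k}"

definition X_coeff :: "(int \<times> int \<Rightarrow> 'w \<Rightarrow> complex) \<Rightarrow> 'w \<Rightarrow> distribution" where
  "X_coeff \<xi> \<omega> k = (if k = 0 then 0 else - \<xi> k \<omega> / complex_of_real ((norm (freq k))\<^sup>2))"

text \<open>
  \<open>X\<close> is a version of the random field \<open>- \<Sum>k\<noteq>0. |k|\<^sup>-\<^sup>2 \<xi>\<^sub>k exp (\<i>k\<cdot>x)\<close>. The series is almost surely
  not absolutely convergent; it converges in \<open>L\<^sup>2\<close>, which is what is expressed here.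
\<close>

definition is_X ::
    "'w measure \<Rightarrow> (int \<times> int \<Rightarrow> 'w \<Rightarrow> complex) \<Rightarrow> ('w \<Rightarrow> real \<times> real \<Rightarrow> real) \<Rightarrow> bool" where
  "is_X M \<xi> X \<longleftrightarrow> (AE \<omega> in M. X \<omega> \<in> L2 \<and> (\<forall>k. fourier_coeff (X \<omega>) k = X_coeff \<xi> \<omega> k))"

definition mollifier :: "(real \<times> real \<Rightarrow> real) \<Rightarrow> bool" where
  "mollifier \<rho> \<longleftrightarrow> smooth \<rho> \<and> (\<forall>x. 0 \<le> \<rho> x) \<and> (\<exists>R. \<forall>x. R < norm x \<longrightarrow> \<rho> x = 0) \<and>
     (LINT y|lborel. \<rho> y) = 1"

text \<open>
  Fourier coefficients of \<open>T * \<rho>\<^sub>\<epsilon>\<close>, where \<open>\<rho>\<^sub>\<epsilon>\<close> is the periodization of \<open>\<epsilon>\<^sup>-\<^sup>2 \<rho> (y / \<epsilon>)\<close>, of mass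
  \<open>1\<close>; that is, \<open>(f * \<rho>\<^sub>\<epsilon>) x = \<integral> f (x - \<epsilon> y) \<rho> y dy\<close> if \<open>T\<close> is a periodic function \<open>f\<close>.
\<close>

definition mollify :: "(real \<times> real \<Rightarrow> real) \<Rightarrow> real \<Rightarrow> distribution \<Rightarrow> distribution" where
  "mollify \<rho> \<epsilon> T k = T k * (LINT y|lborel. complex_of_real (\<rho> y) * cis (- (\<epsilon> * (freq k \<bullet> y))))"

definition grad_X_eps_sq ::
    "(int \<times> int \<Rightarrow> 'w \<Rightarrow> complex) \<Rightarrow> (real \<times> real \<Rightarrow> real) \<Rightarrow> real \<Rightarrow> 'w \<Rightarrow> real \<times> real \<Rightarrow> real" where
  "grad_X_eps_sq \<xi> \<rho> \<epsilon> \<omega> x =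
     (\<Sum>b\<in>Basis. (fourier_series
        (\<lambda>k. \<i> * complex_of_real (freq k \<bullet> b) * mollify \<rho> \<epsilon> (X_coeff \<xi> \<omega>) k) x)\<^sup>2)"

definition wick_eps ::
    "'w measure \<Rightarrow> (int \<times> int \<Rightarrow> 'w \<Rightarrow> complex) \<Rightarrow> (real \<times> real \<Rightarrow> real) \<Rightarrow> real \<Rightarrow> 'w
      \<Rightarrow> real \<times> real \<Rightarrow> real" where
  "wick_eps M \<xi> \<rho> \<epsilon> \<omega> x =
     grad_X_eps_sq \<xi> \<rho> \<epsilon> \<omega> x - (LINT \<omega>'|M. grad_X_eps_sq \<xi> \<rho> \<epsilon> \<omega>' x)"

definition random_distribution :: "'w measure \<Rightarrow> ('w \<Rightarrow> distribution) \<Rightarrow> bool" where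
  "random_distribution M T \<longleftrightarrow>
     (\<forall>k. (\<lambda>\<omega>. T \<omega> k) \<in> borel_measurable M) \<and> (AE \<omega> in M. real_distribution (T \<omega>))"

definition is_wick_square ::
    "(real \<times> real \<Rightarrow> real) \<Rightarrow> (real \<times> real \<Rightarrow> real) \<Rightarrow> 'w measure
      \<Rightarrow> (int \<times> int \<Rightarrow> 'w \<Rightarrow> complex) \<Rightarrow> (real \<times> real \<Rightarrow> real) \<Rightarrow> ('w \<Rightarrow> distribution) \<Rightarrow> bool" where
  "is_wick_square \<phi> \<theta> M \<xi> \<rho> W \<longleftrightarrow>
     random_distribution M W \<and>
     (\<forall>\<kappa>>0. \<forall>\<eta>>0.
        ((\<lambda>\<epsilon>. measure M {\<omega> \<in> space M.
            besov_norm \<phi> \<theta> (- 2 * \<kappa>)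
              (\<lambda>k. fourier_coeff (wick_eps M \<xi> \<rho> \<epsilon> \<omega>) k - W \<omega> k) > ennreal \<eta>})
          \<longlongrightarrow> 0) (at_right 0))"

section \<open>The Anderson form\<close>

text \<open>
  Here \<open>X\<close>, \<open>W\<close> and the real number \<open>z\<close> are realisations of the field, of its Wick square and of
  \<open>\<xi>\<^sub>0\<close>.
\<close>

definition anderson_form ::
    "(real \<times> real \<Rightarrow> real) \<Rightarrow> (real \<times> real \<Rightarrow> real) \<Rightarrow> (real \<times> real \<Rightarrow> real) \<Rightarrow> distribution \<Rightarrow> real
      \<Rightarrow> (real \<times> real \<Rightarrow> real) \<Rightarrow> (real \<times> real \<Rightarrow> real) \<Rightarrow> real" where
  "anderson_form \<phi> \<theta> X W z u1 u2 =
     (let v1 = (\<lambda>x. exp (- X x) * u1 x); v2 = (\<lambda>x. exp (- X x) * u2 x)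
      in (LINT x|torus. (\<Sum>b\<in>Basis. weak_deriv b v1 x * weak_deriv b v2 x) * exp (2 * X x))
         - bracket \<phi> \<theta> W (\<lambda>x. v1 x * v2 x * exp (2 * X x))
         + z * (LINT x|torus. v1 x * v2 x * exp (2 * X x)))"

definition form_domain :: "(real \<times> real \<Rightarrow> real) \<Rightarrow> (real \<times> real \<Rightarrow> real) set" where
  "form_domain X = (\<lambda>v x. exp (X x) * v x) ` H1"

definition form_norm :: "(real \<times> real \<Rightarrow> real) \<Rightarrow> (real \<times> real \<Rightarrow> real) \<Rightarrow> real" where
  "form_norm X u = sqrt ((L2_norm u)\<^sup>2 + (H1_norm (\<lambda>x. exp (- X x) * u x))\<^sup>2)"

end

theory Submission
  imports Defs
begin

text \<open>
  The proof works with Fourier coefficients only. Almost surely \<open>X\<close> agrees almost everywhere with a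
  bounded function whose increments over dyadic steps \<open>h\<close> are \<open>O(h\<^sup>1\<^sup>/\<^sup>8)\<close>: the fourth moment of a
  dyadic block of \<open>X\<close> (or of its increments) controls its supremum, because a trigonometric polynomial
  \<open>P\<close> of degree \<open>N\<close> satisfies \<open>\<parallel>P\<parallel>\<^sub>\<infinity>\<^sup>4 \<le> (4N + 1)\<^sup>2 \<parallel>P\<parallel>\<^sub>4\<^sup>4\<close>. Hence \<open>exp (2X)\<close> is bounded above and
  below, which settles the gradient term and the term with \<open>\<xi>\<^sub>0\<close>.

  For the Wick square, the Besov bound gives \<open>\<Sum>\<^bsub>\<bar>k\<bar> \<le> 2\<^sup>m\<^esub> \<bar>W\<^sub>k\<bar>\<^sup>2 = O(2\<^sup>m\<^sup>/\<^sup>8)\<close>, since the mollified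
  Wick squares are bounded functions. On the other hand, a function in \<open>H\<^sup>1\<close> lies in \<open>H\<^sup>3\<^sup>/\<^sup>4 \<subseteq> L\<^sup>4\<close>, so that
  the increments of \<open>f = v\<^sub>1 v\<^sub>2 exp (2X)\<close> over the step \<open>2\<^sup>-\<^sup>m\<close> are \<open>O(2\<^sup>-\<^sup>m\<^sup>/\<^sup>8)\<close> in \<open>L\<^sup>2\<close>, which bounds the
  Fourier coefficients of \<open>f\<close> with \<open>\<bar>k\<bar> \<approx> 2\<^sup>m\<close>. Summing over \<open>m\<close> bounds the bracket. Since one of the two
  factors is only measured in \<open>H\<^sup>3\<^sup>/\<^sup>4\<close>, interpolation between \<open>L\<^sup>2\<close> and \<open>H\<^sup>1\<close> makes the bracket a small
  multiple of \<open>\<parallel>v\<parallel>\<^sup>2\<^bsub>H\<^sup>1\<^esub>\<close> up to a multiple of \<open>\<parallel>v\<parallel>\<^sup>2\<^bsub>L\<^sup>2\<^esub>\<close>.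
\<close>

section \<open>Trigonometric polynomials on the torus\<close>

text \<open>The data are awkward: \<open>W\<close> is given only through a limit in probability, and
  \<open>X\<close> only as a class of functions with prescribed coefficients. Convergence in
  probability alone supplies the regularity of \<open>W\<close>: for almost every realisation there
  is one \<epsilon> at which the mollified Wick square, a bounded function, differs from
  \<open>W\<close> by a distribution of Besov norm at most 1. Past that point the argument is
  deterministic. All rates are counted in powers of \<open>qr\<close>. Up to constants, block m of
  \<open>W\<close> has l2 size at most \<open>qr\<close> to the power -m/2, and block m of the
  product has l2 size at most \<open>qr ^ m\<close>, so the pairing is dominated by a geometric
  series of ratio \<open>sqrt qr\<close>. Increments are the tool because translation acts
  diagonally on Fourier coefficients while the increment of a product obeys an exact product rule.
  The index 3/4 lies strictly between 1/2, the threshold for the embedding into L4 in dimension two,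
  and 1: the distance to 1 pays for the increments in one factor and for the interpolation in the
  other, and the latter makes the bracket a small perturbation.\<close>

definition trig :: "(int \<times> int) set \<Rightarrow> (int \<times> int \<Rightarrow> complex) \<Rightarrow> real \<times> real \<Rightarrow> complex" where
  "trig A c x = (\<Sum>k\<in>A. c k * cis (freq k \<bullet> x))"

text \<open>Complex-valued version of \<open>fourier_coeff\<close>; truncated Fourier series, even
  of real functions, are handled as complex-valued polynomials.\<close>

definition fcoef :: "(real \<times> real \<Rightarrow> complex) \<Rightarrow> int \<times> int \<Rightarrow> complex" where
  "fcoef f k = (LINT x|torus. f x * cis (- (freq k \<bullet> x)))"

lemma fourier_coeff_eq_fcoef: "fourier_coeff f k = fcoef (\<lambda>x. complex_of_real (f x)) k"
  by (simp add: fourier_coeff_def fcoef_def)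

section \<open>Normalised Lebesgue measure on the fundamental domain\<close>

lemma emeasure_fundamental_domain:
  "emeasure lborel ({0..<2 * pi} \<times> {0..<2 * pi} :: (real \<times> real) set) = ennreal (4 * pi\<^sup>2)"
proof -
  have "emeasure lborel ({0..<2 * pi} \<times> {0..<2 * pi} :: (real \<times> real) set)
      = emeasure (lborel \<Otimes>\<^sub>M lborel) ({0..<2 * pi} \<times> {0..<2 * pi} :: (real \<times> real) set)"
    by (simp add: lborel_prod)
  also have "\<dots> = ennreal (2 * pi) * ennreal (2 * pi)"
    by (subst lborel.emeasure_pair_measure_Times) auto
  finally show ?thesis
    by (simp add: power2_eq_square mult_ac flip: ennreal_mult)
qed

lemma prob_space_torus: "prob_space torus"
  unfolding torus_def
  by (rule prob_space_uniform_measure) (auto simp: emeasure_fundamental_domain)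

interpretation torus: prob_space torus
  by (rule prob_space_torus)

lemma space_torus [simp]: "space torus = UNIV"
  by (simp add: torus_def)

lemma sets_torus [simp, measurable_cong]: "sets torus = sets borel"
  by (simp add: torus_def)

lemma borel_measurable_torus [simp]: "borel_measurable torus = borel_measurable borel"
  by (intro measurable_cong_sets) auto

lemma fundamental_domain_borel [measurable]:
  "{0..<2 * pi} \<times> {0..<2 * pi} \<in> sets (borel :: (real \<times> real) measure)"
  by (simp add: borel_Times)

lemma measurable_cis [measurable]: "cis \<in> borel_measurable borel"
  by (intro borel_measurable_continuous_onI continuous_intros)

lemma fst_snd_borel_measurable [measurable]:
  "fst \<in> borel_measurable (borel :: (real \<times> real) measure)"
  "snd \<in> borel_measurable (borel :: (real \<times> real) measure)"
  by (intro borel_measurable_continuous_onI continuous_intros)+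

lemma torus_eq_density:
  "torus = density lborel (\<lambda>x. ennreal (indicator ({0..<2 * pi} \<times> {0..<2 * pi}) x / (4 * pi\<^sup>2)))"
  unfolding torus_def uniform_measure_def emeasure_fundamental_domain
  by (intro arg_cong2[where f = density] refl ext)
     (auto simp: indicator_def divide_ennreal simp flip: ennreal_1)

lemma AE_torus_domain: "AE x in torus. x \<in> {0..<2 * pi} \<times> {0..<2 * pi}"
  unfolding torus_def
  by (rule AE_uniform_measureI) auto

lemma AE_torusI: "(AE x in lborel. P x) \<Longrightarrow> AE x in torus. P x"
  unfolding torus_def
  by (rule AE_uniform_measureI) auto

lemma integrable_torus_bounded:
  fixes f :: "real \<times> real \<Rightarrow> 'b::{banach, second_countable_topology}"
  assumes "f \<in> borel_measurable borel" "\<And>x. norm (f x) \<le> B"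
  shows "integrable torus f"
  by (rule torus.integrable_const_bound[where B = B]) (use assms in auto)

lemma freq_add: "freq (k + l) = freq k + freq l"
  by (simp add: freq_def)

lemma freq_diff: "freq (k - l) = freq k - freq l"
  by (simp add: freq_def)

lemma freq_uminus: "freq (- k) = - freq k"
  by (simp add: freq_def)

lemma freq_0 [simp]: "freq 0 = 0"
  by (simp add: freq_def zero_prod_def)

section \<open>Orthogonality of the characters\<close>

lemma interval_integral_cis:
  "(LINT t|lborel. indicator {0..<2 * pi} t *\<^sub>R cis (real_of_int n * t)) = (if n = 0 then 2 * pi else 0)"
proof -
  have "(LINT t|lborel. indicator {0..<2 * pi} t *\<^sub>R cis (real_of_int n * t))
      = (LINT t|lborel. indicator {0..2 * pi} t *\<^sub>R cis (real_of_int n * t))"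
  proof (rule integral_cong_AE)
    show "AE t in lborel. indicator {0..<2 * pi} t *\<^sub>R cis (real_of_int n * t)
        = indicator {0..2 * pi} t *\<^sub>R cis (real_of_int n * t)"
      using AE_lborel_singleton[of "2 * pi"] by eventually_elim (auto simp: indicator_def)
  qed measurable
  also have "\<dots> = (if n = 0 then 2 * pi else 0)"
  proof (cases "n = 0")
    case False
    let ?F = "\<lambda>t. cis (real_of_int n * t) / (\<i> * of_int n)"
    have "(?F has_vector_derivative cis (real_of_int n * t)) (at t within {0..2 * pi})" for t
      using False unfolding cis_conv_exp
      by (auto intro!: derivative_eq_intros has_vector_derivative_real_field simp: field_simps)
    then have "(LINT t|lborel. indicator {0..2 * pi} t *\<^sub>R cis (real_of_int n * t)) = ?F (2 * pi) - ?F 0"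
      by (intro integral_FTC_atLeastAtMost)
         (auto intro!: continuous_intros)
    also have "cis (real_of_int n * (2 * pi)) = 1"
      by (metis cis_multiple_2pi Ints_of_int mult.commute)
    finally show ?thesis using False by simp
  qed (simp add: scaleR_conv_of_real)
  finally show ?thesis .
qed

lemma integral_lborel_prod:
  fixes F G :: "real \<Rightarrow> complex"
  assumes F: "integrable lborel F" and G: "integrable lborel G"
  shows "(LINT x|lborel. F (fst x) * G (snd x)) = (LINT t|lborel. F t) * (LINT t|lborel. G t)"
proof -
  have [measurable]: "F \<in> borel_measurable borel" "G \<in> borel_measurable borel"
    using F G by (auto dest: borel_measurable_integrable)
  have "integrable (lborel \<Otimes>\<^sub>M lborel) (\<lambda>x. F (fst x) * G (snd x))"
  proof (rule lborel_pair.Fubini_integrable)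
    show "integrable lborel (\<lambda>x. LINT y|lborel. norm (F (fst (x, y)) * G (snd (x, y))))"
      using F by (simp add: norm_mult)
    show "AE x in lborel. integrable lborel (\<lambda>y. F (fst (x, y)) * G (snd (x, y)))"
      using G by simp
  qed simp
  then show ?thesis
    using lborel_pair.integral_fst'[of "\<lambda>x. F (fst x) * G (snd x)"] by (simp add: lborel_prod)
qed

lemma integral_torus_prod:
  fixes f g :: "real \<Rightarrow> complex"
  assumes [measurable]: "f \<in> borel_measurable borel" "g \<in> borel_measurable borel"
    and f: "\<And>t. cmod (f t) \<le> 1" and g: "\<And>t. cmod (g t) \<le> 1"
  shows "(LINT x|torus. f (fst x) * g (snd x)) =
    (LINT t|lborel. indicator {0..<2 * pi} t *\<^sub>R f t) * (LINT t|lborel. indicator {0..<2 * pi} t *\<^sub>R g t)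
      / (4 * pi\<^sup>2)"
proof -
  let ?I = "{0..<2 * pi} :: real set"
  let ?h = "\<lambda>x. (indicator ?I (fst x) *\<^sub>R f (fst x)) * (indicator ?I (snd x) *\<^sub>R g (snd x))"
  have int1: "integrable lborel (\<lambda>t. indicator ?I t *\<^sub>R h t)"
    if [measurable]: "h \<in> borel_measurable borel" and "\<And>t. cmod (h t) \<le> 1" for h :: "real \<Rightarrow> complex"
  proof (rule Bochner_Integration.integrable_bound[of _ "indicator ?I :: real \<Rightarrow> real"])
    show "AE t in lborel. norm (indicator ?I t *\<^sub>R h t) \<le> norm (indicator ?I t :: real)"
      using that by (auto simp: indicator_def)
  qed (auto intro!: integrable_real_indicator)
  have "(LINT x|torus. f (fst x) * g (snd x)) =
      (LINT x|lborel. (indicator (?I \<times> ?I) x / (4 * pi\<^sup>2)) *\<^sub>R (f (fst x) * g (snd x)))"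
    unfolding torus_eq_density by (subst integral_density) auto
  also have "\<dots> = (LINT x|lborel. ?h x / (4 * pi\<^sup>2))"
    by (intro Bochner_Integration.integral_cong)
       (auto simp: indicator_def scaleR_conv_of_real)
  finally show ?thesis
    using integral_lborel_prod[OF int1[OF assms(1) f] int1[OF assms(2) g]] by simp
qed

lemma integral_cis_freq: "(LINT x|torus. cis (freq k \<bullet> x)) = (if k = 0 then 1 else 0)"
proof -
  have "(LINT x|torus. cis (freq k \<bullet> x)) =
     (LINT x|torus. cis (real_of_int (fst k) * fst x) * cis (real_of_int (snd k) * snd x))"
    by (simp add: freq_def inner_prod_def cis_mult)
  also have "\<dots> = (if k = 0 then 1 else 0)"
    by (subst integral_torus_prod)
       (auto simp: interval_integral_cis prod_eq_iff power2_eq_square)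
  finally show ?thesis .
qed

section \<open>Algebra of trigonometric polynomials\<close>

lemma trig_measurable [measurable]: "trig A c \<in> borel_measurable borel"
  unfolding trig_def by measurable

lemma continuous_trig: "continuous_on S (trig A c)"
  unfolding trig_def by (intro continuous_intros)

lemma cmod_trig_le: "cmod (trig A c x) \<le> (\<Sum>k\<in>A. cmod (c k))"
  unfolding trig_def by (rule order_trans[OF norm_sum]) (simp add: norm_mult)

lemma integrable_trig: "integrable torus (trig A c)"
  by (rule integrable_torus_bounded[OF _ cmod_trig_le]) simp

lemma trig_shift: "trig A c (x + h) = trig A (\<lambda>k. c k * cis (freq k \<bullet> h)) x"
  unfolding trig_def by (rule sum.cong) (simp_all add: inner_add_right algebra_simps flip: cis_mult)

lemma trig_add: "trig A c x + trig A d x = trig A (\<lambda>k. c k + d k) x"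
  unfolding trig_def by (simp add: algebra_simps sum.distrib)

lemma trig_diff: "trig A c x - trig A d x = trig A (\<lambda>k. c k - d k) x"
  unfolding trig_def by (simp add: algebra_simps sum_subtractf)

lemma trig_cmult: "a * trig A c x = trig A (\<lambda>k. a * c k) x"
  unfolding trig_def by (simp add: algebra_simps sum_distrib_left)

lemma trig_superset:
  assumes "finite B" "A \<subseteq> B"
  shows "trig A c x = trig B (\<lambda>k. if k \<in> A then c k else 0) x"
proof -
  have "trig A c x = (\<Sum>k\<in>A. (if k \<in> A then c k else 0) * cis (freq k \<bullet> x))"
    unfolding trig_def by (intro sum.cong) auto
  also have "\<dots> = trig B (\<lambda>k. if k \<in> A then c k else 0) x"
    unfolding trig_def using assms by (intro sum.mono_neutral_left) auto
  finally show ?thesis .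
qed

text \<open>The coefficients of a product are a convolution. For \<open>n\<close> in the sumset,
  \<open>n - k\<close> may leave \<open>B\<close>, hence the requirement that \<open>d\<close>
  vanish there.\<close>

lemma trig_mult:
  assumes "finite A" "finite B" and d: "\<And>k. k \<notin> B \<Longrightarrow> d k = 0"
  shows "trig A c x * trig B d x =
    trig ((\<lambda>(k, l). k + l) ` (A \<times> B)) (\<lambda>n. \<Sum>k\<in>A. c k * d (n - k)) x"
proof -
  let ?S = "(\<lambda>(k, l). k + l) ` (A \<times> B)"
  have "trig ?S (\<lambda>n. \<Sum>k\<in>A. c k * d (n - k)) x
      = (\<Sum>k\<in>A. \<Sum>n\<in>?S. c k * d (n - k) * cis (freq n \<bullet> x))"
    unfolding trig_def sum_distrib_right by (rule sum.swap)
  also have "\<dots> = (\<Sum>k\<in>A. \<Sum>l\<in>B. c k * d l * cis (freq (k + l) \<bullet> x))"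
  proof (rule sum.cong[OF refl])
    fix k assume "k \<in> A"
    then have "(\<Sum>l\<in>B. c k * d l * cis (freq (k + l) \<bullet> x))
        = (\<Sum>n\<in>(\<lambda>l. k + l) ` B. c k * d (n - k) * cis (freq n \<bullet> x))"
      by (subst sum.reindex) (auto simp: inj_on_def)
    also have "\<dots> = (\<Sum>n\<in>?S. c k * d (n - k) * cis (freq n \<bullet> x))"
    proof (rule sum.mono_neutral_left)
      show "\<forall>n\<in>?S - (\<lambda>l. k + l) ` B. c k * d (n - k) * cis (freq n \<bullet> x) = 0"
      proof
        fix n assume "n \<in> ?S - (\<lambda>l. k + l) ` B"
        then have "n - k \<notin> B" by (metis DiffD2 add_diff_cancel_left' diff_add_cancel imageI add.commute)
        then show "c k * d (n - k) * cis (freq n \<bullet> x) = 0" by (simp add: d)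
      qed
    qed (use assms \<open>k \<in> A\<close> in auto)
    finally show "(\<Sum>n\<in>?S. c k * d (n - k) * cis (freq n \<bullet> x))
        = (\<Sum>l\<in>B. c k * d l * cis (freq (k + l) \<bullet> x))" ..
  qed
  also have "\<dots> = trig A c x * trig B d x"
    unfolding trig_def sum_product
    by (intro sum.cong refl) (simp add: freq_add inner_add_left mult_ac flip: cis_mult)
  finally show ?thesis ..
qed

lemma trig_union_mult:
  assumes "finite A" "finite B"
  obtains S e where "finite S" "\<And>x. trig A c x * trig B d x = trig S e x"
proof -
  let ?d = "\<lambda>k. if k \<in> B then d k else 0"
  have "trig B d x = trig B ?d x" for x
    unfolding trig_def by (intro sum.cong) auto
  then show ?thesis
    using trig_mult[OF assms, of ?d c] assms by (intro that) auto
qed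

lemma trig_union_add:
  assumes "finite A" "finite B"
  obtains S e where "finite S" "\<And>x. trig A c x + trig B d x = trig S e x"
proof (rule that)
  show "trig A c x + trig B d x
      = trig (A \<union> B) (\<lambda>k. (if k \<in> A then c k else 0) + (if k \<in> B then d k else 0)) x" for x
    using trig_superset[of "A \<union> B" A c x] trig_superset[of "A \<union> B" B d x] assms
    by (simp add: trig_add)
qed (use assms in auto)

lemma fcoef_trig:
  assumes "finite A"
  shows "fcoef (trig A c) k = (if k \<in> A then c k else 0)"
proof -
  have "fcoef (trig A c) k = (LINT x|torus. (\<Sum>l\<in>A. c l * cis (freq (l - k) \<bullet> x)))"
    unfolding fcoef_def trig_def sum_distrib_right
    by (intro Bochner_Integration.integral_cong sum.cong refl)
       (simp add: freq_diff inner_diff_left mult.assoc cis_mult)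
  also have "\<dots> = (\<Sum>l\<in>A. c l * (LINT x|torus. cis (freq (l - k) \<bullet> x)))"
    by (subst Bochner_Integration.integral_sum)
       (auto intro!: integrable_mult_right integrable_torus_bounded[where B = 1])
  also have "\<dots> = (\<Sum>l\<in>A. if l = k then c l else 0)"
    by (intro sum.cong) (simp_all add: integral_cis_freq)
  also have "\<dots> = (if k \<in> A then c k else 0)"
    using assms by simp
  finally show ?thesis .
qed

section \<open>Square-integrable functions and the Cauchy-Schwarz inequality\<close>

definition sq_int :: "(real \<times> real \<Rightarrow> complex) \<Rightarrow> bool" where
  "sq_int f \<longleftrightarrow> f \<in> borel_measurable borel \<and> integrable torus (\<lambda>x. (cmod (f x))\<^sup>2)"

lemma sq_int_measurable [measurable_dest]: "sq_int f \<Longrightarrow> f \<in> borel_measurable borel"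
  by (simp add: sq_int_def)

lemma le_one_plus_square: "(t::real) \<le> 1 + t\<^sup>2"
proof -
  have "t \<le> (1 + t\<^sup>2) / 2"
    using zero_le_power2[of "t - 1"] unfolding power2_diff by simp
  also have "\<dots> \<le> 1 + t\<^sup>2" by simp
  finally show ?thesis .
qed

lemma sq_int_integrable:
  assumes "sq_int f" shows "integrable torus f"
proof (rule Bochner_Integration.integrable_bound)
  show "AE x in torus. cmod (f x) \<le> norm (1 + (cmod (f x))\<^sup>2)"
    using le_one_plus_square by (auto intro!: AE_I2 order_trans[OF _ abs_ge_self])
qed (use assms in \<open>auto simp: sq_int_def\<close>)

lemma sq_int_bounded:
  assumes [measurable]: "f \<in> borel_measurable borel" and "\<And>x. cmod (f x) \<le> B"
  shows "sq_int f"
  unfolding sq_int_def using assms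
  by (auto intro!: integrable_torus_bounded[where B = "B\<^sup>2"] power_mono)

lemma sq_int_trig [simp]: "sq_int (trig A c)"
  by (rule sq_int_bounded[OF _ cmod_trig_le]) simp

lemma integrable_sq_int_mult:
  assumes f: "sq_int f" and g: "sq_int g"
  shows "integrable torus (\<lambda>x. f x * g x)"
proof (rule Bochner_Integration.integrable_bound)
  show "integrable torus (\<lambda>x. (cmod (f x))\<^sup>2 + (cmod (g x))\<^sup>2)"
    using assms by (simp add: sq_int_def)
  show "(\<lambda>x. f x * g x) \<in> borel_measurable torus"
    using f g by (auto simp: sq_int_def)
  have "a * b \<le> a\<^sup>2 + b\<^sup>2" for a b :: real
    using zero_le_power2[of "a - b"] zero_le_power2[of "a + b"] by (simp add: power2_eq_square algebra_simps)
  then show "AE x in torus. cmod (f x * g x) \<le> norm ((cmod (f x))\<^sup>2 + (cmod (g x))\<^sup>2)"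
    by (auto simp: norm_mult)
qed

lemma sq_int_cnj: "sq_int f \<Longrightarrow> sq_int (\<lambda>x. cnj (f x))"
  unfolding sq_int_def by (auto intro!: borel_measurable_continuous_on[OF continuous_on_cnj[OF continuous_on_id]])

lemma sum_sq_le: "(cmod (a + b))\<^sup>2 \<le> 2 * (cmod a)\<^sup>2 + 2 * (cmod b)\<^sup>2"
proof -
  have "(cmod (a + b))\<^sup>2 \<le> (cmod a + cmod b)\<^sup>2"
    by (intro power_mono norm_triangle_ineq) simp
  also have "\<dots> \<le> 2 * (cmod a)\<^sup>2 + 2 * (cmod b)\<^sup>2"
    using zero_le_power2[of "cmod a - cmod b"] by (simp add: power2_eq_square algebra_simps)
  finally show ?thesis .
qed

lemma sq_int_add:
  assumes "sq_int f" "sq_int g" shows "sq_int (\<lambda>x. f x + g x)"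
proof -
  have [measurable]: "f \<in> borel_measurable borel" "g \<in> borel_measurable borel"
    using assms by (auto simp: sq_int_def)
  have "integrable torus (\<lambda>x. (cmod (f x + g x))\<^sup>2)"
  proof (rule Bochner_Integration.integrable_bound)
    show "integrable torus (\<lambda>x. 2 * (cmod (f x))\<^sup>2 + 2 * (cmod (g x))\<^sup>2)"
      using assms by (auto simp: sq_int_def)
    show "AE x in torus. norm ((cmod (f x + g x))\<^sup>2) \<le> norm (2 * (cmod (f x))\<^sup>2 + 2 * (cmod (g x))\<^sup>2)"
      using sum_sq_le by (auto intro!: AE_I2 order_trans[OF _ abs_ge_self])
  qed auto
  then show ?thesis by (simp add: sq_int_def)
qed

lemma sq_int_mult_bounded:
  assumes f: "sq_int f" and [measurable]: "g \<in> borel_measurable borel" and g: "\<And>x. cmod (g x) \<le> B"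
  shows "sq_int (\<lambda>x. f x * g x)"
proof -
  have [measurable]: "f \<in> borel_measurable borel" using f by (simp add: sq_int_def)
  have "integrable torus (\<lambda>x. (cmod (f x * g x))\<^sup>2)"
  proof (rule Bochner_Integration.integrable_bound)
    show "integrable torus (\<lambda>x. B\<^sup>2 * (cmod (f x))\<^sup>2)"
      using f by (auto simp: sq_int_def)
    show "AE x in torus. norm ((cmod (f x * g x))\<^sup>2) \<le> norm (B\<^sup>2 * (cmod (f x))\<^sup>2)"
    proof (intro AE_I2)
      fix x
      have "(cmod (g x))\<^sup>2 * (cmod (f x))\<^sup>2 \<le> B\<^sup>2 * (cmod (f x))\<^sup>2"
        by (intro mult_right_mono power_mono g) auto
      then show "norm ((cmod (f x * g x))\<^sup>2) \<le> norm (B\<^sup>2 * (cmod (f x))\<^sup>2)"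
        by (simp add: norm_mult power_mult_distrib mult.commute)
    qed
  qed auto
  then show ?thesis by (simp add: sq_int_def)
qed

lemma sq_int_diff: "sq_int f \<Longrightarrow> sq_int g \<Longrightarrow> sq_int (\<lambda>x. f x - g x)"
  using sq_int_add[of f "\<lambda>x. g x * (-1)"] sq_int_mult_bounded[of g "\<lambda>_. -1" 1] by simp

lemma integral_cauchy_schwarz:
  assumes f: "sq_int f" and g: "sq_int g"
  shows "(cmod (LINT x|torus. f x * g x))\<^sup>2
    \<le> (LINT x|torus. (cmod (f x))\<^sup>2) * (LINT x|torus. (cmod (g x))\<^sup>2)"
proof -
  let ?a = "LINT x|torus. (cmod (f x))\<^sup>2" and ?b = "LINT x|torus. (cmod (g x))\<^sup>2"
  let ?i = "cmod (LINT x|torus. f x * g x)"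
  have a: "?a \<ge> 0" and b: "?b \<ge> 0" by simp_all
  have not_le_double: "\<not> 2 * (r + 1) \<le> r" if "r \<ge> 0" for r :: real
    using that by (smt (verit))
  \<comment> \<open>Integrated form of (s|f| - t|g|)^2 \<ge> 0. The free parameters replace any
    normalisation of \<open>f\<close> and \<open>g\<close>: the main case takes s^2 and t^2 to be
    the two integrals, exchanged.\<close>
  have *: "2 * (s * t) * ?i \<le> s\<^sup>2 * ?a + t\<^sup>2 * ?b" if "s \<ge> 0" "t \<ge> 0" for s t :: real
  proof -
    have "?i \<le> (LINT x|torus. cmod (f x * g x))"
      by (rule integral_norm_bound)
    then have "2 * (s * t) * ?i \<le> 2 * (s * t) * (LINT x|torus. cmod (f x * g x))"
      using that by (intro mult_left_mono) auto
    also have "\<dots> = (LINT x|torus. 2 * (s * t) * cmod (f x * g x))"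
      by simp
    also have "\<dots> \<le> (LINT x|torus. s\<^sup>2 * (cmod (f x))\<^sup>2 + t\<^sup>2 * (cmod (g x))\<^sup>2)"
    proof (rule integral_mono)
      show "2 * (s * t) * cmod (f x * g x) \<le> s\<^sup>2 * (cmod (f x))\<^sup>2 + t\<^sup>2 * (cmod (g x))\<^sup>2" for x
        using zero_le_power2[of "s * cmod (f x) - t * cmod (g x)"]
        by (simp add: power2_eq_square algebra_simps norm_mult)
    qed (use f g integrable_norm[OF integrable_sq_int_mult[OF f g]] in \<open>auto simp: sq_int_def norm_mult\<close>)
    also have "\<dots> = s\<^sup>2 * ?a + t\<^sup>2 * ?b"
      using f g by (subst Bochner_Integration.integral_add) (auto simp: sq_int_def)
    finally show ?thesis .
  qed
  show ?thesis
  proof (cases "?a = 0 \<or> ?b = 0")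
    case False
    then have "?a > 0" "?b > 0" using a b by linarith+
    then have "2 * sqrt (?a * ?b) * ?i \<le> 2 * (?a * ?b)"
      using *[of "sqrt ?b" "sqrt ?a"] by (simp add: real_sqrt_mult mult_ac)
    also have "\<dots> = 2 * sqrt (?a * ?b) * sqrt (?a * ?b)"
      using a b by simp
    finally have "?i \<le> sqrt (?a * ?b)"
      using mult_pos_pos[OF \<open>?a > 0\<close> \<open>?b > 0\<close>] by (simp only: mult_le_cancel_left_pos real_sqrt_gt_zero mult_pos_pos zero_less_numeral)
    then have "?i\<^sup>2 \<le> (sqrt (?a * ?b))\<^sup>2"
      by (intro power_mono) auto
    then show ?thesis using a b by simp
  next
    case True
    \<comment> \<open>If one of the integrals vanishes, the parameter in front of it can be made so
      large that the left-hand side exceeds the remaining term; the quotient by \<open>?i\<close>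
      below is large enough.\<close>
    have "?i = 0"
    proof (rule ccontr)
      assume "?i \<noteq> 0"
      then have i: "?i > 0" by simp
      show False
      proof (cases "?a = 0")
        case True
        have "2 * ((?b + 1) / ?i * 1) * ?i \<le> ?b"
          using *[of "(?b + 1) / ?i" 1] True b i by simp
        then have "2 * (?b + 1) \<le> ?b" using i by simp
        then show False using b not_le_double by blast
      next
        case False
        then have "2 * (1 * ((?a + 1) / ?i)) * ?i \<le> ?a"
          using *[of 1 "(?a + 1) / ?i"] True a i by simp
        then have "2 * (?a + 1) \<le> ?a" using i by simp
        then show False using a not_le_double by blast
      qed
    qed
    then show ?thesis by simp
  qed
qed

section \<open>Fourier coefficients, Parseval's identity and Bessel's inequality\<close>

lemma integrable_mult_cis:
  assumes f: "integrable torus f" and [measurable]: "g \<in> borel_measurable borel"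
  shows "integrable torus (\<lambda>x. f x * cis (g x))"
proof (rule Bochner_Integration.integrable_bound[OF f])
  have [measurable]: "f \<in> borel_measurable borel" using borel_measurable_integrable[OF f] by simp
  show "(\<lambda>x. f x * cis (g x)) \<in> borel_measurable torus" by measurable
qed (simp add: norm_mult)

lemma fcoef_diff: "integrable torus f \<Longrightarrow> integrable torus g \<Longrightarrow> fcoef (\<lambda>x. f x - g x) k = fcoef f k - fcoef g k"
  unfolding fcoef_def left_diff_distrib by (intro Bochner_Integration.integral_diff integrable_mult_cis) auto

lemma cmod_fcoef_le: "integrable torus f \<Longrightarrow> cmod (fcoef f k) \<le> (LINT x|torus. cmod (f x))"
  unfolding fcoef_def using integral_norm_bound[of torus "\<lambda>x. f x * cis (- (freq k \<bullet> x))"]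
  by (simp add: norm_mult)

lemma integral_mult_cnj_trig:
  assumes "integrable torus f"
  shows "(LINT x|torus. f x * cnj (trig A c x)) = (\<Sum>k\<in>A. fcoef f k * cnj (c k))"
proof -
  have "(LINT x|torus. f x * cnj (trig A c x)) = (LINT x|torus. (\<Sum>k\<in>A. (f x * cis (- (freq k \<bullet> x))) * cnj (c k)))"
    by (simp add: trig_def sum_distrib_left cis_cnj mult_ac)
  also have "\<dots> = (\<Sum>k\<in>A. LINT x|torus. (f x * cis (- (freq k \<bullet> x))) * cnj (c k))"
    using assms by (intro Bochner_Integration.integral_sum integrable_mult_left integrable_mult_cis) auto
  also have "\<dots> = (\<Sum>k\<in>A. fcoef f k * cnj (c k))"
    by (simp add: fcoef_def)
  finally show ?thesis .
qed

lemma parseval_trig: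
  assumes "finite A"
  shows "(LINT x|torus. (cmod (trig A c x))\<^sup>2) = (\<Sum>k\<in>A. (cmod (c k))\<^sup>2)"
proof -
  have "complex_of_real (LINT x|torus. (cmod (trig A c x))\<^sup>2) = (LINT x|torus. trig A c x * cnj (trig A c x))"
    by (simp only: complex_norm_square integral_complex_of_real[symmetric])
  also have "\<dots> = (\<Sum>k\<in>A. c k * cnj (c k))"
    using assms by (subst integral_mult_cnj_trig[OF integrable_trig]) (auto simp: fcoef_trig)
  also have "\<dots> = complex_of_real (\<Sum>k\<in>A. (cmod (c k))\<^sup>2)"
    by (simp add: complex_norm_square del: of_real_power)
  finally show ?thesis
    using of_real_eq_iff by blast
qed

text \<open>The square is completed coefficient by coefficient, so \<open>c\<close> enters through
  the last sum only. Bessel's inequality and the best approximation property are both read off from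
  this identity.\<close>

lemma integral_cmod_diff_trig:
  assumes f: "sq_int f" and A: "finite A"
  shows "(LINT x|torus. (cmod (f x - trig A c x))\<^sup>2)
    = (LINT x|torus. (cmod (f x))\<^sup>2) - (\<Sum>k\<in>A. (cmod (fcoef f k))\<^sup>2) + (\<Sum>k\<in>A. (cmod (fcoef f k - c k))\<^sup>2)"
proof -
  have sq: "(cmod (a - b))\<^sup>2 = (cmod a)\<^sup>2 - 2 * Re (a * cnj b) + (cmod b)\<^sup>2" for a b
    unfolding cmod_power2 by (simp add: power2_eq_square algebra_simps)
  have int: "integrable torus (\<lambda>x. f x * cnj (trig A c x))"
    using f by (intro integrable_sq_int_mult sq_int_cnj) auto
  have "(LINT x|torus. (cmod (f x - trig A c x))\<^sup>2) =
     (LINT x|torus. (cmod (f x))\<^sup>2 - 2 * Re (f x * cnj (trig A c x)) + (cmod (trig A c x))\<^sup>2)"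
    by (simp add: sq)
  also have "\<dots> = (LINT x|torus. (cmod (f x))\<^sup>2) - (LINT x|torus. 2 * Re (f x * cnj (trig A c x)))
     + (LINT x|torus. (cmod (trig A c x))\<^sup>2)"
    using f integrable_mult_right[OF integrable_Re[OF int], of 2] sq_int_trig[of A c] unfolding sq_int_def
    by (simp only: Bochner_Integration.integral_add Bochner_Integration.integral_diff
        Bochner_Integration.integrable_diff)
  also have "(LINT x|torus. 2 * Re (f x * cnj (trig A c x))) = 2 * Re (\<Sum>k\<in>A. fcoef f k * cnj (c k))"
    by (simp only: integral_Re[OF int] integral_mult_right_zero
        integral_mult_cnj_trig[OF sq_int_integrable[OF f], symmetric])
  also have "(LINT x|torus. (cmod (trig A c x))\<^sup>2) = (\<Sum>k\<in>A. (cmod (c k))\<^sup>2)"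
    using A by (rule parseval_trig)
  finally show ?thesis
    by (simp add: sq sum.distrib sum_subtractf sum_distrib_left)
qed

lemma bessel:
  assumes "sq_int f" "finite A"
  shows "(\<Sum>k\<in>A. (cmod (fcoef f k))\<^sup>2) \<le> (LINT x|torus. (cmod (f x))\<^sup>2)"
proof -
  have "0 \<le> (LINT x|torus. (cmod (f x - trig A (fcoef f) x))\<^sup>2)" by simp
  also have "\<dots> = (LINT x|torus. (cmod (f x))\<^sup>2) - (\<Sum>k\<in>A. (cmod (fcoef f k))\<^sup>2)"
    using integral_cmod_diff_trig[OF assms] by simp
  finally show ?thesis by simp
qed

lemma fourier_best_approx:
  assumes f: "sq_int f" and A: "finite A" "B \<subseteq> A"
  shows "(LINT x|torus. (cmod (f x - trig A (fcoef f) x))\<^sup>2) \<le> (LINT x|torus. (cmod (f x - trig B c x))\<^sup>2)"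
proof -
  have "(\<Sum>k\<in>B. (cmod (fcoef f k))\<^sup>2) \<le> (\<Sum>k\<in>A. (cmod (fcoef f k))\<^sup>2)"
    using A by (intro sum_mono2) auto
  moreover have "finite B" using A finite_subset by blast
  ultimately show ?thesis
    using integral_cmod_diff_trig[OF f, of A "fcoef f"] integral_cmod_diff_trig[OF f, of B c] A
    by (simp add: sum_nonneg add_increasing2)
qed

section \<open>Completeness of the trigonometric system\<close>

lemma prob_torus_UNIV [simp]: "measure torus UNIV = 1"
  using torus.prob_space by simp

text \<open>These are exactly the continuous functions of period 2 pi in both variables. The
  encoding makes them translatable on the whole plane and reduces statements about their
  coefficients to finite sums.\<close>

definition unif_trig :: "(real \<times> real \<Rightarrow> complex) \<Rightarrow> bool" where
  "unif_trig f \<longleftrightarrow> (\<forall>\<epsilon>>0. \<exists>A c. finite A \<and> (\<forall>x. cmod (f x - trig A c x) \<le> \<epsilon>))"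

lemma unif_trigE:
  assumes "unif_trig f" "\<epsilon> > 0"
  obtains A c where "finite A" "\<And>x. cmod (f x - trig A c x) \<le> \<epsilon>"
  using assms unfolding unif_trig_def by metis

lemma unif_trig_trig: "finite A \<Longrightarrow> unif_trig (trig A c)"
  unfolding unif_trig_def by (intro allI impI exI[of _ A] exI[of _ c]) auto

lemma unif_trig_limit:
  assumes "\<And>\<epsilon>. \<epsilon> > 0 \<Longrightarrow> \<exists>g. unif_trig g \<and> (\<forall>x. cmod (f x - g x) \<le> \<epsilon>)"
  shows "unif_trig f"
  unfolding unif_trig_def
proof (intro allI impI)
  fix \<epsilon> :: real assume "\<epsilon> > 0"
  then obtain g where g: "unif_trig g" "\<And>x. cmod (f x - g x) \<le> \<epsilon> / 2"
    using assms[of "\<epsilon> / 2"] by auto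
  obtain A c where A: "finite A" "\<And>x. cmod (g x - trig A c x) \<le> \<epsilon> / 2"
    using unif_trigE[OF g(1), of "\<epsilon> / 2"] \<open>\<epsilon> > 0\<close> by auto
  have "cmod (f x - trig A c x) \<le> \<epsilon>" for x
    using norm_triangle_ineq[of "f x - g x" "g x - trig A c x"] g(2)[of x] A(2)[of x] by simp
  then show "\<exists>A c. finite A \<and> (\<forall>x. cmod (f x - trig A c x) \<le> \<epsilon>)"
    using A(1) by blast
qed

lemma unif_trig_bounded:
  assumes "unif_trig f"
  obtains B where "B > 0" "\<And>x. cmod (f x) \<le> B"
proof -
  obtain A c where A: "\<And>x. cmod (f x - trig A c x) \<le> 1"
    using unif_trigE[OF assms zero_less_one] by metis
  show thesis
  proof (rule that)
    show "0 < 1 + (\<Sum>k\<in>A. cmod (c k))"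
      by (intro add_pos_nonneg sum_nonneg) auto
    show "cmod (f x) \<le> 1 + (\<Sum>k\<in>A. cmod (c k))" for x
      using norm_triangle_ineq[of "f x - trig A c x" "trig A c x"] A[of x] cmod_trig_le[of A c x] by simp
  qed
qed

lemma unif_trig_continuous:
  assumes "unif_trig f"
  shows "continuous_on UNIV f"
proof -
  have "\<exists>A c. \<forall>x. cmod (f x - trig A c x) \<le> 1 / real (Suc n)" for n
    using assms unfolding unif_trig_def by (metis of_nat_0_less_iff zero_less_Suc zero_less_divide_1_iff)
  then obtain A c where A: "\<And>n x. cmod (f x - trig (A n) (c n) x) \<le> 1 / real (Suc n)"
    by metis
  have "uniform_limit UNIV (\<lambda>n. trig (A n) (c n)) f sequentially"
  proof (rule uniform_limitI)
    fix e :: real assume "e > 0"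
    then have "\<forall>\<^sub>F n in sequentially. 1 / real (Suc n) < e"
      using LIMSEQ_inverse_real_of_nat by (simp add: inverse_eq_divide order_tendsto_iff)
    then show "\<forall>\<^sub>F n in sequentially. \<forall>x\<in>UNIV. dist (trig (A n) (c n) x) (f x) < e"
      by eventually_elim (metis A dist_commute dist_norm le_less_trans)
  qed
  then show ?thesis
    by (rule uniform_limit_theorem[rotated]) (auto simp: continuous_trig)
qed

lemma unif_trig_measurable [measurable_dest]: "unif_trig f \<Longrightarrow> f \<in> borel_measurable borel"
  using unif_trig_continuous by (rule borel_measurable_continuous_onI)

lemma unif_trig_sq_int: "unif_trig f \<Longrightarrow> sq_int f"
  by (metis unif_trig_bounded sq_int_bounded unif_trig_measurable)

lemma unif_trig_add:
  assumes f: "unif_trig f" and g: "unif_trig g"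
  shows "unif_trig (\<lambda>x. f x + g x)"
  unfolding unif_trig_def
proof (intro allI impI)
  fix \<epsilon> :: real assume "\<epsilon> > 0"
  obtain A c where A: "finite A" "\<And>x. cmod (f x - trig A c x) \<le> \<epsilon> / 2"
    using unif_trigE[OF f, of "\<epsilon> / 2"] \<open>\<epsilon> > 0\<close> by auto
  obtain B d where B: "finite B" "\<And>x. cmod (g x - trig B d x) \<le> \<epsilon> / 2"
    using unif_trigE[OF g, of "\<epsilon> / 2"] \<open>\<epsilon> > 0\<close> by auto
  obtain S e where S: "finite S" "\<And>x. trig A c x + trig B d x = trig S e x"
    using trig_union_add[OF A(1) B(1)] by metis
  have "cmod (f x + g x - trig S e x) \<le> \<epsilon>" for x
    using norm_triangle_ineq[of "f x - trig A c x" "g x - trig B d x"] A(2)[of x] B(2)[of x]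
    by (simp add: S(2)[symmetric] algebra_simps)
  then show "\<exists>A c. finite A \<and> (\<forall>x. cmod (f x + g x - trig A c x) \<le> \<epsilon>)"
    using S(1) by blast
qed

lemma unif_trig_mult:
  assumes f: "unif_trig f" and g: "unif_trig g"
  shows "unif_trig (\<lambda>x. f x * g x)"
  unfolding unif_trig_def
proof (intro allI impI)
  fix \<epsilon> :: real assume "\<epsilon> > 0"
  obtain Bf where Bf: "Bf > 0" "\<And>x. cmod (f x) \<le> Bf" using unif_trig_bounded[OF f] by metis
  obtain Bg where Bg: "Bg > 0" "\<And>x. cmod (g x) \<le> Bg" using unif_trig_bounded[OF g] by metis
  \<comment> \<open>The error of the product is at most Bf \<eta> + \<eta> Bg + \<eta>^2, and \<eta>
    \<le> 1 lets the quadratic term count as \<eta>.\<close>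
  define \<eta> where "\<eta> = min 1 (\<epsilon> / (Bf + Bg + 1))"
  have "\<eta> \<le> \<epsilon> / (Bf + Bg + 1)" by (simp add: \<eta>_def)
  then have \<eta>: "\<eta> > 0" "\<eta> \<le> 1" "\<eta> * (Bf + Bg + 1) \<le> \<epsilon>"
    using \<open>\<epsilon> > 0\<close> Bf(1) Bg(1) pos_le_divide_eq[of "Bf + Bg + 1" \<eta> \<epsilon>] by (auto simp: \<eta>_def)
  obtain A c where A: "finite A" "\<And>x. cmod (f x - trig A c x) \<le> \<eta>"
    using unif_trigE[OF f \<eta>(1)] by auto
  obtain B d where B: "finite B" "\<And>x. cmod (g x - trig B d x) \<le> \<eta>"
    using unif_trigE[OF g \<eta>(1)] by auto
  obtain S e where S: "finite S" "\<And>x. trig A c x * trig B d x = trig S e x"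
    using trig_union_mult[OF A(1) B(1)] by metis
  have "cmod (f x * g x - trig S e x) \<le> \<epsilon>" for x
  proof -
    let ?a = "f x - trig A c x" and ?b = "g x - trig B d x"
    have "f x * g x - trig S e x = f x * ?b + ?a * g x - ?a * ?b"
      by (simp add: S(2)[symmetric] algebra_simps)
    then have "cmod (f x * g x - trig S e x) \<le> cmod (f x) * cmod ?b + cmod ?a * cmod (g x) + cmod ?a * cmod ?b"
      using norm_triangle_ineq4[of "f x * ?b + ?a * g x" "?a * ?b"] norm_triangle_ineq[of "f x * ?b" "?a * g x"]
      by (simp add: norm_mult)
    also have "\<dots> \<le> Bf * \<eta> + \<eta> * Bg + \<eta> * 1"
      using A(2)[of x] B(2)[of x] Bf Bg \<eta> by (intro add_mono mult_mono) (auto intro: order_trans)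
    also have "\<dots> \<le> \<epsilon>" using \<eta>(3) by (simp add: algebra_simps)
    finally show ?thesis .
  qed
  then show "\<exists>A c. finite A \<and> (\<forall>x. cmod (f x * g x - trig A c x) \<le> \<epsilon>)"
    using S(1) by blast
qed

lemma unif_trig_const: "unif_trig (\<lambda>_. a)"
proof -
  have "trig {0} (\<lambda>_. a) = (\<lambda>_. a)" by (rule ext) (simp add: trig_def)
  then show ?thesis using unif_trig_trig[of "{0}" "\<lambda>_. a"] by simp
qed

lemma unif_trig_power: "unif_trig f \<Longrightarrow> unif_trig (\<lambda>x. f x ^ n)"
  by (induction n) (auto intro: unif_trig_mult unif_trig_const)

lemma unif_trig_sum: "finite I \<Longrightarrow> (\<And>i. i \<in> I \<Longrightarrow> unif_trig (f i)) \<Longrightarrow> unif_trig (\<lambda>x. \<Sum>i\<in>I. f i x)"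
  by (induction I rule: finite_induct) (auto intro: unif_trig_add unif_trig_const)

text \<open>By the Weierstrass theorem, \<open>F\<close> is a uniform limit of polynomials on the range of \<open>g\<close>.\<close>

lemma unif_trig_compose:
  fixes F :: "real \<Rightarrow> real"
  assumes g: "unif_trig (\<lambda>x. complex_of_real (g x))" and K: "\<And>x. \<bar>g x\<bar> \<le> K"
    and F: "continuous_on {- K..K} F"
  shows "unif_trig (\<lambda>x. complex_of_real (F (g x)))"
proof (rule unif_trig_limit)
  fix \<epsilon> :: real assume "\<epsilon> > 0"
  then obtain p where p: "real_polynomial_function p" "\<And>t. t \<in> {- K..K} \<Longrightarrow> \<bar>F t - p t\<bar> < \<epsilon>"
    using Stone_Weierstrass_real_polynomial_function[OF compact_Icc F] by metis
  obtain a and n :: nat where "p = (\<lambda>t. \<Sum>i\<le>n. a i * t ^ i)"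
    using real_polynomial_function_imp_sum[OF p(1)] by auto
  then have "unif_trig (\<lambda>x. complex_of_real (p (g x)))"
    by (auto intro!: unif_trig_sum unif_trig_mult unif_trig_const unif_trig_power g)
  moreover have "cmod (complex_of_real (F (g x)) - complex_of_real (p (g x))) \<le> \<epsilon>" for x
  proof -
    have "\<bar>F (g x) - p (g x)\<bar> < \<epsilon>" by (rule p) (use K[of x] in auto)
    then show ?thesis by (simp flip: of_real_diff)
  qed
  ultimately show "\<exists>h. unif_trig h \<and> (\<forall>x. cmod (complex_of_real (F (g x)) - h x) \<le> \<epsilon>)"
    by blast
qed

lemma unif_trig_shift:
  assumes "unif_trig f"
  shows "unif_trig (\<lambda>x. f (x + h))"
  unfolding unif_trig_def
proof (intro allI impI)
  fix \<epsilon> :: real assume "\<epsilon> > 0"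
  then obtain A c where A: "finite A" "\<And>x. cmod (f x - trig A c x) \<le> \<epsilon>"
    using unif_trigE[OF assms] by auto
  then have "cmod (f (x + h) - trig A (\<lambda>k. c k * cis (freq k \<bullet> h)) x) \<le> \<epsilon>" for x
    by (simp flip: trig_shift)
  then show "\<exists>A c. finite A \<and> (\<forall>x. cmod (f (x + h) - trig A c x) \<le> \<epsilon>)"
    using A(1) by blast
qed

text \<open>The identity is algebraic for trigonometric polynomials, and both sides are continuous
  under uniform convergence. This takes the place of a change of variables, under which the
  fundamental domain would move.\<close>

lemma fcoef_shift:
  assumes f: "unif_trig f"
  shows "fcoef (\<lambda>x. f (x + h)) k = cis (freq k \<bullet> h) * fcoef f k"
proof -
  have *: "cmod (fcoef (\<lambda>x. f (x + h)) k - cis (freq k \<bullet> h) * fcoef f k) \<le> \<epsilon>" if "\<epsilon> > 0" for \<epsilon> :: real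
  proof -
    obtain A c where A: "finite A" "\<And>x. cmod (f x - trig A c x) \<le> \<epsilon> / 2"
      using unif_trigE[OF f, of "\<epsilon> / 2"] \<open>\<epsilon> > 0\<close> by auto
    have close: "cmod (fcoef u k - fcoef v k) \<le> \<epsilon> / 2"
      if "integrable torus u" "integrable torus v" "\<And>x. cmod (u x - v x) \<le> \<epsilon> / 2" for u v
    proof -
      have "cmod (fcoef u k - fcoef v k) \<le> (LINT x|torus. cmod (u x - v x))"
        using that cmod_fcoef_le[of "\<lambda>x. u x - v x" k] by (simp add: fcoef_diff)
      also have "\<dots> \<le> (LINT x|torus. \<epsilon> / 2)"
        using that by (intro integral_mono) auto
      finally show ?thesis by simp
    qed
    let ?d = "\<lambda>k. c k * cis (freq k \<bullet> h)"
    have int: "integrable torus f" "integrable torus (\<lambda>x. f (x + h))"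
      using f unif_trig_shift[OF f, of h] by (auto intro!: sq_int_integrable unif_trig_sq_int)
    have "cmod (fcoef (\<lambda>x. f (x + h)) k - fcoef (trig A ?d) k) \<le> \<epsilon> / 2"
      using A by (intro close int integrable_trig) (simp flip: trig_shift)
    moreover have "fcoef (trig A ?d) k = cis (freq k \<bullet> h) * fcoef (trig A c) k"
      using A by (simp add: fcoef_trig)
    moreover have "cmod (cis (freq k \<bullet> h) * fcoef (trig A c) k - cis (freq k \<bullet> h) * fcoef f k) \<le> \<epsilon> / 2"
    proof -
      have "cmod (cis (freq k \<bullet> h) * (fcoef (trig A c) k - fcoef f k)) = cmod (fcoef f k - fcoef (trig A c) k)"
        by (simp add: norm_mult norm_minus_commute)
      also have "\<dots> \<le> \<epsilon> / 2"
        using A by (intro close int integrable_trig)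
      finally show ?thesis by (simp add: algebra_simps)
    qed
    ultimately show ?thesis
      using norm_triangle_ineq[of "fcoef (\<lambda>x. f (x + h)) k - fcoef (trig A ?d) k"
          "fcoef (trig A ?d) k - cis (freq k \<bullet> h) * fcoef f k"] by simp
  qed
  have "cmod (fcoef (\<lambda>x. f (x + h)) k - cis (freq k \<bullet> h) * fcoef f k) \<le> 0"
    by (rule field_le_epsilon) (unfold add_0, rule *)
  then show ?thesis by simp
qed

section \<open>Density of trigonometric polynomials in L2\<close>

definition trig_approx :: "(real \<times> real \<Rightarrow> complex) \<Rightarrow> bool" where
  "trig_approx f \<longleftrightarrow> sq_int f \<and>
     (\<forall>\<epsilon>>0. \<exists>A c. finite A \<and> (LINT x|torus. (cmod (f x - trig A c x))\<^sup>2) \<le> \<epsilon>)"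

text \<open>Substitute for the triangle inequality of the L2 norm that works with squared norms; the
  factors 2 are the reason for the fractions of \<epsilon> in the limit arguments.\<close>

lemma integral_sq_triangle:
  assumes "sq_int (\<lambda>x. f x - g x)" "sq_int (\<lambda>x. g x - h x)"
  shows "(LINT x|torus. (cmod (f x - h x))\<^sup>2)
    \<le> 2 * (LINT x|torus. (cmod (f x - g x))\<^sup>2) + 2 * (LINT x|torus. (cmod (g x - h x))\<^sup>2)"
proof -
  have "(LINT x|torus. (cmod (f x - h x))\<^sup>2) \<le>
     (LINT x|torus. 2 * (cmod (f x - g x))\<^sup>2 + 2 * (cmod (g x - h x))\<^sup>2)"
  proof (rule integral_mono)
    show "integrable torus (\<lambda>x. (cmod (f x - h x))\<^sup>2)"
      using sq_int_add[OF assms] by (simp add: sq_int_def)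
    show "(cmod (f x - h x))\<^sup>2 \<le> 2 * (cmod (f x - g x))\<^sup>2 + 2 * (cmod (g x - h x))\<^sup>2" for x
      using sum_sq_le[of "f x - g x" "g x - h x"] by simp
  qed (use assms in \<open>auto simp: sq_int_def\<close>)
  also have "\<dots> = 2 * (LINT x|torus. (cmod (f x - g x))\<^sup>2) + 2 * (LINT x|torus. (cmod (g x - h x))\<^sup>2)"
    using assms by (simp add: sq_int_def)
  finally show ?thesis .
qed

lemma trig_approx_limit:
  assumes f: "sq_int f"
    and "\<And>\<epsilon>. \<epsilon> > 0 \<Longrightarrow> \<exists>g. trig_approx g \<and> (LINT x|torus. (cmod (f x - g x))\<^sup>2) \<le> \<epsilon>"
  shows "trig_approx f"
  unfolding trig_approx_def
proof (intro conjI allI impI f)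
  fix \<epsilon> :: real assume "\<epsilon> > 0"
  then obtain g where g: "trig_approx g" "(LINT x|torus. (cmod (f x - g x))\<^sup>2) \<le> \<epsilon> / 4"
    using assms(2)[of "\<epsilon> / 4"] by auto
  then obtain A c where A: "finite A" "(LINT x|torus. (cmod (g x - trig A c x))\<^sup>2) \<le> \<epsilon> / 4"
    using \<open>\<epsilon> > 0\<close> unfolding trig_approx_def by (meson divide_pos_pos zero_less_numeral)
  have "(LINT x|torus. (cmod (f x - trig A c x))\<^sup>2) \<le> \<epsilon>"
    using integral_sq_triangle[of f g "trig A c"] g A f
    by (simp add: sq_int_diff trig_approx_def)
  then show "\<exists>A c. finite A \<and> (LINT x|torus. (cmod (f x - trig A c x))\<^sup>2) \<le> \<epsilon>"
    using A(1) by blast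
qed

lemma trig_approx_sq_int: "trig_approx f \<Longrightarrow> sq_int f"
  by (simp add: trig_approx_def)

lemma trig_approx_trig: "finite A \<Longrightarrow> trig_approx (trig A c)"
  unfolding trig_approx_def by (intro conjI allI impI exI[of _ A] exI[of _ c]) auto

lemma unif_trig_approx:
  assumes "unif_trig f" shows "trig_approx f"
  unfolding trig_approx_def
proof (intro conjI allI impI)
  show f: "sq_int f" using assms by (rule unif_trig_sq_int)
  fix \<epsilon> :: real assume "\<epsilon> > 0"
  then obtain A c where A: "finite A" "\<And>x. cmod (f x - trig A c x) \<le> sqrt \<epsilon>"
    using unif_trigE[OF assms, of "sqrt \<epsilon>"] by auto
  have "(LINT x|torus. (cmod (f x - trig A c x))\<^sup>2) \<le> (LINT x|torus. \<epsilon>)"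
  proof (rule integral_mono)
    show "(cmod (f x - trig A c x))\<^sup>2 \<le> \<epsilon>" for x
      using power_mono[OF A(2)[of x] norm_ge_zero, of 2] \<open>\<epsilon> > 0\<close> by simp
  qed (use sq_int_diff[OF f sq_int_trig] in \<open>auto simp: sq_int_def\<close>)
  then show "\<exists>A c. finite A \<and> (LINT x|torus. (cmod (f x - trig A c x))\<^sup>2) \<le> \<epsilon>"
    using A(1) by auto
qed

lemma trig_approx_add:
  assumes f: "trig_approx f" and g: "trig_approx g"
  shows "trig_approx (\<lambda>x. f x + g x)"
proof (rule trig_approx_limit)
  show "sq_int (\<lambda>x. f x + g x)"
    using f g by (simp add: trig_approx_def sq_int_add)
  fix \<epsilon> :: real assume "\<epsilon> > 0"
  obtain A c where A: "finite A" "(LINT x|torus. (cmod (f x - trig A c x))\<^sup>2) \<le> \<epsilon> / 4"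
    using f \<open>\<epsilon> > 0\<close> unfolding trig_approx_def by (meson divide_pos_pos zero_less_numeral)
  obtain B d where B: "finite B" "(LINT x|torus. (cmod (g x - trig B d x))\<^sup>2) \<le> \<epsilon> / 4"
    using g \<open>\<epsilon> > 0\<close> unfolding trig_approx_def by (meson divide_pos_pos zero_less_numeral)
  obtain S e where S: "finite S" "\<And>x. trig A c x + trig B d x = trig S e x"
    using trig_union_add[OF A(1) B(1)] by metis
  have "(LINT x|torus. (cmod ((f x + g x) - trig S e x))\<^sup>2) \<le> \<epsilon>"
    using integral_sq_triangle[of "\<lambda>x. f x + g x" "\<lambda>x. trig A c x + g x" "trig S e"]
      sq_int_diff[OF trig_approx_sq_int[OF f] sq_int_trig[of A c]]
      sq_int_diff[OF trig_approx_sq_int[OF g] sq_int_trig[of B d]] A B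
    by (simp add: S(2)[symmetric])
  then show "\<exists>h. trig_approx h \<and> (LINT x|torus. (cmod ((f x + g x) - h x))\<^sup>2) \<le> \<epsilon>"
    using trig_approx_trig[OF S(1)] by blast
qed

lemma trig_approx_cmult:
  assumes f: "trig_approx f"
  shows "trig_approx (\<lambda>x. a * f x)"
proof (rule trig_approx_limit)
  show sq: "sq_int (\<lambda>x. a * f x)"
    using sq_int_mult_bounded[OF trig_approx_sq_int[OF f], of "\<lambda>_. a" "cmod a"] by (simp add: mult.commute)
  fix \<epsilon> :: real assume "\<epsilon> > 0"
  then have "\<epsilon> / (1 + (cmod a)\<^sup>2) > 0" by (simp add: add_pos_nonneg)
  then obtain A c where A: "finite A" "(LINT x|torus. (cmod (f x - trig A c x))\<^sup>2) \<le> \<epsilon> / (1 + (cmod a)\<^sup>2)"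
    using f unfolding trig_approx_def by meson
  have "(LINT x|torus. (cmod (a * f x - trig A (\<lambda>k. a * c k) x))\<^sup>2)
      = (cmod a)\<^sup>2 * (LINT x|torus. (cmod (f x - trig A c x))\<^sup>2)"
    by (simp add: trig_cmult[symmetric] right_diff_distrib[symmetric] norm_mult power_mult_distrib)
  also have "\<dots> \<le> (1 + (cmod a)\<^sup>2) * (\<epsilon> / (1 + (cmod a)\<^sup>2))"
    by (intro mult_mono A) auto
  also have "\<dots> = \<epsilon>" using add_pos_nonneg[of 1 "(cmod a)\<^sup>2"] by simp
  finally show "\<exists>h. trig_approx h \<and> (LINT x|torus. (cmod (a * f x - h x))\<^sup>2) \<le> \<epsilon>"
    using trig_approx_trig[OF A(1)] by blast
qed

lemma trig_approx_dominated:
  assumes g: "\<And>n. trig_approx (g n)" and f: "sq_int f" and w: "integrable torus w"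
    and lim: "AE x in torus. (\<lambda>n. g n x) \<longlonglongrightarrow> f x"
    and le: "\<And>n. AE x in torus. (cmod (f x - g n x))\<^sup>2 \<le> w x"
  shows "trig_approx f"
proof (rule trig_approx_limit[OF f])
  fix \<epsilon> :: real assume "\<epsilon> > 0"
  have "(\<lambda>n. LINT x|torus. (cmod (f x - g n x))\<^sup>2) \<longlonglongrightarrow> (LINT x|torus. 0)"
  proof (rule integral_dominated_convergence[where w = w])
    show "AE x in torus. (\<lambda>n. (cmod (f x - g n x))\<^sup>2) \<longlonglongrightarrow> 0"
      using lim by eventually_elim (auto intro!: tendsto_eq_intros)
    show "(\<lambda>x. (cmod (f x - g n x))\<^sup>2) \<in> borel_measurable torus" for n
      using sq_int_diff[OF f trig_approx_sq_int[OF g[of n]]] by (auto simp: sq_int_def)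
  qed (use le w in auto)
  then have "\<forall>\<^sub>F n in sequentially. (LINT x|torus. (cmod (f x - g n x))\<^sup>2) < \<epsilon>"
    using \<open>\<epsilon> > 0\<close> by (auto simp: order_tendsto_iff)
  then show "\<exists>h. trig_approx h \<and> (LINT x|torus. (cmod (f x - h x))\<^sup>2) \<le> \<epsilon>"
    using g less_imp_le by (blast dest: eventually_happens'[OF sequentially_bot])
qed

lemma unif_trig_cos:
  "unif_trig (\<lambda>x. complex_of_real (cos (freq k \<bullet> x - c)))"
proof -
  have eq: "complex_of_real (cos (freq k \<bullet> x - c))
      = cis (- c) / 2 * trig {k} (\<lambda>_. 1) x + cis c / 2 * trig {- k} (\<lambda>_. 1) x" for x
  proof -
    have "cis (- c) / 2 * trig {k} (\<lambda>_. 1) x + cis c / 2 * trig {- k} (\<lambda>_. 1) x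
        = (cis (freq k \<bullet> x - c) + cis (- (freq k \<bullet> x - c))) / 2"
      by (simp add: trig_def cis_mult freq_uminus add_divide_distrib algebra_simps)
    also have "\<dots> = complex_of_real (cos (freq k \<bullet> x - c))"
      using cos_minus[of "freq k \<bullet> x - c"] sin_minus[of "freq k \<bullet> x - c"]
      by (simp add: complex_eq_iff)
    finally show ?thesis ..
  qed
  show ?thesis unfolding eq
    by (intro unif_trig_add unif_trig_mult unif_trig_const unif_trig_trig) auto
qed

text \<open>On the circle, an arc is the set where \<open>cos (t - c)\<close> exceeds a threshold.\<close>

lemma arc_iff_cos:
  fixes a b :: real
  obtains c l where "\<And>t. t \<in> {0<..<2 * pi} \<Longrightarrow> a < t \<and> t < b \<longleftrightarrow> cos l < cos (t - c)"
proof (cases "max 0 a < min (2 * pi) b")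
  case False
  have "\<not> (a < t \<and> t < b)" if "t \<in> {0<..<2 * pi}" for t
    using False that by auto
  \<comment> \<open>The empty arc is described by threshold 1 = cos 0, which no cosine
    exceeds.\<close>
  then have "a < t \<and> t < b \<longleftrightarrow> cos 0 < cos (t - 0)" if "t \<in> {0<..<2 * pi}" for t
    using that cos_le_one[of "t - 0"] by (simp only: cos_zero not_less[symmetric])
  then show thesis by (rule that)
next
  case True
  define a' b' where "a' = max 0 a" and "b' = min (2 * pi) b"
  define c l where "c = (a' + b') / 2" and "l = (b' - a') / 2"
  have ab: "0 \<le> a'" "a' < b'" "b' \<le> 2 * pi" using True by (auto simp: a'_def b'_def)
  have l: "0 \<le> l" "l \<le> pi" using ab by (auto simp: l_def)
  have "a < t \<and> t < b \<longleftrightarrow> cos l < cos (t - c)" if t: "t \<in> {0<..<2 * pi}" for t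
  proof -
    have "a < t \<and> t < b \<longleftrightarrow> \<bar>t - c\<bar> < l"
      using t by (auto simp: c_def l_def a'_def b'_def abs_less_iff field_simps)
    also have "\<dots> \<longleftrightarrow> cos l < cos \<bar>t - c\<bar>"
    proof (cases "\<bar>t - c\<bar> \<le> pi")
      case True
      then show ?thesis using l cos_mono_less_eq[of l "\<bar>t - c\<bar>"] by auto
    next
      case False
      \<comment> \<open>Here \<open>t\<close> is more than half a turn from the midpoint
        \<open>c\<close>. Its distance to \<open>c\<close> the other way round the circle is still
        at least the half-length \<open>l\<close>, because the arc was clipped to [0, 2 pi]; so the
        cosine does not exceed the threshold either.\<close>
      have "2 * pi - \<bar>t - c\<bar> \<ge> l"
        using t ab by (auto simp: c_def l_def abs_if field_simps)
      moreover have "2 * pi - \<bar>t - c\<bar> \<le> pi" using False by simp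
      ultimately have "cos (2 * pi - \<bar>t - c\<bar>) \<le> cos l"
        using l by (intro cos_monotone_0_pi_le) auto
      then have "\<not> cos l < cos \<bar>t - c\<bar>"
        using cos_periodic[of "- \<bar>t - c\<bar>"] by (simp add: algebra_simps)
      then show ?thesis using False l by auto
    qed
    finally show ?thesis by simp
  qed
  then show thesis by (rule that)
qed

text \<open>Continuous functions increasing to the indicator of the positive half-line as
  \<open>n\<close> grows. They replace the sharp threshold on a cosine by something to which the
  Weierstrass theorem applies.\<close>

definition ramp :: "nat \<Rightarrow> real \<Rightarrow> real" where
  "ramp n t = min 1 (real n * max 0 t)"

lemma ramp_bounds: "0 \<le> ramp n t" "ramp n t \<le> 1"
  by (auto simp: ramp_def)

lemma continuous_ramp: "continuous_on S (ramp n)"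
  unfolding ramp_def by (intro continuous_intros)

lemma ramp_tendsto: "(\<lambda>n. ramp n t) \<longlonglongrightarrow> (if 0 < t then 1 else 0)"
proof (cases "0 < t")
  case True
  have "\<forall>\<^sub>F n in sequentially. real n * t \<ge> 1"
    using eventually_ge_at_top[of "nat \<lceil>1 / t\<rceil>"]
  proof eventually_elim
    case (elim n)
    then have "1 / t \<le> real n" by linarith
    then show ?case using True by (simp add: field_simps)
  qed
  then have "\<forall>\<^sub>F n in sequentially. ramp n t = 1"
    by eventually_elim (use True in \<open>auto simp: ramp_def\<close>)
  then show ?thesis using True by (simp add: tendsto_eventually)
qed (simp add: ramp_def)

text \<open>The cosine description of arcs holds for angles strictly between 0 and 2 pi, so the two
  edges of the fundamental domain have to be discarded.\<close>

lemma AE_torus_interior: "AE x in torus. x \<in> {0<..<2 * pi} \<times> {0<..<2 * pi}"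
proof -
  have "AE x in (lborel \<Otimes>\<^sub>M lborel :: (real \<times> real) measure). fst x \<noteq> 0"
  proof (rule lborel_pair.AE_pair_measure)
    show "{x \<in> space (lborel \<Otimes>\<^sub>M lborel). fst x \<noteq> (0::real)} \<in> sets (lborel \<Otimes>\<^sub>M lborel :: (real \<times> real) measure)"
      by measurable
  qed (use AE_lborel_singleton[of "0::real"] in \<open>auto elim: eventually_mono\<close>)
  moreover have "AE x in (lborel \<Otimes>\<^sub>M lborel :: (real \<times> real) measure). snd x \<noteq> 0"
  proof (rule lborel_pair.AE_pair_measure)
    show "{x \<in> space (lborel \<Otimes>\<^sub>M lborel). snd x \<noteq> (0::real)} \<in> sets (lborel \<Otimes>\<^sub>M lborel :: (real \<times> real) measure)"
      by measurable
  qed (use AE_lborel_singleton[of "0::real"] in \<open>auto elim: eventually_mono\<close>)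
  ultimately have "AE x in torus. fst x \<noteq> 0 \<and> snd x \<noteq> 0"
    unfolding lborel_prod by (intro AE_torusI) (rule AE_conjI)
  with AE_torus_domain show ?thesis
    by eventually_elim (auto simp: less_le)
qed

lemma trig_approx_indicator_box:
  "trig_approx (\<lambda>x. complex_of_real (indicator (box a b) x))"
proof -
  obtain c l where 1: "\<And>t. t \<in> {0<..<2 * pi} \<Longrightarrow> fst a < t \<and> t < fst b \<longleftrightarrow> cos l < cos (t - c)"
    using arc_iff_cos[of "fst a" "fst b"] by metis
  obtain c' l' where 2: "\<And>t. t \<in> {0<..<2 * pi} \<Longrightarrow> snd a < t \<and> t < snd b \<longleftrightarrow> cos l' < cos (t - c')"
    using arc_iff_cos[of "snd a" "snd b"] by metis
  \<comment> \<open>One ramp for each coordinate: the frequencies (1,0) and (0,1) read off the first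
    and the second coordinate of \<open>x\<close>, so the product tends to the indicator of the
    box.\<close>
  define G where "G = (\<lambda>n x. complex_of_real (ramp n (cos (freq (1, 0) \<bullet> x - c) - cos l)) *
      complex_of_real (ramp n (cos (freq (0, 1) \<bullet> x - c') - cos l')))"
  have u: "unif_trig (\<lambda>x. complex_of_real (ramp n (cos (freq k \<bullet> x - c) - cos l)))" for n k c l
  proof (rule unif_trig_compose[where K = 2 and F = "ramp n" and g = "\<lambda>x. cos (freq k \<bullet> x - c) - cos l"])
    show "unif_trig (\<lambda>x. complex_of_real (cos (freq k \<bullet> x - c) - cos l))"
      using unif_trig_add[OF unif_trig_cos unif_trig_const[of "- complex_of_real (cos l)"]] by simp
    show "\<bar>cos (freq k \<bullet> x - c) - cos l\<bar> \<le> 2" for x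
      using abs_cos_le_one[of "freq k \<bullet> x - c"] abs_cos_le_one[of l] by linarith
  qed (rule continuous_ramp)
  have g: "trig_approx (G n)" for n
    unfolding G_def by (intro unif_trig_approx unif_trig_mult u)
  show ?thesis
  proof (rule trig_approx_dominated[where g = G and w = "\<lambda>_. 4", OF g])
    show "sq_int (\<lambda>x. complex_of_real (indicator (box a b) x))"
      by (rule sq_int_bounded[where B = 1]) (auto simp: indicator_def)
    show "AE x in torus. (\<lambda>n. G n x) \<longlonglongrightarrow> complex_of_real (indicator (box a b) x)"
      using AE_torus_interior
    proof eventually_elim
      case (elim x)
      have "(\<lambda>n. G n x) \<longlonglongrightarrow> complex_of_real (if 0 < cos (freq (1, 0) \<bullet> x - c) - cos l then 1 else 0)
          * complex_of_real (if 0 < cos (freq (0, 1) \<bullet> x - c') - cos l' then 1 else 0)"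
        unfolding G_def by (intro tendsto_intros ramp_tendsto)
      also have "complex_of_real (if 0 < cos (freq (1, 0) \<bullet> x - c) - cos l then 1 else 0)
          * complex_of_real (if 0 < cos (freq (0, 1) \<bullet> x - c') - cos l' then 1 else 0)
          = complex_of_real (indicator (box a b) x)"
        using 1[of "fst x"] 2[of "snd x"] elim
        by (auto simp: freq_def inner_prod_def indicator_def box_def Basis_prod_def)
      finally show ?case .
    qed
    show "AE x in torus. (cmod (complex_of_real (indicator (box a b) x) - G n x))\<^sup>2 \<le> 4" for n
    proof (rule AE_I2)
      fix x
      have "cmod (complex_of_real (indicator (box a b) x) - G n x) \<le> 1 + 1"
        by (intro order_trans[OF norm_triangle_ineq4] add_mono)
           (auto simp: G_def norm_mult ramp_bounds indicator_def intro!: mult_le_one)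
      then show "(cmod (complex_of_real (indicator (box a b) x) - G n x))\<^sup>2 \<le> 4"
        using power_mono[OF _ norm_ge_zero, of "complex_of_real (indicator (box a b) x) - G n x" 2 2] by simp
    qed
  qed simp
qed

text \<open>Boxes form a generator stable under intersection, so it suffices that the class is
  closed under complements, by linearity, and under countable disjoint unions, by additivity and
  dominated convergence.\<close>

lemma trig_approx_indicator:
  assumes "A \<in> sets borel"
  shows "trig_approx (\<lambda>x. complex_of_real (indicator A x))"
proof -
  have Int_stable_box: "Int_stable (range (\<lambda>(a, b). box a b :: (real \<times> real) set))"
    by (auto simp: Int_stable_def box_Int_box)
  have subset_Pow: "range (\<lambda>(a, b). box a b :: (real \<times> real) set) \<subseteq> Pow UNIV"
    by simp
  have "A \<in> sigma_sets UNIV (range (\<lambda>(a, b). box a b :: (real \<times> real) set))"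
    using assms by (simp add: borel_eq_box)
  from Int_stable_box subset_Pow this show ?thesis
  proof (induction rule: sigma_sets_induct_disjoint)
    case (basic A)
    then show ?case using trig_approx_indicator_box by auto
  next
    case empty
    then show ?case using unif_trig_approx[OF unif_trig_const[of 0]] by simp
  next
    case (compl A)
    have "complex_of_real (indicator (UNIV - A) x) = 1 + (-1) * complex_of_real (indicator A x)" for x
      by (auto simp: indicator_def)
    then show ?case
      using trig_approx_add[OF unif_trig_approx[OF unif_trig_const[of 1]] trig_approx_cmult[OF compl.IH, of "-1"]]
      by simp
  next
    case (union A)
    have sum: "trig_approx (\<lambda>x. complex_of_real (indicator (\<Union>i<n. A i) x))" for n
    proof (induction n)
      case 0
      then show ?case using unif_trig_approx[OF unif_trig_const[of 0]] by simp
    next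
      case (Suc n)
      have "A n \<inter> (\<Union>i<n. A i) = {}"
      proof -
        have "A n \<inter> A i = {}" if "i < n" for i
          using union.hyps(1) that by (auto simp: disjoint_family_on_def)
        then show ?thesis by blast
      qed
      then have "complex_of_real (indicator (\<Union>i<Suc n. A i) x)
          = complex_of_real (indicator (\<Union>i<n. A i) x) + complex_of_real (indicator (A n) x)" for x
        by (auto simp: indicator_def lessThan_Suc)
      then show ?case using trig_approx_add[OF Suc union.IH[of n]] by simp
    qed
    have meas: "A i \<in> sets borel" for i
      using union.hyps(2) by (auto simp: borel_eq_box)
    show ?case
    proof (rule trig_approx_dominated[where w = "\<lambda>_. 1", OF sum])
      show "sq_int (\<lambda>x. complex_of_real (indicator (\<Union> (range A)) x))"
        using meas by (intro sq_int_bounded[where B = 1]) (auto simp: indicator_def)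
      show "AE x in torus. (\<lambda>n. complex_of_real (indicator (\<Union>i<n. A i) x))
          \<longlonglongrightarrow> complex_of_real (indicator (\<Union> (range A)) x)"
        by (intro AE_I2 tendsto_of_real LIMSEQ_indicator_UN)
    qed (auto simp: indicator_def)
  qed
qed

theorem sq_int_trig_approx:
  assumes f: "sq_int f"
  shows "trig_approx f"
proof -
  obtain F where F: "\<And>i. simple_function torus (F i)" "\<And>x. (\<lambda>i. F i x) \<longlonglongrightarrow> f x"
    "\<And>i x. dist (F i x) 0 \<le> 2 * dist (f x) 0"
    using borel_measurable_implies_sequence_metric[of f torus 0] f by (auto simp: sq_int_def)
  have "trig_approx (F i)" for i
  proof -
    have fin: "finite (range (F i))" using F(1)[of i] by (simp add: simple_function_def)
    define S where "S Y x = (\<Sum>y\<in>Y. y * complex_of_real (indicator (F i -` {y}) x))" for Y x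
    have "F i x = S (range (F i)) x" for x
    proof -
      have "S (range (F i)) x = (\<Sum>y\<in>range (F i). if y = F i x then y else 0)"
        unfolding S_def by (intro sum.cong) (auto simp: indicator_def)
      then show ?thesis using fin by simp
    qed
    then have F_eq: "F i = S (range (F i))" by (rule ext)
    have "trig_approx (S Y)" if "finite Y" "Y \<subseteq> range (F i)" for Y
      using that
    proof (induction Y rule: finite_induct)
      case empty
      then show ?case using unif_trig_approx[OF unif_trig_const[of 0]] by (simp add: S_def[abs_def])
    next
      case (insert y Y)
      have "F i -` {y} \<in> sets borel"
        using F(1)[of i] insert by (auto simp: simple_function_def)
      then have "trig_approx (\<lambda>x. y * complex_of_real (indicator (F i -` {y}) x) + S Y x)"
        using insert by (auto intro!: trig_approx_add trig_approx_cmult trig_approx_indicator)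
      then show ?case
        using insert by (simp add: S_def[abs_def])
    qed
    then have "trig_approx (S (range (F i)))"
      using fin by blast
    then show ?thesis by (rule ssubst[OF F_eq])
  qed
  then show ?thesis
  \<comment> \<open>The approximating simple functions satisfy |F i| \<le> 2|f|, hence |f - F i|
    \<le> 3|f|, whose square is the dominating function.\<close>
  proof (rule trig_approx_dominated[where g = F and w = "\<lambda>x. 9 * (cmod (f x))\<^sup>2"])
    show "integrable torus (\<lambda>x. 9 * (cmod (f x))\<^sup>2)" using f by (simp add: sq_int_def)
    show "AE x in torus. (cmod (f x - F i x))\<^sup>2 \<le> 9 * (cmod (f x))\<^sup>2" for i
    proof (rule AE_I2)
      fix x
      have "cmod (f x - F i x) \<le> 3 * cmod (f x)"
        using norm_triangle_ineq4[of "f x" "F i x"] F(3)[of i x] by simp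
      then show "(cmod (f x - F i x))\<^sup>2 \<le> 9 * (cmod (f x))\<^sup>2"
        using power_mono[OF _ norm_ge_zero, of "f x - F i x" "3 * cmod (f x)" 2] by (simp add: power_mult_distrib)
    qed
    show "AE x in torus. (\<lambda>i. F i x) \<longlonglongrightarrow> f x"
      by (rule AE_I2) (rule F(2))
  qed (rule f)
qed

definition fbox :: "nat \<Rightarrow> (int \<times> int) set" where
  "fbox N = {- int N..int N} \<times> {- int N..int N}"

lemma finite_fbox [simp]: "finite (fbox N)"
  by (simp add: fbox_def)

lemma fbox_mono: "M \<le> N \<Longrightarrow> fbox M \<subseteq> fbox N"
  by (auto simp: fbox_def)

lemma finite_subset_fbox:
  assumes "finite A" obtains N where "A \<subseteq> fbox N"
  using assms
proof (induction A arbitrary: thesis rule: finite_induct)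
  case (insert k A)
  then obtain N where N: "A \<subseteq> fbox N" by blast
  have "k \<in> fbox (nat (\<bar>fst k\<bar> + \<bar>snd k\<bar>))" by (cases k) (auto simp: fbox_def)
  then have "insert k A \<subseteq> fbox (max N (nat (\<bar>fst k\<bar> + \<bar>snd k\<bar>)))"
    using N fbox_mono by (meson insert_subset max.cobounded1 max.cobounded2 subset_trans subsetD)
  then show ?case using insert.prems by blast
qed auto

text \<open>Density provides one good polynomial; by the best approximation property every Fourier
  partial sum over a box containing its spectrum does at least as well.\<close>

theorem fourier_partial_sums_tendsto:
  assumes f: "sq_int f"
  shows "(\<lambda>N. LINT x|torus. (cmod (f x - trig (fbox N) (fcoef f) x))\<^sup>2) \<longlonglongrightarrow> 0"
proof (rule LIMSEQ_I)
  fix \<epsilon> :: real assume "\<epsilon> > 0"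
  then obtain A c where A: "finite A" "(LINT x|torus. (cmod (f x - trig A c x))\<^sup>2) \<le> \<epsilon> / 2"
    using sq_int_trig_approx[OF f] unfolding trig_approx_def by (meson half_gt_zero)
  obtain N where N: "A \<subseteq> fbox N" using finite_subset_fbox[OF A(1)] .
  have "norm ((LINT x|torus. (cmod (f x - trig (fbox n) (fcoef f) x))\<^sup>2) - 0) < \<epsilon>" if "n \<ge> N" for n
  proof -
    have "A \<subseteq> fbox n" using N fbox_mono[OF that] by blast
    then have "(LINT x|torus. (cmod (f x - trig (fbox n) (fcoef f) x))\<^sup>2)
        \<le> (LINT x|torus. (cmod (f x - trig A c x))\<^sup>2)"
      by (intro fourier_best_approx f) simp_all
    then have "(LINT x|torus. (cmod (f x - trig (fbox n) (fcoef f) x))\<^sup>2) < \<epsilon>"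
      using A(2) \<open>\<epsilon> > 0\<close> by linarith
    moreover have "0 \<le> (LINT x|torus. (cmod (f x - trig (fbox n) (fcoef f) x))\<^sup>2)"
      by (rule Bochner_Integration.integral_nonneg) (rule zero_le_power2)
    ultimately show ?thesis unfolding diff_0_right real_norm_def by (simp only: abs_of_nonneg)
  qed
  then show "\<exists>N. \<forall>n\<ge>N. norm ((LINT x|torus. (cmod (f x - trig (fbox n) (fcoef f) x))\<^sup>2) - 0) < \<epsilon>"
    by blast
qed

section \<open>Fourier coefficients of products\<close>

abbreviation fnorm :: "int \<times> int \<Rightarrow> real" where
  "fnorm k \<equiv> norm (freq k)"

lemma abs_fst_le_fnorm: "\<bar>real_of_int (fst k)\<bar> \<le> fnorm k"
  and abs_snd_le_fnorm: "\<bar>real_of_int (snd k)\<bar> \<le> fnorm k"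
  using norm_fst_le[of "fst (freq k)" "snd (freq k)"] norm_snd_le[of "snd (freq k)" "fst (freq k)"]
  by (simp_all add: freq_def)

lemma abs_inner_le_fnorm: "b \<in> Basis \<Longrightarrow> \<bar>freq k \<bullet> b\<bar> \<le> fnorm k"
  by (rule Basis_le_norm)

lemma one_plus_fnorm_pos: "0 < 1 + fnorm k"
  using norm_ge_zero[of "freq k"] by linarith

lemma sum_powr_bounded:
  obtains C :: real where "C > 0" "\<And>N. (\<Sum>n\<in>{- int N..int N}. (1 + \<bar>real_of_int n\<bar>) powr (- 3 / 2)) \<le> C"
proof -
  have sm: "summable (\<lambda>n. real (Suc n) powr (- 3 / 2))"
    by (subst summable_Suc_iff) (simp add: summable_real_powr_iff)
  define s where "s = (\<Sum>n. real (Suc n) powr (- 3 / 2))"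
  have s: "(\<Sum>n\<le>N. real (Suc n) powr (- 3 / 2)) \<le> s" for N
    unfolding s_def by (intro sum_le_suminf sm) auto
  show thesis
  proof (rule that)
    show "0 < 2 * s" using s[of 0] by simp
    fix N
    have "(\<Sum>n\<in>{- int N..int N}. (1 + \<bar>real_of_int n\<bar>) powr (- 3 / 2))
        \<le> (\<Sum>n\<in>int ` {..N} \<union> (\<lambda>n. - int n) ` {..N}. (1 + \<bar>real_of_int n\<bar>) powr (- 3 / 2))"
    proof (intro sum_mono2)
      show "{- int N..int N} \<subseteq> int ` {..N} \<union> (\<lambda>n. - int n) ` {..N}"
      proof
        fix n assume n: "n \<in> {- int N..int N}"
        show "n \<in> int ` {..N} \<union> (\<lambda>n. - int n) ` {..N}"
        proof (cases "n \<ge> 0")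
          case True
          then have "n = int (nat n)" "nat n \<in> {..N}" using n by auto
          then show ?thesis by blast
        next
          case False
          then have "n = - int (nat (- n))" "nat (- n) \<in> {..N}" using n by auto
          then show ?thesis by blast
        qed
      qed
    qed auto
    also have "\<dots> \<le> (\<Sum>n\<in>int ` {..N}. (1 + \<bar>real_of_int n\<bar>) powr (- 3 / 2))
        + (\<Sum>n\<in>(\<lambda>n. - int n) ` {..N}. (1 + \<bar>real_of_int n\<bar>) powr (- 3 / 2))"
      by (subst sum.union_inter[symmetric]) (auto intro!: sum_nonneg)
    also have "\<dots> = 2 * (\<Sum>n\<le>N. real (Suc n) powr (- 3 / 2))"
      by (subst (1 2) sum.reindex) (auto simp: inj_on_def add.commute)
    also have "\<dots> \<le> 2 * s" using s[of N] by simp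
    finally show "(\<Sum>n\<in>{- int N..int N}. (1 + \<bar>real_of_int n\<bar>) powr (- 3 / 2)) \<le> 2 * s" .
  qed
qed

text \<open>The exponent 3 exceeds the dimension 2. Splitting the cube into two powers 3/2 and
  bounding the norm below by one coordinate in each factorises the double sum into two convergent
  one-dimensional ones.\<close>

lemma sum_inverse_cube_bounded:
  obtains C :: real where "C > 0" "\<And>F. finite F \<Longrightarrow> (\<Sum>k\<in>F. 1 / (1 + fnorm k) ^ 3) \<le> C"
proof -
  let ?a = "\<lambda>n. (1 + \<bar>real_of_int n\<bar>) powr (- 3 / 2)"
  obtain C where C: "C > 0" "\<And>N. (\<Sum>n\<in>{- int N..int N}. ?a n) \<le> C"
    using sum_powr_bounded by blast
  have le: "1 / (1 + fnorm k) ^ 3 \<le> ?a (fst k) * ?a (snd k)" for k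
  proof -
    have "1 / (1 + fnorm k) ^ 3 = (1 + fnorm k) powr (- 3 / 2) * (1 + fnorm k) powr (- 3 / 2)"
      by (simp add: powr_add[symmetric] powr_minus powr_numeral field_simps add_pos_nonneg)
    also have "\<dots> \<le> ?a (fst k) * ?a (snd k)"
      using abs_fst_le_fnorm[of k] abs_snd_le_fnorm[of k] by (intro mult_mono powr_mono2') auto
    finally show ?thesis .
  qed
  show thesis
  proof (rule that)
    show "0 < C * C" using C by simp
    fix F :: "(int \<times> int) set" assume "finite F"
    then obtain N where N: "F \<subseteq> fbox N" by (rule finite_subset_fbox)
    have "(\<Sum>k\<in>F. 1 / (1 + fnorm k) ^ 3) \<le> (\<Sum>k\<in>fbox N. 1 / (1 + fnorm k) ^ 3)"
      using N by (intro sum_mono2) auto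
    also have "\<dots> \<le> (\<Sum>k\<in>fbox N. ?a (fst k) * ?a (snd k))"
      by (intro sum_mono le)
    also have "\<dots> = (\<Sum>n\<in>{- int N..int N}. ?a n) * (\<Sum>n\<in>{- int N..int N}. ?a n)"
      unfolding fbox_def sum_product by (simp add: sum.cartesian_product case_prod_beta)
    also have "\<dots> \<le> C * C"
      using C by (intro mult_mono sum_nonneg) auto
    finally show "(\<Sum>k\<in>F. 1 / (1 + fnorm k) ^ 3) \<le> C * C" .
  qed
qed

text \<open>The weight of the squared Sobolev norm of order 3/4. An order s gives a square (1 +
  |k|)^(4s), and its inverse is summable over the planar lattice exactly for s > 1/2; the choice 3/4
  makes the square a cube.\<close>

definition wt :: "int \<times> int \<Rightarrow> real" where
  "wt k = (1 + fnorm k) powr (3 / 2)"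

lemma wt_pos: "wt k > 0"
  using one_plus_fnorm_pos[of k] by (simp add: wt_def)

lemma wt_sq: "(wt k)\<^sup>2 = (1 + fnorm k) ^ 3"
  unfolding wt_def power2_eq_square
  using powr_numeral[OF less_imp_le[OF one_plus_fnorm_pos], of k "num.Bit1 num.One"] by (simp add: powr_add[symmetric])

lemma wt_le: "wt k \<le> (1 + fnorm k)\<^sup>2"
proof -
  have "wt k \<le> (1 + fnorm k) powr 2" unfolding wt_def by (intro powr_mono) auto
  then show ?thesis by (simp add: powr_numeral add_pos_nonneg)
qed

text \<open>Squared Sobolev norm of order 3/4 of a trigonometric polynomial; \<open>nH\<close> is
  its analogue of order 1.\<close>

definition nwt :: "(int \<times> int) set \<Rightarrow> (int \<times> int \<Rightarrow> complex) \<Rightarrow> real" where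
  "nwt A c = (\<Sum>k\<in>A. wt k * (cmod (c k))\<^sup>2)"

definition nH :: "(int \<times> int) set \<Rightarrow> (int \<times> int \<Rightarrow> complex) \<Rightarrow> real" where
  "nH A c = (\<Sum>k\<in>A. (1 + fnorm k)\<^sup>2 * (cmod (c k))\<^sup>2)"

lemma nwt_nonneg [simp]: "0 \<le> nwt A c"
  unfolding nwt_def using wt_pos by (intro sum_nonneg mult_nonneg_nonneg) (auto simp: less_imp_le)

lemma nH_nonneg [simp]: "0 \<le> nH A c"
  unfolding nH_def by (intro sum_nonneg) auto

lemma nwt_le_nH: "nwt A c \<le> nH A c"
  unfolding nwt_def nH_def by (intro sum_mono mult_right_mono wt_le) auto

text \<open>
  The embedding \<open>H\<^sup>3\<^sup>/\<^sup>4 \<subseteq> L\<^sup>4\<close>, in bilinear form. It follows from the Cauchy--Schwarz inequality for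
  the convolution of the Fourier coefficients, since \<open>wt\<^sup>-\<^sup>2\<close> is summable.
\<close>

lemma trig_product_bound:
  obtains C :: real where "C > 0"
    "\<And>A B c d. finite A \<Longrightarrow> finite B \<Longrightarrow>
      (LINT x|torus. (cmod (trig A c x * trig B d x))\<^sup>2) \<le> C * nwt A c * nwt B d"
proof -
  obtain C where C: "C > 0" "\<And>F. finite F \<Longrightarrow> (\<Sum>k\<in>F. 1 / (1 + fnorm k) ^ 3) \<le> C"
    using sum_inverse_cube_bounded by blast
  have "(LINT x|torus. (cmod (trig A c x * trig B d x))\<^sup>2) \<le> C * nwt A c * nwt B d"
    if A: "finite A" and B: "finite B" for A B c d
  proof -
    define e where "e k = (if k \<in> B then d k else 0)" for k
    define S where "S = (\<lambda>(k, l). k + l) ` (A \<times> B)"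
    have [simp]: "finite S" using A B by (simp add: S_def)
    have "trig B d x = trig B e x" for x
      unfolding trig_def e_def by (intro sum.cong) auto
    then have "(LINT x|torus. (cmod (trig A c x * trig B d x))\<^sup>2)
        = (LINT x|torus. (cmod (trig S (\<lambda>n. \<Sum>k\<in>A. c k * e (n - k)) x))\<^sup>2)"
      using trig_mult[OF A B, of e c] by (simp add: S_def e_def)
    also have "\<dots> = (\<Sum>n\<in>S. (cmod (\<Sum>k\<in>A. c k * e (n - k)))\<^sup>2)"
      by (simp add: parseval_trig)
    also have "\<dots> \<le> (\<Sum>n\<in>S. C * (\<Sum>k\<in>A. wt k * (cmod (c k))\<^sup>2 * (wt (n - k) * (cmod (e (n - k)))\<^sup>2)))"
    proof (rule sum_mono)
      fix n
      \<comment> \<open>The weight in Cauchy-Schwarz is symmetric in the two frequencies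
        \<open>k\<close> and \<open>n - k\<close>, so that each factor of the product is charged
        with its own \<open>wt\<close>.\<close>
      let ?u = "\<lambda>k. sqrt (wt k * wt (n - k))"
      have u: "?u k > 0" for k using wt_pos by simp
      have "(cmod (\<Sum>k\<in>A. c k * e (n - k)))\<^sup>2 \<le> (\<Sum>k\<in>A. cmod (c k) * cmod (e (n - k)))\<^sup>2"
        by (intro power_mono order_trans[OF norm_sum]) (auto simp: norm_mult)
      also have "\<dots> = (\<Sum>k\<in>A. (1 / ?u k) * (?u k * (cmod (c k) * cmod (e (n - k)))))\<^sup>2"
        using u by (simp add: less_imp_neq[THEN not_sym] del: real_sqrt_eq_zero_cancel_iff real_sqrt_mult)
      also have "\<dots> \<le> (\<Sum>k\<in>A. (1 / ?u k)\<^sup>2) * (\<Sum>k\<in>A. (?u k * (cmod (c k) * cmod (e (n - k))))\<^sup>2)"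
        by (rule Cauchy_Schwarz_ineq_sum)
      also have "(\<Sum>k\<in>A. (?u k * (cmod (c k) * cmod (e (n - k))))\<^sup>2)
          = (\<Sum>k\<in>A. wt k * (cmod (c k))\<^sup>2 * (wt (n - k) * (cmod (e (n - k)))\<^sup>2))"
        using wt_pos by (intro sum.cong) (simp_all add: power_mult_distrib less_imp_le mult_ac)
      also have "(\<Sum>k\<in>A. (1 / ?u k)\<^sup>2) \<le> C"
      proof -
        \<comment> \<open>The inequality between geometric and arithmetic mean separates the two
          weights. Each half then sums the inverse of \<open>wt\<close> squared over a finite set or
          its reflection, uniformly in \<open>n\<close>.\<close>
        have "(1 / ?u k)\<^sup>2 \<le> (1 / (1 + fnorm k) ^ 3) / 2 + (1 / (1 + fnorm (n - k)) ^ 3) / 2" for k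
        proof -
          have "(1 / ?u k)\<^sup>2 = (1 / wt k) * (1 / wt (n - k))"
            using wt_pos[of k] wt_pos[of "n - k"] by (simp add: power_divide)
          also have "\<dots> \<le> (1 / wt k)\<^sup>2 / 2 + (1 / wt (n - k))\<^sup>2 / 2"
            using zero_le_power2[of "1 / wt k - 1 / wt (n - k)"] unfolding power2_diff by linarith
          finally show ?thesis by (simp add: power_divide wt_sq)
        qed
        then have "(\<Sum>k\<in>A. (1 / ?u k)\<^sup>2)
            \<le> (\<Sum>k\<in>A. 1 / (1 + fnorm k) ^ 3) / 2 + (\<Sum>k\<in>A. 1 / (1 + fnorm (n - k)) ^ 3) / 2"
          unfolding sum_divide_distrib sum.distrib[symmetric] by (intro sum_mono) simp
        also have "(\<Sum>k\<in>A. 1 / (1 + fnorm (n - k)) ^ 3) = (\<Sum>k\<in>(\<lambda>k. n - k) ` A. 1 / (1 + fnorm k) ^ 3)"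
          by (subst sum.reindex) (auto simp: inj_on_def)
        also have "(\<Sum>k\<in>A. 1 / (1 + fnorm k) ^ 3) / 2 + \<dots> / 2 \<le> C / 2 + C / 2"
          using A by (intro add_mono divide_right_mono C) auto
        finally show ?thesis by simp
      qed
      finally show "(cmod (\<Sum>k\<in>A. c k * e (n - k)))\<^sup>2
          \<le> C * (\<Sum>k\<in>A. wt k * (cmod (c k))\<^sup>2 * (wt (n - k) * (cmod (e (n - k)))\<^sup>2))"
        using wt_pos by (auto simp: mult_right_mono sum_nonneg less_imp_le)
    qed
    also have "\<dots> = C * (\<Sum>k\<in>A. wt k * (cmod (c k))\<^sup>2 * (\<Sum>n\<in>S. wt (n - k) * (cmod (e (n - k)))\<^sup>2))"
      unfolding sum_distrib_left[symmetric] by (subst sum.swap) (simp add: sum_distrib_left)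
    also have "\<dots> \<le> C * (\<Sum>k\<in>A. wt k * (cmod (c k))\<^sup>2 * nwt B d)"
    proof (intro mult_left_mono sum_mono)
      fix k
      have "(\<Sum>n\<in>S. wt (n - k) * (cmod (e (n - k)))\<^sup>2) = (\<Sum>l\<in>(\<lambda>n. n - k) ` S. wt l * (cmod (e l))\<^sup>2)"
        by (subst sum.reindex) (auto simp: inj_on_def)
      also have "\<dots> \<le> (\<Sum>l\<in>(\<lambda>n. n - k) ` S \<union> B. wt l * (cmod (e l))\<^sup>2)"
        using B wt_pos by (intro sum_mono2) (auto simp: less_imp_le)
      also have "\<dots> = (\<Sum>l\<in>B. wt l * (cmod (e l))\<^sup>2)"
        using B by (intro sum.mono_neutral_right) (auto simp: e_def)
      also have "\<dots> = nwt B d" by (simp add: nwt_def e_def)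
      finally show "(\<Sum>n\<in>S. wt (n - k) * (cmod (e (n - k)))\<^sup>2) \<le> nwt B d" .
    qed (use C wt_pos in \<open>auto simp: less_imp_le\<close>)
    also have "\<dots> = C * nwt A c * nwt B d"
      by (simp add: nwt_def sum_distrib_right mult.assoc)
    finally show ?thesis .
  qed
  with C(1) show thesis by (rule that)
qed

section \<open>Increments over dyadic steps\<close>

lemma cmod_cis_diff_sq: "(cmod (cis \<theta> - 1))\<^sup>2 = 2 - 2 * cos \<theta>"
  unfolding cmod_power2 by (simp add: power2_diff)

lemma cmod_cis_diff_le: "cmod (cis \<theta> - 1) \<le> \<bar>\<theta>\<bar>"
proof -
  have "(cmod (cis \<theta> - 1))\<^sup>2 = 4 * (sin (\<theta> / 2))\<^sup>2"
    using cos_double_sin[of "\<theta> / 2"] by (simp add: cmod_cis_diff_sq)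
  also have "\<dots> \<le> 4 * (\<theta> / 2)\<^sup>2"
    using abs_sin_x_le_abs_x[of "\<theta> / 2"] unfolding abs_le_square_iff by simp
  finally have "(cmod (cis \<theta> - 1))\<^sup>2 \<le> \<bar>\<theta>\<bar>\<^sup>2" by (simp add: power_divide)
  then show ?thesis by (rule power2_le_imp_le) simp
qed

text \<open>Interpolation between the quadratic bound for small angles and the trivial bound 4. The
  power 1/2 is chosen because \<open>wt k\<close> times the square root of 1 + |k| is exactly the
  weight (1 + |k|)^2 of order 1.\<close>

lemma cmod_cis_diff_sq_le: "(cmod (cis \<theta> - 1))\<^sup>2 \<le> 4 * sqrt \<bar>\<theta>\<bar>"
proof (cases "\<bar>\<theta>\<bar> \<le> 1")
  case True
  have "(cmod (cis \<theta> - 1))\<^sup>2 \<le> \<bar>\<theta>\<bar>\<^sup>2"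
    by (intro power_mono cmod_cis_diff_le) simp
  also have "\<dots> \<le> \<bar>\<theta>\<bar>"
    using True power_decreasing[of 1 2 "\<bar>\<theta>\<bar>"] by simp
  also have "\<dots> \<le> sqrt \<bar>\<theta>\<bar>"
    using True real_le_rsqrt[of "\<bar>\<theta>\<bar>" "\<bar>\<theta>\<bar>"] power_decreasing[of 1 2 "\<bar>\<theta>\<bar>"] by simp
  also have "\<dots> \<le> 4 * sqrt \<bar>\<theta>\<bar>" by simp
  finally show ?thesis .
next
  case False
  have "(cmod (cis \<theta> - 1))\<^sup>2 \<le> 4" by (simp add: cmod_cis_diff_sq)
     (use cos_ge_minus_one[of \<theta>] in linarith)
  also have "\<dots> \<le> 4 * sqrt \<bar>\<theta>\<bar>" using False by simp
  finally show ?thesis .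
qed

lemma cmod_cis_diff_sq_ge:
  assumes "pi / 2 \<le> \<bar>\<theta>\<bar>" "\<bar>\<theta>\<bar> \<le> pi"
  shows "2 \<le> (cmod (cis \<theta> - 1))\<^sup>2"
proof -
  have "cos \<bar>\<theta>\<bar> \<le> cos (pi / 2)"
    using assms by (intro cos_monotone_0_pi_le) auto
  then show ?thesis by (simp add: cmod_cis_diff_sq)
qed

text \<open>The step for which a frequency component between 2^m and 2^(m+1) turns the phase by an
  angle between pi/2 and pi, where \<open>cis\<close> stays away from 1.\<close>

definition hstep :: "nat \<Rightarrow> real" where
  "hstep m = (pi / 2) / 2 ^ m"

text \<open>The decay rate of one dyadic scale: regularity \<open>1/8\<close> is all that the argument needs.\<close>

definition qr :: real where
  "qr = 2 powr (- 1 / 8)"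

lemma qr_bounds: "0 < qr" "qr < 1"
  using powr_less_mono[of "-1/8" 0 2] by (auto simp: qr_def)

lemma qr_8: "qr ^ 8 = 1 / 2"
proof -
  have "qr ^ 8 = 2 powr (- 1)" unfolding qr_def by (subst powr_power) auto
  then show ?thesis by (simp add: powr_minus)
qed

lemma hstep_pos: "hstep m > 0"
  by (simp add: hstep_def)

lemma sqrt_hstep_le: "sqrt (hstep m) \<le> 2 * (qr ^ m) ^ 4"
proof (rule real_le_lsqrt)
  have "(2 * (qr ^ m) ^ 4)\<^sup>2 = 4 * (qr ^ 8) ^ m"
    by (simp add: power_mult_distrib power_mult[symmetric] mult.commute)
  also have "\<dots> = 4 / 2 ^ m" by (simp add: qr_8 power_divide)
  also have "\<dots> \<ge> hstep m"
    unfolding hstep_def using pi_less_4 by (intro divide_right_mono) auto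
  finally show "hstep m \<le> (2 * (qr ^ m) ^ 4)\<^sup>2" .
qed (use qr_bounds in \<open>auto simp: hstep_def\<close>)

text \<open>Half a power of the angle raises the order from 3/4 to 1 and gains
  \<open>sqrt (hstep m)\<close>, of order \<open>(qr ^ m) ^ 4\<close>. Only
  \<open>(qr ^ m)\<^sup>2\<close> is kept, which matches the squared increments of the exponential
  weight.\<close>

lemma nwt_difference_le:
  assumes b: "b \<in> Basis"
  shows "nwt A (\<lambda>k. c k * (cis (freq k \<bullet> (hstep m *\<^sub>R b)) - 1)) \<le> 8 * (qr ^ m)\<^sup>2 * nH A c"
proof -
  have q: "sqrt (hstep m) \<le> 2 * (qr ^ m)\<^sup>2"
  proof -
    have "(qr ^ m) ^ 4 \<le> (qr ^ m)\<^sup>2"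
      using qr_bounds by (intro power_decreasing) (auto simp: power_le_one)
    then show ?thesis using sqrt_hstep_le[of m] by simp
  qed
  have "wt k * (cmod (c k * (cis (freq k \<bullet> (hstep m *\<^sub>R b)) - 1)))\<^sup>2
      \<le> 8 * (qr ^ m)\<^sup>2 * ((1 + fnorm k)\<^sup>2 * (cmod (c k))\<^sup>2)" for k
  proof -
    let ?\<theta> = "freq k \<bullet> (hstep m *\<^sub>R b)"
    have "(cmod (cis ?\<theta> - 1))\<^sup>2 \<le> 4 * sqrt \<bar>?\<theta>\<bar>" by (rule cmod_cis_diff_sq_le)
    also have "sqrt \<bar>?\<theta>\<bar> \<le> sqrt (hstep m) * sqrt (1 + fnorm k)"
      using abs_inner_le_fnorm[OF b, of k] hstep_pos[of m]
      by (simp add: abs_mult real_sqrt_mult[symmetric] mult_left_mono)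
    also have "\<dots> \<le> (2 * (qr ^ m)\<^sup>2) * sqrt (1 + fnorm k)"
      using q by (intro mult_right_mono) auto
    finally have "(cmod (cis ?\<theta> - 1))\<^sup>2 \<le> 8 * (qr ^ m)\<^sup>2 * sqrt (1 + fnorm k)" by simp
    then have "wt k * (cmod (cis ?\<theta> - 1))\<^sup>2 \<le> wt k * (8 * (qr ^ m)\<^sup>2 * sqrt (1 + fnorm k))"
      using wt_pos[of k] by (intro mult_left_mono) auto
    also have "wt k * sqrt (1 + fnorm k) = (1 + fnorm k)\<^sup>2"
      by (simp add: wt_def powr_half_sqrt[symmetric] powr_add[symmetric] powr_numeral add_pos_nonneg)
    then have "wt k * (8 * (qr ^ m)\<^sup>2 * sqrt (1 + fnorm k)) = 8 * (qr ^ m)\<^sup>2 * (1 + fnorm k)\<^sup>2"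
      by (simp add: mult_ac)
    finally have "wt k * (cmod (cis ?\<theta> - 1))\<^sup>2 * (cmod (c k))\<^sup>2 \<le> 8 * (qr ^ m)\<^sup>2 * (1 + fnorm k)\<^sup>2 * (cmod (c k))\<^sup>2"
      by (intro mult_right_mono) auto
    then show ?thesis by (simp add: norm_mult power_mult_distrib mult_ac)
  qed
  then show ?thesis unfolding nwt_def nH_def sum_distrib_left by (rule sum_mono)
qed

lemma sum3_sq_le: "(cmod (a + b + c))\<^sup>2 \<le> 3 * (cmod a)\<^sup>2 + 3 * (cmod b)\<^sup>2 + 3 * (cmod c)\<^sup>2"
proof -
  have "(cmod (a + b + c))\<^sup>2 \<le> (cmod a + cmod b + cmod c)\<^sup>2"
    by (intro power_mono norm_triangle_mono add_mono order_refl norm_triangle_ineq) auto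
  also have "\<dots> \<le> 3 * (cmod a)\<^sup>2 + 3 * (cmod b)\<^sup>2 + 3 * (cmod c)\<^sup>2"
    using zero_le_power2[of "cmod a - cmod b"] zero_le_power2[of "cmod b - cmod c"]
      zero_le_power2[of "cmod a - cmod c"]
    by (simp add: power2_eq_square algebra_simps)
  finally show ?thesis .
qed

text \<open>Translation multiplies the coefficient at \<open>k\<close> by a phase; on this range of
  frequencies the phase differs from 1 by at least \<open>sqrt 2\<close>, thanks to the choice of
  the step. Bessel's inequality for the increment then bounds the block.\<close>

lemma fcoef_block_le_increment:
  assumes f: "unif_trig f" and F: "finite F" and b: "b \<in> Basis"
    and Fm: "\<And>k. k \<in> F \<Longrightarrow> 2 ^ m \<le> \<bar>freq k \<bullet> b\<bar> \<and> \<bar>freq k \<bullet> b\<bar> \<le> 2 ^ Suc m"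
  shows "2 * (\<Sum>k\<in>F. (cmod (fcoef f k))\<^sup>2) \<le> (LINT x|torus. (cmod (f (x + hstep m *\<^sub>R b) - f x))\<^sup>2)"
proof -
  let ?D = "\<lambda>x. f (x + hstep m *\<^sub>R b) - f x"
  have fs: "unif_trig (\<lambda>x. f (x + hstep m *\<^sub>R b))" by (rule unif_trig_shift[OF f])
  have coef: "fcoef ?D k = (cis (freq k \<bullet> (hstep m *\<^sub>R b)) - 1) * fcoef f k" for k
    using f fs by (simp add: fcoef_diff fcoef_shift sq_int_integrable unif_trig_sq_int algebra_simps)
  have "2 * (cmod (fcoef f k))\<^sup>2 \<le> (cmod (fcoef ?D k))\<^sup>2" if "k \<in> F" for k
  proof -
    have "\<bar>freq k \<bullet> (hstep m *\<^sub>R b)\<bar> = hstep m * \<bar>freq k \<bullet> b\<bar>"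
      using hstep_pos[of m] by (simp add: abs_mult)
    moreover have "hstep m * 2 ^ m \<le> hstep m * \<bar>freq k \<bullet> b\<bar>" "hstep m * \<bar>freq k \<bullet> b\<bar> \<le> hstep m * 2 ^ Suc m"
      using Fm[OF that] hstep_pos[of m] by (auto intro!: mult_left_mono)
    ultimately have "2 \<le> (cmod (cis (freq k \<bullet> (hstep m *\<^sub>R b)) - 1))\<^sup>2"
      by (intro cmod_cis_diff_sq_ge) (auto simp: hstep_def)
    then show ?thesis
      unfolding coef norm_mult power_mult_distrib by (intro mult_right_mono) auto
  qed
  then have "2 * (\<Sum>k\<in>F. (cmod (fcoef f k))\<^sup>2) \<le> (\<Sum>k\<in>F. (cmod (fcoef ?D k))\<^sup>2)"
    unfolding sum_distrib_left by (rule sum_mono)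
  also have "\<dots> \<le> (LINT x|torus. (cmod (?D x))\<^sup>2)"
    using f fs F by (intro bessel sq_int_diff unif_trig_sq_int)
  finally show ?thesis .
qed

text \<open>Product rule for increments: each term puts the increment on one of the three factors.
  An increment on a polynomial costs order 1 there and order 3/4 on the other one, whence the sum
  symmetric in the two factors; the weight \<open>E\<close> pays with its own increment
  \<open>K * qr ^ m\<close>.\<close>

lemma block_estimate:
  obtains C :: real where "C > 0"
    "\<And>A B c d E M K b m F. finite A \<Longrightarrow> finite B \<Longrightarrow> unif_trig E \<Longrightarrow> (\<And>x. cmod (E x) \<le> M) \<Longrightarrow> b \<in> Basis \<Longrightarrow>
      (\<And>x. cmod (E (x + hstep m *\<^sub>R b) - E x) \<le> K * qr ^ m) \<Longrightarrow> finite F \<Longrightarrow>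
      (\<And>k. k \<in> F \<Longrightarrow> 2 ^ m \<le> \<bar>freq k \<bullet> b\<bar> \<and> \<bar>freq k \<bullet> b\<bar> \<le> 2 ^ Suc m) \<Longrightarrow>
      (\<Sum>k\<in>F. (cmod (fcoef (\<lambda>x. trig A c x * trig B d x * E x) k))\<^sup>2)
        \<le> C * (M\<^sup>2 + K\<^sup>2) * (qr ^ m)\<^sup>2 * (nH A c * nwt B d + nwt A c * nH B d)"
proof -
  obtain C where C: "C > 0"
    "\<And>A B c d. finite A \<Longrightarrow> finite B \<Longrightarrow>
      (LINT x|torus. (cmod (trig A c x * trig B d x))\<^sup>2) \<le> C * nwt A c * nwt B d"
    using trig_product_bound by blast
  have "(\<Sum>k\<in>F. (cmod (fcoef (\<lambda>x. trig A c x * trig B d x * E x) k))\<^sup>2)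
        \<le> 12 * C * (M\<^sup>2 + K\<^sup>2) * (qr ^ m)\<^sup>2 * (nH A c * nwt B d + nwt A c * nH B d)"
    if A: "finite A" and B: "finite B" and E: "unif_trig E" and M: "\<And>x. cmod (E x) \<le> M" and b: "b \<in> Basis"
      and K: "\<And>x. cmod (E (x + hstep m *\<^sub>R b) - E x) \<le> K * qr ^ m" and F: "finite F"
      and Fm: "\<And>k. k \<in> F \<Longrightarrow> 2 ^ m \<le> \<bar>freq k \<bullet> b\<bar> \<and> \<bar>freq k \<bullet> b\<bar> \<le> 2 ^ Suc m"
    for A B c d E M K b m F
  proof -
    define h where "h = hstep m *\<^sub>R b"
    let ?f = "\<lambda>x. trig A c x * trig B d x * E x"
    define c' where "c' = (\<lambda>k. c k * (cis (freq k \<bullet> h) - 1))"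
    define d' where "d' = (\<lambda>k. d k * (cis (freq k \<bullet> h) - 1))"
    define d2 where "d2 = (\<lambda>k. d k * cis (freq k \<bullet> h))"
    let ?I = "\<lambda>A c B d. LINT x|torus. (cmod (trig A c x * trig B d x))\<^sup>2"
    have f: "unif_trig ?f" using A B E by (intro unif_trig_mult unif_trig_trig)
    have sq: "sq_int (\<lambda>x. trig A c x * trig B d x)" for c d
      by (intro sq_int_mult_bounded[OF sq_int_trig _ cmod_trig_le]) auto
    have pc: "trig A c (x + h) - trig A c x = trig A c' x" for x
      by (simp only: trig_shift trig_diff c'_def right_diff_distrib mult_1_right)
    have pd: "trig B d (x + h) - trig B d x = trig B d' x" for x
      by (simp only: trig_shift trig_diff d'_def right_diff_distrib mult_1_right)
    have p2: "trig B d (x + h) = trig B d2 x" for x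
      by (simp add: trig_shift d2_def)
    have "2 * (\<Sum>k\<in>F. (cmod (fcoef ?f k))\<^sup>2) \<le> (LINT x|torus. (cmod (?f (x + h) - ?f x))\<^sup>2)"
      unfolding h_def using f F b Fm by (rule fcoef_block_le_increment)
    also have "\<dots> \<le> (LINT x|torus. 3 * M\<^sup>2 * (cmod (trig A c' x * trig B d2 x))\<^sup>2
        + 3 * M\<^sup>2 * (cmod (trig A c x * trig B d' x))\<^sup>2 + 3 * (K * qr ^ m)\<^sup>2 * (cmod (trig A c x * trig B d x))\<^sup>2)"
    proof (rule integral_mono)
      show "integrable torus (\<lambda>x. (cmod (?f (x + h) - ?f x))\<^sup>2)"
        using sq_int_diff[OF unif_trig_sq_int[OF unif_trig_shift[OF f]] unif_trig_sq_int[OF f], of h]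
        by (simp add: sq_int_def)
      show "integrable torus (\<lambda>x. 3 * M\<^sup>2 * (cmod (trig A c' x * trig B d2 x))\<^sup>2
        + 3 * M\<^sup>2 * (cmod (trig A c x * trig B d' x))\<^sup>2 + 3 * (K * qr ^ m)\<^sup>2 * (cmod (trig A c x * trig B d x))\<^sup>2)"
        using sq unfolding sq_int_def by (intro Bochner_Integration.integrable_add integrable_mult_right) blast+
      fix x
      let ?a = "trig A c' x * trig B d2 x * E (x + h)" and ?b = "trig A c x * trig B d' x * E (x + h)"
        and ?c = "trig A c x * trig B d x * (E (x + h) - E x)"
      \<comment> \<open>The factors are shifted one after the other; \<open>E\<close> is shifted in
        the first two terms, where only its bound \<open>M\<close> matters.\<close>
      have "?f (x + h) - ?f x = ?a + ?b + ?c"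
        unfolding pc[symmetric] pd[symmetric] p2[symmetric] by (simp add: algebra_simps)
      then have "(cmod (?f (x + h) - ?f x))\<^sup>2 \<le> 3 * (cmod ?a)\<^sup>2 + 3 * (cmod ?b)\<^sup>2 + 3 * (cmod ?c)\<^sup>2"
        using sum3_sq_le by presburger
      moreover have "(cmod ?a)\<^sup>2 \<le> M\<^sup>2 * (cmod (trig A c' x * trig B d2 x))\<^sup>2"
        using mult_left_mono[OF power_mono[OF M[of "x + h"] norm_ge_zero, of 2], of "(cmod (trig A c' x * trig B d2 x))\<^sup>2"]
        by (simp add: norm_mult power_mult_distrib mult_ac)
      moreover have "(cmod ?b)\<^sup>2 \<le> M\<^sup>2 * (cmod (trig A c x * trig B d' x))\<^sup>2"
        using mult_left_mono[OF power_mono[OF M[of "x + h"] norm_ge_zero, of 2], of "(cmod (trig A c x * trig B d' x))\<^sup>2"]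
        by (simp add: norm_mult power_mult_distrib mult_ac)
      moreover have "(cmod ?c)\<^sup>2 \<le> (K * qr ^ m)\<^sup>2 * (cmod (trig A c x * trig B d x))\<^sup>2"
        using mult_left_mono[OF power_mono[OF K[of x, folded h_def] norm_ge_zero, of 2], of "(cmod (trig A c x * trig B d x))\<^sup>2"]
        by (simp add: norm_mult power_mult_distrib mult_ac)
      ultimately show "(cmod (?f (x + h) - ?f x))\<^sup>2 \<le> 3 * M\<^sup>2 * (cmod (trig A c' x * trig B d2 x))\<^sup>2
        + 3 * M\<^sup>2 * (cmod (trig A c x * trig B d' x))\<^sup>2 + 3 * (K * qr ^ m)\<^sup>2 * (cmod (trig A c x * trig B d x))\<^sup>2"
        by linarith
    qed
    also have "\<dots> = 3 * M\<^sup>2 * ?I A c' B d2 + 3 * M\<^sup>2 * ?I A c B d' + 3 * (K * qr ^ m)\<^sup>2 * ?I A c B d"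
    proof -
      have i: "integrable torus (\<lambda>x. r * (cmod (trig A c x * trig B d x))\<^sup>2)" for r :: real and c d
        using sq[of c d] unfolding sq_int_def by (intro integrable_mult_right) blast
      show ?thesis
        by (simp only: Bochner_Integration.integral_add Bochner_Integration.integrable_add i integral_mult_right_zero)
    qed
    also have "\<dots> \<le> 3 * M\<^sup>2 * (C * (8 * (qr ^ m)\<^sup>2 * nH A c) * nwt B d) + 3 * M\<^sup>2 * (C * nwt A c * (8 * (qr ^ m)\<^sup>2 * nH B d))
        + 3 * (K * qr ^ m)\<^sup>2 * (C * nH A c * nwt B d)"
    proof (intro add_mono mult_left_mono)
      \<comment> \<open>Translation multiplies coefficients by numbers of modulus one and preserves
        Sobolev norms.\<close>
      have "nwt B d2 = nwt B d" by (simp add: nwt_def d2_def norm_mult)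
      moreover have "nwt A c' \<le> 8 * (qr ^ m)\<^sup>2 * nH A c"
        unfolding c'_def h_def using b by (rule nwt_difference_le)
      ultimately show "?I A c' B d2 \<le> C * (8 * (qr ^ m)\<^sup>2 * nH A c) * nwt B d"
        using C(2)[OF A B, of c' d2] C(1) by (smt (verit) mult_left_mono mult_right_mono nwt_nonneg)
      have "nwt B d' \<le> 8 * (qr ^ m)\<^sup>2 * nH B d"
        unfolding d'_def h_def using b by (rule nwt_difference_le)
      then have "C * nwt A c * nwt B d' \<le> C * nwt A c * (8 * (qr ^ m)\<^sup>2 * nH B d)"
        using C(1) by (intro mult_left_mono) auto
      then show "?I A c B d' \<le> C * nwt A c * (8 * (qr ^ m)\<^sup>2 * nH B d)"
        using C(2)[OF A B, of c d'] by linarith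
      \<comment> \<open>No increment falls on the polynomials in this term; the order of one factor
        is raised to 1 only to bring all terms to a common form.\<close>
      have "C * nwt A c * nwt B d \<le> C * nH A c * nwt B d"
        using C(1) by (intro mult_left_mono mult_right_mono nwt_le_nH) auto
      then show "?I A c B d \<le> C * nH A c * nwt B d"
        using C(2)[OF A B, of c d] by linarith
    qed auto
    also have "\<dots> = C * (qr ^ m)\<^sup>2 * ((24 * M\<^sup>2 + 3 * K\<^sup>2) * (nH A c * nwt B d) + 24 * M\<^sup>2 * (nwt A c * nH B d))"
      by (simp add: power_mult_distrib algebra_simps)
    \<comment> \<open>24 = 3 * 8, from three terms in the square and the factor 8 in
      \<open>nwt_difference_le\<close>; the factor 2 gained on the left leaves the constant
      12.\<close>
    also have "\<dots> \<le> C * (qr ^ m)\<^sup>2 * ((24 * (M\<^sup>2 + K\<^sup>2)) * (nH A c * nwt B d) + 24 * (M\<^sup>2 + K\<^sup>2) * (nwt A c * nH B d))"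
      using C(1) by (intro mult_left_mono add_mono mult_right_mono) auto
    also have "\<dots> = 2 * (12 * C * (M\<^sup>2 + K\<^sup>2) * (qr ^ m)\<^sup>2 * (nH A c * nwt B d + nwt A c * nH B d))"
      by (simp add: algebra_simps)
    finally show ?thesis by (rule mult_left_le_imp_le) simp
  qed
  with C(1) show thesis by (intro that[of "12 * C"]) auto
qed

section \<open>Sobolev functions\<close>

lemma trig_monomial_has_derivative:
  "((\<lambda>x. a * cos (freq k \<bullet> x) + c * sin (freq k \<bullet> x)) has_derivative
    (\<lambda>h. (- a * sin (freq k \<bullet> x) + c * cos (freq k \<bullet> x)) * (freq k \<bullet> h))) (at x)"
  by (auto intro!: derivative_eq_intros simp: algebra_simps)

lemma frechet_derivative_trig_monomial:
  "frechet_derivative (\<lambda>x. a * cos (freq k \<bullet> x) + c * sin (freq k \<bullet> x)) (at x) h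
    = (c * (freq k \<bullet> h)) * cos (freq k \<bullet> x) + (- a * (freq k \<bullet> h)) * sin (freq k \<bullet> x)"
  using frechet_derivative_at[OF trig_monomial_has_derivative[of a k c x], symmetric]
  by (simp add: algebra_simps)

text \<open>For fixed \<open>k\<close> this two-parameter family is closed under directional
  derivatives, so the induction on the order runs over all \<open>a\<close> and \<open>c\<close> at
  once.\<close>

lemma smooth_trig_monomial: "smooth (\<lambda>x. a * cos (freq k \<bullet> x) + c * sin (freq k \<bullet> x))"
proof -
  have "C_k n (\<lambda>x. a * cos (freq k \<bullet> x) + c * sin (freq k \<bullet> x))" for n
  proof (induction n arbitrary: a c)
    case 0
    show ?case by (auto intro!: continuous_intros)
  next
    case (Suc n)
    have "(\<lambda>x. a * cos (freq k \<bullet> x) + c * sin (freq k \<bullet> x)) differentiable at x" for x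
      using trig_monomial_has_derivative[of a k c x] unfolding differentiable_def by blast
    then show ?case
      unfolding C_k.simps frechet_derivative_trig_monomial using Suc by blast
  qed
  then show ?thesis by (simp add: smooth_def)
qed

lemma cis_freq_periodic:
  assumes b: "b \<in> Basis"
  shows "cis (freq k \<bullet> (x + (2 * pi) *\<^sub>R b)) = cis (freq k \<bullet> x)"
proof -
  obtain n :: int where "freq k \<bullet> b = real_of_int n"
    using b by (auto simp: freq_def Basis_prod_def)
  then have eq: "freq k \<bullet> (x + (2 * pi) *\<^sub>R b) = freq k \<bullet> x + 2 * pi * real_of_int n"
    by (simp add: inner_add_right)
  show ?thesis unfolding eq cis_mult[symmetric] cis_multiple_2pi[OF Ints_of_int] by simp
qed

lemma periodic_trig_monomial: "periodic (\<lambda>x. a * cos (freq k \<bullet> x) + c * sin (freq k \<bullet> x))"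
  unfolding periodic_def using cis_freq_periodic by (auto simp: complex_eq_iff)

lemma L2_sq_int: "f \<in> L2 \<Longrightarrow> sq_int (\<lambda>x. complex_of_real (f x))"
  by (auto simp: L2_def sq_int_def)

lemma L2_norm_sq: "(L2_norm f)\<^sup>2 = (LINT x|torus. (cmod (complex_of_real (f x)))\<^sup>2)"
  by (simp add: L2_norm_def)

lemma L2_integrable: "f \<in> L2 \<Longrightarrow> integrable torus f"
  using integrable_Re[OF sq_int_integrable[OF L2_sq_int]] by simp

lemma integrable_mult_bounded_real:
  fixes f g :: "real \<times> real \<Rightarrow> real"
  assumes f: "integrable torus f" and [measurable]: "g \<in> borel_measurable borel" and g: "\<And>x. \<bar>g x\<bar> \<le> 1"
  shows "integrable torus (\<lambda>x. f x * g x)"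
proof (rule Bochner_Integration.integrable_bound[OF f])
  have [measurable]: "f \<in> borel_measurable borel" using borel_measurable_integrable[OF f] by simp
  show "(\<lambda>x. f x * g x) \<in> borel_measurable torus" by measurable
  show "AE x in torus. norm (f x * g x) \<le> norm (f x)"
    using g by (auto simp: abs_mult intro!: mult_left_le)
qed

lemma fourier_coeff_cos_sin:
  assumes f: "f \<in> L2"
  shows "fourier_coeff f k = complex_of_real (LINT x|torus. f x * cos (freq k \<bullet> x))
    - \<i> * complex_of_real (LINT x|torus. f x * sin (freq k \<bullet> x))"
proof -
  have int: "integrable torus (\<lambda>x. f x * cos (freq k \<bullet> x))" "integrable torus (\<lambda>x. f x * sin (freq k \<bullet> x))"
    using L2_integrable[OF f] by (auto intro!: integrable_mult_bounded_real)
  have "fourier_coeff f k = (LINT x|torus. complex_of_real (f x * cos (freq k \<bullet> x))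
      - \<i> * complex_of_real (f x * sin (freq k \<bullet> x)))"
    unfolding fourier_coeff_def by (intro Bochner_Integration.integral_cong) (auto simp: complex_eq_iff)
  also have "\<dots> = (LINT x|torus. complex_of_real (f x * cos (freq k \<bullet> x)))
      - (LINT x|torus. \<i> * complex_of_real (f x * sin (freq k \<bullet> x)))"
    using int by (intro Bochner_Integration.integral_diff integrable_mult_right integrable_of_real)
  also have "\<dots> = complex_of_real (LINT x|torus. f x * cos (freq k \<bullet> x))
    - \<i> * complex_of_real (LINT x|torus. f x * sin (freq k \<bullet> x))"
    by (simp only: integral_mult_right_zero integral_complex_of_real)
  finally show ?thesis .
qed

text \<open>Test functions are real-valued, so cosine and sine are tested separately and recombined
  into the complex coefficient.\<close>

lemma fourier_coeff_weak_deriv: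
  assumes v: "v \<in> L2" and g: "is_weak_deriv b v g"
  shows "fourier_coeff g k = \<i> * complex_of_real (freq k \<bullet> b) * fourier_coeff v k"
proof -
  let ?c = "\<lambda>f. LINT x|torus. f x * cos (freq k \<bullet> x)" and ?s = "\<lambda>f. LINT x|torus. f x * sin (freq k \<bullet> x)"
  have test: "(LINT x|torus. v x * ((c * (freq k \<bullet> b)) * cos (freq k \<bullet> x) + (- a * (freq k \<bullet> b)) * sin (freq k \<bullet> x)))
     = - (LINT x|torus. g x * (a * cos (freq k \<bullet> x) + c * sin (freq k \<bullet> x)))" for a c
    using g smooth_trig_monomial[of a k c] periodic_trig_monomial[of a k c]
    unfolding is_weak_deriv_def frechet_derivative_trig_monomial[symmetric] by blast
  have "- (freq k \<bullet> b) * ?s v = (LINT x|torus. v x * (- (freq k \<bullet> b) * sin (freq k \<bullet> x)))"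
    unfolding integral_mult_right_zero[symmetric] by (simp add: mult_ac)
  also have "\<dots> = - ?c g"
    using test[of 0 1] by simp
  finally have 1: "?c g = (freq k \<bullet> b) * ?s v" by simp
  have "(freq k \<bullet> b) * ?c v = (LINT x|torus. v x * ((freq k \<bullet> b) * cos (freq k \<bullet> x)))"
    unfolding integral_mult_right_zero[symmetric] by (simp add: mult_ac)
  also have "\<dots> = - ?s g"
    using test[of 1 0] by simp
  finally have 2: "?s g = - (freq k \<bullet> b) * ?c v" by simp
  have "g \<in> L2" using g by (simp add: is_weak_deriv_def)
  then show ?thesis
    unfolding fourier_coeff_cos_sin[OF v] fourier_coeff_cos_sin[OF \<open>g \<in> L2\<close>] 1 2
    by (simp add: complex_eq_iff)
qed

lemma is_weak_deriv_weak_deriv: "v \<in> H1 \<Longrightarrow> b \<in> Basis \<Longrightarrow> is_weak_deriv b v (weak_deriv b v)"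
  unfolding H1_def weak_deriv_def by (simp add: some_eq_ex)

lemma weak_deriv_L2: "v \<in> H1 \<Longrightarrow> b \<in> Basis \<Longrightarrow> weak_deriv b v \<in> L2"
  using is_weak_deriv_weak_deriv by (auto simp: is_weak_deriv_def)

lemma H1_L2: "v \<in> H1 \<Longrightarrow> v \<in> L2"
  by (simp add: H1_def)

lemma H1_norm_sq: "(H1_norm v)\<^sup>2 = (L2_norm v)\<^sup>2 + (\<Sum>b\<in>Basis. (L2_norm (weak_deriv b v))\<^sup>2)"
  unfolding H1_norm_def by (simp add: add_nonneg_nonneg sum_nonneg)

lemma bessel_L2:
  assumes "f \<in> L2" "finite A"
  shows "(\<Sum>k\<in>A. (cmod (fourier_coeff f k))\<^sup>2) \<le> (L2_norm f)\<^sup>2"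
  using bessel[OF L2_sq_int[OF assms(1)] assms(2)] by (simp add: L2_norm_sq fourier_coeff_eq_fcoef)

text \<open>Bessel's inequality for \<open>v\<close> and for each weak derivative, added up. It
  works for the arbitrary representatives chosen by \<open>weak_deriv\<close>, since their
  coefficients are determined.\<close>

lemma bessel_H1:
  assumes v: "v \<in> H1" and A: "finite A"
  shows "(\<Sum>k\<in>A. (1 + (fnorm k)\<^sup>2) * (cmod (fourier_coeff v k))\<^sup>2) \<le> (H1_norm v)\<^sup>2"
proof -
  have "(1 + (fnorm k)\<^sup>2) * (cmod (fourier_coeff v k))\<^sup>2
      = (cmod (fourier_coeff v k))\<^sup>2 + (\<Sum>b\<in>Basis. (cmod (fourier_coeff (weak_deriv b v) k))\<^sup>2)" for k
  proof -
    have "(fnorm k)\<^sup>2 = (\<Sum>b\<in>Basis. (freq k \<bullet> b)\<^sup>2)"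
      unfolding power2_norm_eq_inner by (subst euclidean_inner) (simp add: power2_eq_square)
    moreover have "cmod (fourier_coeff (weak_deriv b v) k) = \<bar>freq k \<bullet> b\<bar> * cmod (fourier_coeff v k)"
      if "b \<in> Basis" for b
      using fourier_coeff_weak_deriv[OF H1_L2[OF v] is_weak_deriv_weak_deriv[OF v that], of k]
      by (simp add: norm_mult)
    ultimately show ?thesis
      by (simp add: distrib_right sum_distrib_right power_mult_distrib)
  qed
  then have "(\<Sum>k\<in>A. (1 + (fnorm k)\<^sup>2) * (cmod (fourier_coeff v k))\<^sup>2)
      = (\<Sum>k\<in>A. (cmod (fourier_coeff v k))\<^sup>2) + (\<Sum>b\<in>Basis. \<Sum>k\<in>A. (cmod (fourier_coeff (weak_deriv b v) k))\<^sup>2)"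
    by (simp add: sum.distrib sum.swap[of _ Basis])
  also have "\<dots> \<le> (H1_norm v)\<^sup>2"
    unfolding H1_norm_sq using v A by (intro add_mono sum_mono bessel_L2 H1_L2 weak_deriv_L2)
  finally show ?thesis .
qed

lemma nH_fourier_le:
  assumes v: "v \<in> H1" and A: "finite A"
  shows "nH A (fourier_coeff v) \<le> 2 * (H1_norm v)\<^sup>2"
proof -
  have "(1 + t)\<^sup>2 \<le> 2 * (1 + t\<^sup>2)" for t :: real
    using zero_le_power2[of "1 - t"] by (simp add: power2_eq_square algebra_simps)
  then have "nH A (fourier_coeff v) \<le> (\<Sum>k\<in>A. 2 * (1 + (fnorm k)\<^sup>2) * (cmod (fourier_coeff v k))\<^sup>2)"
    unfolding nH_def by (intro sum_mono mult_right_mono) auto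
  also have "\<dots> \<le> 2 * (H1_norm v)\<^sup>2"
    using bessel_H1[OF v A] by (simp only: sum_distrib_left[symmetric] mult.assoc mult_le_cancel_left_pos zero_less_numeral)
  finally show ?thesis .
qed

text \<open>With t the square root of 1 + |k|, this reads t^3 \<le> \<delta> t^4 + \<delta>^(-3):
  the first term suffices if \<delta> t \<ge> 1, the second one otherwise.\<close>

lemma wt_interpolation:
  assumes \<delta>: "\<delta> > 0"
  shows "wt k \<le> \<delta> * (1 + fnorm k)\<^sup>2 + (1 / \<delta>) ^ 3"
proof (cases "\<delta> * sqrt (1 + fnorm k) \<ge> 1")
  case True
  have "wt k * 1 \<le> wt k * (\<delta> * sqrt (1 + fnorm k))"
    using True wt_pos[of k] by (intro mult_left_mono) auto
  also have "wt k * sqrt (1 + fnorm k) = (1 + fnorm k)\<^sup>2"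
    using one_plus_fnorm_pos[of k]
    by (simp add: wt_def powr_half_sqrt[symmetric] powr_add[symmetric] powr_numeral)
  then have "wt k * (\<delta> * sqrt (1 + fnorm k)) = \<delta> * (1 + fnorm k)\<^sup>2" by simp
  finally have "wt k \<le> \<delta> * (1 + fnorm k)\<^sup>2" by simp
  moreover have "0 \<le> (1 / \<delta>) ^ 3" using \<delta> by simp
  ultimately show ?thesis by linarith
next
  case False
  then have *: "sqrt (1 + fnorm k) \<le> 1 / \<delta>" using \<delta> by (simp add: field_simps)
  have "wt k = sqrt (1 + fnorm k) ^ 3"
    using one_plus_fnorm_pos[of k]
    by (simp add: wt_def powr_half_sqrt[symmetric] powr_power)
  also have "\<dots> \<le> (1 / \<delta>) ^ 3"
    using * one_plus_fnorm_pos[of k] by (intro power_mono) auto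
  finally show ?thesis using \<delta> by (simp add: add_increasing)
qed

lemma nwt_fourier_le:
  assumes v: "v \<in> H1" and A: "finite A" and \<delta>: "\<delta> > 0"
  shows "nwt A (fourier_coeff v) \<le> 2 * \<delta> * (H1_norm v)\<^sup>2 + (1 / \<delta>) ^ 3 * (L2_norm v)\<^sup>2"
proof -
  have "nwt A (fourier_coeff v)
      \<le> (\<Sum>k\<in>A. (\<delta> * (1 + fnorm k)\<^sup>2 + (1 / \<delta>) ^ 3) * (cmod (fourier_coeff v k))\<^sup>2)"
    unfolding nwt_def by (intro sum_mono mult_right_mono wt_interpolation \<delta>) auto
  also have "\<dots> = \<delta> * nH A (fourier_coeff v) + (1 / \<delta>) ^ 3 * (\<Sum>k\<in>A. (cmod (fourier_coeff v k))\<^sup>2)"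
    by (simp add: nH_def distrib_right sum.distrib sum_distrib_left mult.assoc)
  also have "\<dots> \<le> \<delta> * (2 * (H1_norm v)\<^sup>2) + (1 / \<delta>) ^ 3 * (L2_norm v)\<^sup>2"
    using \<delta> by (intro add_mono mult_left_mono nH_fourier_le[OF v A] bessel_L2[OF H1_L2[OF v] A]) auto
  finally show ?thesis by simp
qed

text \<open>Products of two L2-convergent sequences with a bounded factor converge in L1, hence
  coefficientwise. This carries the block estimate over from polynomials to Sobolev
  functions.\<close>

lemma fcoef_product_tendsto:
  assumes u: "sq_int u" and v: "sq_int v" and E: "E \<in> borel_measurable borel" "\<And>x. cmod (E x) \<le> M"
    and p: "\<And>N. sq_int (p N)" "(\<lambda>N. LINT x|torus. (cmod (u x - p N x))\<^sup>2) \<longlonglongrightarrow> 0"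
    and r: "\<And>N. sq_int (r N)" "(\<lambda>N. LINT x|torus. (cmod (v x - r N x))\<^sup>2) \<longlonglongrightarrow> 0"
  shows "(\<lambda>N. fcoef (\<lambda>x. p N x * r N x * E x) k) \<longlonglongrightarrow> fcoef (\<lambda>x. u x * v x * E x) k"
proof -
  let ?n = "\<lambda>f. sqrt (LINT x|torus. (cmod (f x))\<^sup>2)"
  define e where "e x = E x * cis (- (freq k \<bullet> x))" for x
  have [measurable]: "e \<in> borel_measurable borel" using E(1) unfolding e_def by measurable
  have e: "cmod (e x) \<le> M" for x using E(2)[of x] by (simp add: e_def norm_mult)
  have M: "M \<ge> 0" using order_trans[OF norm_ge_zero e[of 0]] .
  have coef: "fcoef (\<lambda>x. f x * g x * E x) k = (LINT x|torus. f x * (g x * e x))" for f g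
    unfolding fcoef_def e_def by (simp add: mult_ac)
  have sqe: "sq_int (\<lambda>x. g x * e x)" if "sq_int g" for g
    using that e by (intro sq_int_mult_bounded) auto
  have bd: "cmod (LINT x|torus. f x * (g x * e x)) \<le> M * (?n f * ?n g)" if f: "sq_int f" and g: "sq_int g" for f g
  proof -
    have "(cmod (LINT x|torus. f x * (g x * e x)))\<^sup>2
        \<le> (LINT x|torus. (cmod (f x))\<^sup>2) * (LINT x|torus. (cmod (g x * e x))\<^sup>2)"
      using f sqe[OF g] by (rule integral_cauchy_schwarz)
    also have "(LINT x|torus. (cmod (g x * e x))\<^sup>2) \<le> (LINT x|torus. M\<^sup>2 * (cmod (g x))\<^sup>2)"
    proof (rule integral_mono)
      fix x
      have "(cmod (g x))\<^sup>2 * (cmod (e x))\<^sup>2 \<le> (cmod (g x))\<^sup>2 * M\<^sup>2"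
        using e by (intro mult_left_mono power_mono) auto
      then show "(cmod (g x * e x))\<^sup>2 \<le> M\<^sup>2 * (cmod (g x))\<^sup>2"
        by (simp add: norm_mult power_mult_distrib mult.commute)
    qed (use g sqe[OF g] in \<open>auto simp: sq_int_def\<close>)
    then have "(LINT x|torus. (cmod (f x))\<^sup>2) * (LINT x|torus. (cmod (g x * e x))\<^sup>2)
        \<le> (LINT x|torus. (cmod (f x))\<^sup>2) * (M\<^sup>2 * (LINT x|torus. (cmod (g x))\<^sup>2))"
      by (intro mult_left_mono) auto
    also have "\<dots> = (M * (?n f * ?n g))\<^sup>2"
      by (simp add: power_mult_distrib)
    finally show ?thesis
      by (rule power2_le_imp_le) (use M in auto)
  qed
  have int: "integrable torus (\<lambda>x. f x * (g x * e x))" if "sq_int f" "sq_int g" for f g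
    using that sqe by (intro integrable_sq_int_mult) auto
  have tri: "?n (p N) \<le> sqrt (2 * (LINT x|torus. (cmod (u x - p N x))\<^sup>2) + 2 * (LINT x|torus. (cmod (u x))\<^sup>2))" for N
  proof -
    have "(LINT x|torus. (cmod (p N x))\<^sup>2)
        \<le> 2 * (LINT x|torus. (cmod (p N x - u x))\<^sup>2) + 2 * (LINT x|torus. (cmod (u x))\<^sup>2)"
      using integral_sq_triangle[of "p N" u "\<lambda>_. 0"] u p(1)[of N] by (simp add: sq_int_diff)
    then show ?thesis by (simp add: norm_minus_commute)
  qed
  have est: "cmod (fcoef (\<lambda>x. u x * v x * E x) k - fcoef (\<lambda>x. p N x * r N x * E x) k)
      \<le> M * (?n (\<lambda>x. u x - p N x) * ?n v)
        + M * (sqrt (2 * (LINT x|torus. (cmod (u x - p N x))\<^sup>2) + 2 * (LINT x|torus. (cmod (u x))\<^sup>2))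
            * ?n (\<lambda>x. v x - r N x))" (is "_ \<le> ?b N") for N
  proof -
    have up: "sq_int (\<lambda>x. u x - p N x)" and vr: "sq_int (\<lambda>x. v x - r N x)"
      using u v p r by (auto intro: sq_int_diff)
    have "fcoef (\<lambda>x. u x * v x * E x) k - fcoef (\<lambda>x. p N x * r N x * E x) k
        = (LINT x|torus. u x * (v x * e x) - p N x * (r N x * e x))"
      unfolding coef by (rule Bochner_Integration.integral_diff[symmetric, OF int[OF u v] int[OF p(1) r(1)]])
    also have "\<dots> = (LINT x|torus. (u x - p N x) * (v x * e x) + p N x * ((v x - r N x) * e x))"
      by (intro Bochner_Integration.integral_cong refl) (simp add: algebra_simps)
    also have "\<dots> = (LINT x|torus. (u x - p N x) * (v x * e x)) + (LINT x|torus. p N x * ((v x - r N x) * e x))"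
      by (rule Bochner_Integration.integral_add[OF int[OF up v] int[OF p(1) vr]])
    finally have "cmod (fcoef (\<lambda>x. u x * v x * E x) k - fcoef (\<lambda>x. p N x * r N x * E x) k)
        \<le> cmod (LINT x|torus. (u x - p N x) * (v x * e x)) + cmod (LINT x|torus. p N x * ((v x - r N x) * e x))"
      by (rule ord_eq_le_trans[OF arg_cong[where f = cmod]]) (rule norm_triangle_ineq)
    also have "\<dots> \<le> M * (?n (\<lambda>x. u x - p N x) * ?n v) + M * (?n (p N) * ?n (\<lambda>x. v x - r N x))"
      using up v p(1) vr by (intro add_mono bd)
    also have "\<dots> \<le> ?b N"
      by (intro add_mono order_refl mult_left_mono[OF mult_right_mono[OF tri] M] real_sqrt_ge_zero
          Bochner_Integration.integral_nonneg zero_le_power2)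
    finally show ?thesis .
  qed
  have "?b \<longlonglongrightarrow> M * (sqrt 0 * ?n v) + M * (sqrt (2 * 0 + 2 * (LINT x|torus. (cmod (u x))\<^sup>2)) * sqrt 0)"
    using p(2) r(2) by (intro tendsto_intros)
  then have "?b \<longlonglongrightarrow> 0" by simp
  then have "(\<lambda>N. fcoef (\<lambda>x. p N x * r N x * E x) k - fcoef (\<lambda>x. u x * v x * E x) k) \<longlonglongrightarrow> 0"
    by (rule Lim_null_comparison[OF always_eventually, rotated])
       (rule allI, rule ord_eq_le_trans[OF norm_minus_commute], rule est)
  then show ?thesis by (rule LIM_zero_cancel)
qed

text \<open>The bounds \<open>B1\<close> and \<open>B2\<close> on the norms of order 3/4 stay free:
  continuity inserts the full H1 norm, coercivity the interpolated bound with a small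
  parameter.\<close>

lemma block_estimate_H1:
  obtains C :: real where "C > 0"
    "\<And>v1 v2 E M K b m F B1 B2. v1 \<in> H1 \<Longrightarrow> v2 \<in> H1 \<Longrightarrow> unif_trig E \<Longrightarrow> (\<And>x. cmod (E x) \<le> M) \<Longrightarrow> b \<in> Basis \<Longrightarrow>
      (\<And>x. cmod (E (x + hstep m *\<^sub>R b) - E x) \<le> K * qr ^ m) \<Longrightarrow> finite F \<Longrightarrow>
      (\<And>k. k \<in> F \<Longrightarrow> 2 ^ m \<le> \<bar>freq k \<bullet> b\<bar> \<and> \<bar>freq k \<bullet> b\<bar> \<le> 2 ^ Suc m) \<Longrightarrow>
      (\<And>A. finite A \<Longrightarrow> nwt A (fourier_coeff v1) \<le> B1) \<Longrightarrow> (\<And>A. finite A \<Longrightarrow> nwt A (fourier_coeff v2) \<le> B2) \<Longrightarrow>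
      (\<Sum>k\<in>F. (cmod (fcoef (\<lambda>x. complex_of_real (v1 x) * complex_of_real (v2 x) * E x) k))\<^sup>2)
        \<le> C * (M\<^sup>2 + K\<^sup>2) * (qr ^ m)\<^sup>2 * ((H1_norm v1)\<^sup>2 * B2 + B1 * (H1_norm v2)\<^sup>2)"
proof (rule block_estimate)
  fix C :: real
  assume C: "C > 0"
    "\<And>A B c d E M K b m F. finite A \<Longrightarrow> finite B \<Longrightarrow> unif_trig E \<Longrightarrow> (\<And>x. cmod (E x) \<le> M) \<Longrightarrow> b \<in> Basis \<Longrightarrow>
      (\<And>x. cmod (E (x + hstep m *\<^sub>R b) - E x) \<le> K * qr ^ m) \<Longrightarrow> finite F \<Longrightarrow>
      (\<And>k. k \<in> F \<Longrightarrow> 2 ^ m \<le> \<bar>freq k \<bullet> b\<bar> \<and> \<bar>freq k \<bullet> b\<bar> \<le> 2 ^ Suc m) \<Longrightarrow>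
      (\<Sum>k\<in>F. (cmod (fcoef (\<lambda>x. trig A c x * trig B d x * E x) k))\<^sup>2)
        \<le> C * (M\<^sup>2 + K\<^sup>2) * (qr ^ m)\<^sup>2 * (nH A c * nwt B d + nwt A c * nH B d)"
  have "(\<Sum>k\<in>F. (cmod (fcoef (\<lambda>x. complex_of_real (v1 x) * complex_of_real (v2 x) * E x) k))\<^sup>2)
        \<le> 2 * C * (M\<^sup>2 + K\<^sup>2) * (qr ^ m)\<^sup>2 * ((H1_norm v1)\<^sup>2 * B2 + B1 * (H1_norm v2)\<^sup>2)"
    if v1: "v1 \<in> H1" and v2: "v2 \<in> H1" and E: "unif_trig E" and M: "\<And>x. cmod (E x) \<le> M" and b: "b \<in> Basis"
      and K: "\<And>x. cmod (E (x + hstep m *\<^sub>R b) - E x) \<le> K * qr ^ m" and F: "finite F"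
      and Fm: "\<And>k. k \<in> F \<Longrightarrow> 2 ^ m \<le> \<bar>freq k \<bullet> b\<bar> \<and> \<bar>freq k \<bullet> b\<bar> \<le> 2 ^ Suc m"
      and B1: "\<And>A. finite A \<Longrightarrow> nwt A (fourier_coeff v1) \<le> B1" and B2: "\<And>A. finite A \<Longrightarrow> nwt A (fourier_coeff v2) \<le> B2"
    for v1 v2 E M K b m F B1 B2
  proof -
    let ?p = "\<lambda>v N x. trig (fbox N) (fourier_coeff v) x"
    have B: "B1 \<ge> 0" "B2 \<ge> 0" using B1[of "{}"] B2[of "{}"] by (simp_all add: nwt_def)
    have lim: "(\<lambda>N. LINT x|torus. (cmod (complex_of_real (v x) - ?p v N x))\<^sup>2) \<longlonglongrightarrow> 0" if "v \<in> H1" for v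
    proof -
      have "fourier_coeff v = fcoef (\<lambda>x. complex_of_real (v x))"
        by (rule ext) (rule fourier_coeff_eq_fcoef)
      then show ?thesis
        using fourier_partial_sums_tendsto[OF L2_sq_int[OF H1_L2[OF that]]] by simp
    qed
    have "(\<lambda>N. \<Sum>k\<in>F. (cmod (fcoef (\<lambda>x. ?p v1 N x * ?p v2 N x * E x) k))\<^sup>2)
      \<longlonglongrightarrow> (\<Sum>k\<in>F. (cmod (fcoef (\<lambda>x. complex_of_real (v1 x) * complex_of_real (v2 x) * E x) k))\<^sup>2)"
      using v1 v2 lim E M
      by (intro tendsto_intros fcoef_product_tendsto[where M = M] L2_sq_int H1_L2 sq_int_trig unif_trig_measurable)
    moreover have "(\<Sum>k\<in>F. (cmod (fcoef (\<lambda>x. ?p v1 N x * ?p v2 N x * E x) k))\<^sup>2)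
        \<le> 2 * C * (M\<^sup>2 + K\<^sup>2) * (qr ^ m)\<^sup>2 * ((H1_norm v1)\<^sup>2 * B2 + B1 * (H1_norm v2)\<^sup>2)" for N
    proof -
      let ?n1 = "nH (fbox N) (fourier_coeff v1)" and ?n2 = "nH (fbox N) (fourier_coeff v2)"
      let ?w1 = "nwt (fbox N) (fourier_coeff v1)" and ?w2 = "nwt (fbox N) (fourier_coeff v2)"
      have "(\<Sum>k\<in>F. (cmod (fcoef (\<lambda>x. ?p v1 N x * ?p v2 N x * E x) k))\<^sup>2)
          \<le> C * (M\<^sup>2 + K\<^sup>2) * (qr ^ m)\<^sup>2 * (?n1 * ?w2 + ?w1 * ?n2)"
        using finite_fbox finite_fbox E M b K F Fm by (rule C(2))
      also have "\<dots> \<le> C * (M\<^sup>2 + K\<^sup>2) * (qr ^ m)\<^sup>2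
          * ((2 * (H1_norm v1)\<^sup>2) * B2 + B1 * (2 * (H1_norm v2)\<^sup>2))"
        using C(1) v1 v2 B B1 B2 by (intro mult_left_mono add_mono mult_mono nH_fourier_le) auto
      finally show ?thesis by (simp add: algebra_simps)
    qed
    ultimately show ?thesis
      by (intro LIMSEQ_le_const2) auto
  qed
  with C(1) show thesis by (intro that[of "2 * C"]) auto
qed

section \<open>The duality bracket\<close>

text \<open>Coefficient form of the Besov space of order -1/16 with integrability 2 and third index
  infinity: squared l2 sums grow at most like 2^(m/8). Quantifying over finite sets avoids any
  summability question.\<close>

definition coeff_growth :: "(int \<times> int \<Rightarrow> complex) \<Rightarrow> real \<Rightarrow> bool" where
  "coeff_growth W C \<longleftrightarrow> C \<ge> 0 \<and>
     (\<forall>m F. finite F \<longrightarrow> (\<forall>k\<in>F. fnorm k \<le> 2 ^ m) \<longrightarrow> (\<Sum>k\<in>F. (cmod (W k))\<^sup>2) \<le> C * (1 / qr) ^ m)"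

text \<open>The direction \<open>b\<close> is that of the larger coordinate, which is comparable to
  |k|. This is why increments along the two axes see every nonzero frequency. The exponent
  \<open>m + 2\<close> absorbs |k| \<le> 2 |k . b| together with |k . b| < 2^(m+1).\<close>

lemma dyadic_index:
  assumes "k \<noteq> 0"
  obtains m b where "b \<in> Basis" "2 ^ m \<le> \<bar>freq k \<bullet> b\<bar>" "\<bar>freq k \<bullet> b\<bar> \<le> 2 ^ Suc m" "fnorm k \<le> 2 ^ (m + 2)"
proof -
  define n where "n = nat (max \<bar>fst k\<bar> \<bar>snd k\<bar>)"
  have "n \<ge> 1" using assms by (cases k) (auto simp: n_def zero_prod_def max_def)
  then obtain m where m: "2 ^ m \<le> n" "n < 2 ^ (m + 1)"
    using ex_power_ivl1[of 2 n] by auto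
  obtain b :: "real \<times> real" where b: "b \<in> Basis" "\<bar>freq k \<bullet> b\<bar> = real n"
  proof (cases "\<bar>fst k\<bar> \<ge> \<bar>snd k\<bar>")
    case True
    then show ?thesis
      by (intro that[of "(1, 0)"]) (auto simp: n_def freq_def Basis_prod_def max_def)
  next
    case False
    then show ?thesis
      by (intro that[of "(0, 1)"]) (auto simp: n_def freq_def Basis_prod_def max_def)
  qed
  have "fnorm k \<le> \<bar>real_of_int (fst k)\<bar> + \<bar>real_of_int (snd k)\<bar>"
    using norm_Pair_le[of "real_of_int (fst k)" "real_of_int (snd k)"] by (simp add: freq_def)
  also have "\<dots> \<le> 2 * real n"
    by (simp add: n_def)
  also have "\<dots> \<le> 2 ^ (m + 2)"
  proof -
    have "real n \<le> 2 ^ (m + 1)" using m(2) by (metis less_imp_le numeral_power_less_of_nat_cancel_iff of_nat_less_numeral_power_cancel_iff)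
    then show ?thesis by simp
  qed
  finally have "fnorm k \<le> 2 ^ (m + 2)" .
  moreover have "2 ^ m \<le> real n" using m(1) by (metis numeral_power_le_of_nat_cancel_iff)
  moreover have "real n \<le> 2 ^ Suc m" using m(2) by (metis Suc_eq_plus1 less_imp_le of_nat_less_numeral_power_cancel_iff)
  ultimately show thesis using b that by metis
qed

text \<open>Cauchy-Schwarz on each block multiplies the growth of \<open>W\<close>, a factor
  \<open>1 / qr\<close> to the power (m+2)/2, by the decay \<open>qr ^ m\<close> of
  \<open>g\<close>; what remains is \<open>sqrt qr ^ m / qr\<close>, and the blocks sum up
  geometrically. Frequency 0 belongs to no block and is kept apart.\<close>

lemma pairing_bound:
  assumes W: "coeff_growth W C" and D: "D \<ge> 0" and g: "\<And>k. g k \<ge> 0"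
    and block: "\<And>m b F. b \<in> Basis \<Longrightarrow> finite F \<Longrightarrow>
      (\<And>k. k \<in> F \<Longrightarrow> 2 ^ m \<le> \<bar>freq k \<bullet> b\<bar> \<and> \<bar>freq k \<bullet> b\<bar> \<le> 2 ^ Suc m) \<Longrightarrow> (\<Sum>k\<in>F. (g k)\<^sup>2) \<le> D * (qr ^ m)\<^sup>2"
    and F: "finite F"
  shows "(\<Sum>k\<in>F. cmod (W k) * g k) \<le> cmod (W 0) * g 0 + 2 / (qr * (1 - sqrt qr)) * sqrt (C * D)"
proof -
  have C: "C \<ge> 0" using W by (simp add: coeff_growth_def)
  define sr where "sr = sqrt qr"
  have sr: "0 < sr" "sr < 1" using qr_bounds by (auto simp: sr_def)
  have sr2: "sr * sr = qr" using qr_bounds by (simp add: sr_def)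
  have blk: "(\<Sum>k\<in>S. cmod (W k) * g k) \<le> sqrt (C * D) / qr * sr ^ m"
    if b: "b \<in> Basis" and S: "finite S" and Sm: "\<And>k. k \<in> S \<Longrightarrow> 2 ^ m \<le> \<bar>freq k \<bullet> b\<bar> \<and> \<bar>freq k \<bullet> b\<bar> \<le> 2 ^ Suc m"
      and Sn: "\<And>k. k \<in> S \<Longrightarrow> fnorm k \<le> 2 ^ (m + 2)" for m b S
  proof (rule power2_le_imp_le)
    have "(\<Sum>k\<in>S. cmod (W k) * g k)\<^sup>2 \<le> (\<Sum>k\<in>S. (cmod (W k))\<^sup>2) * (\<Sum>k\<in>S. (g k)\<^sup>2)"
      by (rule Cauchy_Schwarz_ineq_sum)
    also have "\<dots> \<le> (C * (1 / qr) ^ (m + 2)) * (D * (qr ^ m)\<^sup>2)"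
    proof (rule mult_mono)
      show "(\<Sum>k\<in>S. (cmod (W k))\<^sup>2) \<le> C * (1 / qr) ^ (m + 2)"
        using W S Sn unfolding coeff_growth_def by blast
      show "(\<Sum>k\<in>S. (g k)\<^sup>2) \<le> D * (qr ^ m)\<^sup>2"
        using b S Sm by (rule block)
    qed (use C qr_bounds in \<open>auto intro!: sum_nonneg\<close>)
    also have "\<dots> = C * D * (1 / qr)\<^sup>2 * (((1 / qr) ^ m * qr ^ m) * qr ^ m)"
      by (simp add: power_add power2_eq_square)
    also have "(1 / qr) ^ m * qr ^ m = 1"
      using qr_bounds by (simp add: power_mult_distrib[symmetric])
    also have "C * D * (1 / qr)\<^sup>2 * (1 * qr ^ m) = (sqrt (C * D) / qr * sr ^ m)\<^sup>2"
      using C D by (simp add: power_mult_distrib power_divide sr2[symmetric])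
         (simp add: power2_eq_square power_mult_distrib)
    finally show "(\<Sum>k\<in>S. cmod (W k) * g k)\<^sup>2 \<le> (sqrt (C * D) / qr * sr ^ m)\<^sup>2" .
    show "0 \<le> sqrt (C * D) / qr * sr ^ m"
      using C D qr_bounds sr by simp
  qed
  \<comment> \<open>Blocks overlap at powers of two and in the two directions, so one admissible
    index is selected for each frequency before grouping the sum.\<close>
  define P where "P k mb \<longleftrightarrow> snd mb \<in> Basis \<and> 2 ^ fst mb \<le> \<bar>freq k \<bullet> snd mb\<bar> \<and>
     \<bar>freq k \<bullet> snd mb\<bar> \<le> 2 ^ Suc (fst mb) \<and> fnorm k \<le> 2 ^ (fst mb + 2)" for k and mb :: "nat \<times> (real \<times> real)"
  define idx where "idx k = (SOME mb. P k mb)" for k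
  have idx: "P k (idx k)" if "k \<noteq> 0" for k
  proof -
    have "\<exists>mb. P k mb"
      using dyadic_index[OF \<open>k \<noteq> 0\<close>] unfolding P_def by (metis fst_conv snd_conv)
    then show ?thesis unfolding idx_def by (rule someI_ex)
  qed
  define F' where "F' = F - {0}"
  have F': "finite F'" using F by (simp add: F'_def)
  obtain L where L: "fst ` idx ` F' \<subseteq> {..<L}"
    using F' finite_nat_bounded[of "fst ` idx ` F'"] by auto
  have "(\<Sum>k\<in>F. cmod (W k) * g k) \<le> (\<Sum>k\<in>insert 0 F'. cmod (W k) * g k)"
    using F' g by (intro sum_mono2) (auto simp: F'_def)
  also have "\<dots> = cmod (W 0) * g 0 + (\<Sum>k\<in>F'. cmod (W k) * g k)"
    using F' by (subst sum.insert) (auto simp: F'_def)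
  also have "(\<Sum>k\<in>F'. cmod (W k) * g k)
      = (\<Sum>i\<in>{..<L} \<times> Basis. \<Sum>k\<in>{k \<in> F'. idx k = i}. cmod (W k) * g k)"
  proof (rule sum.group[symmetric])
    show "idx ` F' \<subseteq> {..<L} \<times> Basis"
    proof
      fix i assume "i \<in> idx ` F'"
      then obtain k where k: "k \<in> F'" "i = idx k" by auto
      then have "P k i" using idx by (auto simp: F'_def)
      moreover have "fst i \<in> {..<L}" using L k by auto
      ultimately show "i \<in> {..<L} \<times> Basis" by (cases i) (auto simp: P_def)
    qed
  qed (use F' in auto)
  also have "\<dots> \<le> (\<Sum>i\<in>{..<L} \<times> (Basis :: (real \<times> real) set). sqrt (C * D) / qr * sr ^ fst i)"
  proof (rule sum_mono)
    fix i assume i: "i \<in> {..<L} \<times> (Basis :: (real \<times> real) set)"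
    have Pk: "P k i" if "k \<in> {k \<in> F'. idx k = i}" for k
      using idx[of k] that by (auto simp: F'_def)
    show "(\<Sum>k\<in>{k \<in> F'. idx k = i}. cmod (W k) * g k) \<le> sqrt (C * D) / qr * sr ^ fst i"
    proof (rule blk[of "snd i"])
      show "snd i \<in> Basis" using i by auto
      show "finite {k \<in> F'. idx k = i}" using F' by simp
    qed (use Pk in \<open>simp_all add: P_def\<close>)
  qed
  also have "\<dots> = (\<Sum>m<L. \<Sum>b\<in>(Basis :: (real \<times> real) set). sqrt (C * D) / qr * sr ^ m)"
    by (simp only: sum.cartesian_product case_prod_unfold)
  \<comment> \<open>The factor 2 counts the coordinate directions.\<close>
  also have "\<dots> = 2 * (sqrt (C * D) / qr) * (\<Sum>m<L. sr ^ m)"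
    unfolding sum_distrib_left by (rule sum.cong) simp_all
  also have "\<dots> \<le> 2 * (sqrt (C * D) / qr) * (1 / (1 - sr))"
  proof (rule mult_left_mono)
    have "(\<Sum>m<L. sr ^ m) \<le> (\<Sum>m. sr ^ m)"
      using sr by (intro sum_le_suminf summable_geometric) auto
    then show "(\<Sum>m<L. sr ^ m) \<le> 1 / (1 - sr)"
      using suminf_geometric[of sr] sr by simp
  qed (use C D qr_bounds in simp)
  also have "\<dots> = 2 / (qr * (1 - sqrt qr)) * sqrt (C * D)"
    by (simp add: sr_def)
  finally show ?thesis by simp
qed

section \<open>Littlewood-Paley symbols and the bracket\<close>

lemma finite_fnorm_le: "finite {k. fnorm k \<le> R}"
proof (rule finite_subset)
  show "{k. fnorm k \<le> R} \<subseteq> fbox (nat \<lceil>\<bar>R\<bar>\<rceil>)"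
  proof
    fix k assume "k \<in> {k. fnorm k \<le> R}"
    then have "\<bar>real_of_int (fst k)\<bar> \<le> \<bar>R\<bar>" "\<bar>real_of_int (snd k)\<bar> \<le> \<bar>R\<bar>"
      using abs_fst_le_fnorm[of k] abs_snd_le_fnorm[of k] by auto
    then have "\<bar>fst k\<bar> \<le> \<lceil>\<bar>R\<bar>\<rceil>" "\<bar>snd k\<bar> \<le> \<lceil>\<bar>R\<bar>\<rceil>" by linarith+
    then show "k \<in> fbox (nat \<lceil>\<bar>R\<bar>\<rceil>)" by (cases k) (auto simp: fbox_def)
  qed
qed simp

lemma dyadic_partition_nonneg: "dyadic_partition \<phi> \<theta> \<Longrightarrow> 0 \<le> \<phi> x" "dyadic_partition \<phi> \<theta> \<Longrightarrow> 0 \<le> \<theta> x"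
  unfolding dyadic_partition_def by blast+

lemma dyadic_partition_sums:
  "dyadic_partition \<phi> \<theta> \<Longrightarrow> (\<lambda>j. \<theta> ((1 / 2 ^ j) *\<^sub>R x)) sums (1 - \<phi> x)"
  unfolding dyadic_partition_def by blast

lemma dyadic_partition_annulus:
  "dyadic_partition \<phi> \<theta> \<Longrightarrow> \<exists>r R. 0 < r \<and> (\<forall>x. norm x < r \<or> R < norm x \<longrightarrow> \<theta> x = 0)"
  unfolding dyadic_partition_def by (elim conjE)

lemma lp_symbol_nonneg: "dyadic_partition \<phi> \<theta> \<Longrightarrow> 0 \<le> lp_symbol \<phi> \<theta> n k"
  by (cases n) (auto intro: dyadic_partition_nonneg)

lemma finite_lp_symbol:
  assumes "dyadic_partition \<phi> \<theta>"
  shows "finite {k. lp_symbol \<phi> \<theta> n k \<noteq> 0}"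
proof (cases n)
  case 0
  obtain R where R: "\<forall>x. R < norm x \<longrightarrow> \<phi> x = 0" using assms unfolding dyadic_partition_def by blast
  have "{k. lp_symbol \<phi> \<theta> n k \<noteq> 0} \<subseteq> {k. fnorm k \<le> R}"
  proof
    fix k assume "k \<in> {k. lp_symbol \<phi> \<theta> n k \<noteq> 0}"
    then have "\<phi> (freq k) \<noteq> 0" using 0 by simp
    then have "\<not> R < fnorm k" using R by blast
    then show "k \<in> {k. fnorm k \<le> R}" by simp
  qed
  then show ?thesis by (rule finite_subset) (rule finite_fnorm_le)
next
  case (Suc j)
  from dyadic_partition_annulus[OF assms] obtain r R
    where R: "\<forall>x. norm x < r \<or> R < norm x \<longrightarrow> \<theta> x = 0" by (elim exE conjE)
  have "{k. lp_symbol \<phi> \<theta> n k \<noteq> 0} \<subseteq> {k. fnorm k \<le> 2 ^ j * R}"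
  proof
    fix k assume "k \<in> {k. lp_symbol \<phi> \<theta> n k \<noteq> 0}"
    then have "\<theta> ((1 / 2 ^ j) *\<^sub>R freq k) \<noteq> 0" using Suc by simp
    then have "\<not> R < norm ((1 / 2 ^ j) *\<^sub>R freq k)" using R by blast
    then show "k \<in> {k. fnorm k \<le> 2 ^ j * R}" by (simp add: field_simps)
  qed
  then show ?thesis by (rule finite_subset) (rule finite_fnorm_le)
qed

lemma sum_lp_symbol: "(\<Sum>n<Suc N. lp_symbol \<phi> \<theta> n k) = \<phi> (freq k) + (\<Sum>j<N. \<theta> ((1 / 2 ^ j) *\<^sub>R freq k))"
  by (subst sum.lessThan_Suc_shift) simp

lemma sum_lp_symbol_le:
  assumes d: "dyadic_partition \<phi> \<theta>"
  shows "(\<Sum>n<N. lp_symbol \<phi> \<theta> n k) \<le> 1"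
proof -
  have "(\<Sum>n<N. lp_symbol \<phi> \<theta> n k) \<le> (\<Sum>n<Suc N. lp_symbol \<phi> \<theta> n k)"
    using lp_symbol_nonneg[OF d] by simp
  also have "\<dots> = \<phi> (freq k) + (\<Sum>j<N. \<theta> ((1 / 2 ^ j) *\<^sub>R freq k))" by (rule sum_lp_symbol)
  also have "(\<Sum>j<N. \<theta> ((1 / 2 ^ j) *\<^sub>R freq k)) \<le> 1 - \<phi> (freq k)"
  proof -
    note s = dyadic_partition_sums[OF d, of "freq k"]
    show ?thesis
      unfolding sums_unique[OF s]
      by (rule sum_le_suminf[OF sums_summable[OF s]]) (simp_all add: dyadic_partition_nonneg[OF d])
  qed
  finally show ?thesis by simp
qed

lemma cmod_fourier_coeff_uminus: "cmod (fourier_coeff f (- k)) = cmod (fourier_coeff f k)"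
proof -
  have "fourier_coeff f (- k) = (LINT x|torus. cnj (complex_of_real (f x) * cis (- (freq k \<bullet> x))))"
    by (simp add: fourier_coeff_def freq_uminus cis_cnj)
  also have "\<dots> = cnj (fourier_coeff f k)"
    unfolding fourier_coeff_def by (rule Bochner_Integration.integral_cnj)
  finally show ?thesis by simp
qed

text \<open>The term of index \<open>n\<close> pairs \<open>W\<close> and \<open>f\<close>
  coefficientwise with weight \<open>lp_symbol\<close>. These weights are nonnegative with sum over
  \<open>n\<close> at most 1, so the absolute partial sums are dominated by the plain pairing of
  coefficients. Convergence of the series defining the bracket is thus a consequence and not an
  assumption.\<close>

lemma abs_bracket_le:
  assumes d: "dyadic_partition \<phi> \<theta>" and f: "integrable torus f"
    and S: "\<And>F. finite F \<Longrightarrow> (\<Sum>k\<in>F. cmod (W k) * cmod (fourier_coeff f k)) \<le> S"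
  shows "\<bar>bracket \<phi> \<theta> W f\<bar> \<le> S"
proof -
  let ?l = "lp_symbol \<phi> \<theta>"
  define A where "A n = {k. ?l n k \<noteq> 0}" for n
  have A: "finite (A n)" for n unfolding A_def by (rule finite_lp_symbol[OF d])
  define a where "a n = (LINT x|torus. lp_block \<phi> \<theta> n W x * complex_of_real (f x))" for n
  have a: "a n = (\<Sum>k\<in>A n. complex_of_real (?l n k) * W k * fourier_coeff f (- k))" for n
  proof -
    have "a n = (LINT x|torus. (\<Sum>k\<in>A n. (complex_of_real (?l n k) * W k) * (complex_of_real (f x) * cis (freq k \<bullet> x))))"
      unfolding a_def lp_block_def A_def sum_distrib_right by (simp add: mult_ac)
    also have "\<dots> = (\<Sum>k\<in>A n. LINT x|torus. (complex_of_real (?l n k) * W k) * (complex_of_real (f x) * cis (freq k \<bullet> x)))"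
      using f by (intro Bochner_Integration.integral_sum integrable_mult_right integrable_mult_cis) auto
    also have "\<dots> = (\<Sum>k\<in>A n. complex_of_real (?l n k) * W k * fourier_coeff f (- k))"
      by (simp add: fourier_coeff_def freq_uminus)
    finally show ?thesis .
  qed
  have le: "(\<Sum>n<N. cmod (a n)) \<le> S" for N
  proof -
    define U where "U = (\<Union>n<N. A n)"
    have U: "finite U" using A by (simp add: U_def)
    have "(\<Sum>n<N. cmod (a n)) \<le> (\<Sum>n<N. \<Sum>k\<in>U. ?l n k * (cmod (W k) * cmod (fourier_coeff f k)))"
    proof (rule sum_mono)
      fix n assume n: "n \<in> {..<N}"
      have "cmod (a n) \<le> (\<Sum>k\<in>A n. ?l n k * (cmod (W k) * cmod (fourier_coeff f k)))"
        unfolding a by (rule order_trans[OF norm_sum])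
          (simp add: norm_mult lp_symbol_nonneg[OF d] cmod_fourier_coeff_uminus mult.assoc)
      also have "\<dots> \<le> (\<Sum>k\<in>U. ?l n k * (cmod (W k) * cmod (fourier_coeff f k)))"
        using U n lp_symbol_nonneg[OF d] by (intro sum_mono2) (auto simp: U_def)
      finally show "cmod (a n) \<le> (\<Sum>k\<in>U. ?l n k * (cmod (W k) * cmod (fourier_coeff f k)))" .
    qed
    also have "\<dots> = (\<Sum>k\<in>U. (\<Sum>n<N. ?l n k) * (cmod (W k) * cmod (fourier_coeff f k)))"
      by (subst sum.swap) (simp add: sum_distrib_right)
    also have "\<dots> \<le> (\<Sum>k\<in>U. 1 * (cmod (W k) * cmod (fourier_coeff f k)))"
      by (intro sum_mono mult_right_mono sum_lp_symbol_le[OF d]) simp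
    also have "\<dots> \<le> S" using S[OF U] by simp
    finally show ?thesis .
  qed
  have sm: "summable (\<lambda>n. cmod (a n))"
    by (rule summableI_nonneg_bounded[OF norm_ge_zero le])
  have "\<bar>bracket \<phi> \<theta> W f\<bar> \<le> cmod (\<Sum>n. a n)"
    unfolding bracket_def a_def by (rule abs_Re_le_cmod)
  also have "\<dots> \<le> (\<Sum>n. cmod (a n))" by (rule summable_norm[OF sm])
  also have "\<dots> \<le> S" by (rule suminf_le_const[OF sm le])
  finally show ?thesis .
qed

section \<open>Growth of coefficients from L2 and Besov bounds\<close>

lemma coeff_growth_diff:
  assumes "coeff_growth U C" "coeff_growth V D"
  shows "coeff_growth (\<lambda>k. U k - V k) (2 * C + 2 * D)"
  unfolding coeff_growth_def
proof (intro conjI allI impI)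
  show "0 \<le> 2 * C + 2 * D" using assms by (simp add: coeff_growth_def)
  fix m :: nat and F :: "(int \<times> int) set" assume F: "finite F" "\<forall>k\<in>F. fnorm k \<le> 2 ^ m"
  have "(\<Sum>k\<in>F. (cmod (U k - V k))\<^sup>2) \<le> (\<Sum>k\<in>F. 2 * (cmod (U k))\<^sup>2 + 2 * (cmod (V k))\<^sup>2)"
    using sum_sq_le[of "U k" "- V k" for k] by (intro sum_mono) simp
  also have "\<dots> = 2 * (\<Sum>k\<in>F. (cmod (U k))\<^sup>2) + 2 * (\<Sum>k\<in>F. (cmod (V k))\<^sup>2)"
    by (simp add: sum.distrib sum_distrib_left)
  also have "\<dots> \<le> 2 * (C * (1 / qr) ^ m) + 2 * (D * (1 / qr) ^ m)"
    using assms F unfolding coeff_growth_def by (intro add_mono mult_left_mono) auto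
  finally show "(\<Sum>k\<in>F. (cmod (U k - V k))\<^sup>2) \<le> (2 * C + 2 * D) * (1 / qr) ^ m"
    by (simp add: algebra_simps)
qed

lemma coeff_growth_L2:
  assumes "f \<in> L2"
  shows "coeff_growth (fourier_coeff f) ((L2_norm f)\<^sup>2)"
  unfolding coeff_growth_def
proof (intro conjI allI impI)
  fix m :: nat and F :: "(int \<times> int) set" assume F: "finite F"
  have "(1 / qr) ^ m \<ge> 1"
    using qr_bounds by (intro one_le_power) simp
  then have "(L2_norm f)\<^sup>2 * 1 \<le> (L2_norm f)\<^sup>2 * (1 / qr) ^ m"
    by (intro mult_left_mono) auto
  then show "(\<Sum>k\<in>F. (cmod (fourier_coeff f k))\<^sup>2) \<le> (L2_norm f)\<^sup>2 * (1 / qr) ^ m"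
    using bessel_L2[OF assms F] by simp
qed simp

lemma lp_block_eq_trig:
  "lp_block \<phi> \<theta> n T = trig {k. lp_symbol \<phi> \<theta> n k \<noteq> 0} (\<lambda>k. complex_of_real (lp_symbol \<phi> \<theta> n k) * T k)"
  by (rule ext) (simp add: lp_block_def trig_def)

text \<open>
  Frequencies in the ball of radius \<open>2\<^sup>m\<close> meet only \<open>m + O(1)\<close> Littlewood--Paley blocks; the loss of
  powers of \<open>m\<close> is absorbed by the gap between \<open>2\<^sup>m\<^sup>/\<^sup>1\<^sup>6\<close> and \<open>qr\<^sup>-\<^sup>m = 2\<^sup>m\<^sup>/\<^sup>8\<close>.
\<close>

lemma coeff_growth_besov:
  assumes d: "dyadic_partition \<phi> \<theta>" and T: "besov_norm \<phi> \<theta> (- 1 / 32) T \<le> ennreal \<eta>" and \<eta>: "\<eta> \<ge> 0"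
  obtains C where "coeff_growth T C"
proof -
  \<comment> \<open>The loss per block allowed by the order -1/32. The budget
    \<open>1 / qr = g ^ 4\<close> is spent on two powers for the squared block norm and two for the
    squared number of blocks.\<close>
  define g :: real where "g = 2 powr (1 / 32)"
  have g: "g > 1" by (simp add: g_def)
  have g4: "g ^ 4 = 1 / qr"
    unfolding g_def qr_def by (subst powr_power) (auto simp: powr_minus field_simps)
  have blk: "cmod (lp_block \<phi> \<theta> n T x) \<le> \<eta> * g ^ n" for n x
  proof -
    have "ennreal (2 powr ((- 1 / 32) * real n)) * ennreal (cmod (lp_block \<phi> \<theta> n T x)) \<le> ennreal \<eta>"
      using T unfolding besov_norm_def
      by (intro order_trans[OF _ T[unfolded besov_norm_def]] order_trans[OF _ SUP_upper[of n]] mult_left_mono SUP_upper) auto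
    then have "2 powr ((- 1 / 32) * real n) * cmod (lp_block \<phi> \<theta> n T x) \<le> \<eta>"
      using \<eta> by (simp add: ennreal_mult[symmetric] ennreal_le_iff)
    moreover have "g ^ n = 2 powr (real n / 32)" by (simp add: g_def powr_power mult.commute)
    then have "2 powr ((- 1 / 32) * real n) = 1 / g ^ n"
      using powr_minus_divide[of 2 "real n / 32"] by simp
    moreover have "g ^ n > 0" using g by simp
    ultimately show ?thesis by (simp add: pos_divide_le_eq mult.commute)
  qed
  have bl2: "(\<Sum>k\<in>F. (lp_symbol \<phi> \<theta> n k * cmod (T k))\<^sup>2) \<le> (\<eta> * g ^ n)\<^sup>2" if F: "finite F" for n F
  proof -
    let ?A = "{k. lp_symbol \<phi> \<theta> n k \<noteq> 0}"
    have A: "finite ?A" by (rule finite_lp_symbol[OF d])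
    have "(\<Sum>k\<in>F. (lp_symbol \<phi> \<theta> n k * cmod (T k))\<^sup>2) \<le> (\<Sum>k\<in>F \<union> ?A. (lp_symbol \<phi> \<theta> n k * cmod (T k))\<^sup>2)"
      using F A by (intro sum_mono2) auto
    also have "\<dots> = (\<Sum>k\<in>?A. (lp_symbol \<phi> \<theta> n k * cmod (T k))\<^sup>2)"
      using F A by (intro sum.mono_neutral_right) auto
    also have "\<dots> = (\<Sum>k\<in>?A. (cmod (complex_of_real (lp_symbol \<phi> \<theta> n k) * T k))\<^sup>2)"
      by (simp add: norm_mult power_mult_distrib)
    also have "\<dots> = (LINT x|torus. (cmod (lp_block \<phi> \<theta> n T x))\<^sup>2)"
      unfolding lp_block_eq_trig by (rule parseval_trig[OF A, symmetric])
    also have "\<dots> \<le> (LINT x|torus. (\<eta> * g ^ n)\<^sup>2)"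
    proof (rule integral_mono)
      show "integrable torus (\<lambda>x. (cmod (lp_block \<phi> \<theta> n T x))\<^sup>2)"
        unfolding lp_block_eq_trig using sq_int_trig unfolding sq_int_def by blast
      show "(cmod (lp_block \<phi> \<theta> n T x))\<^sup>2 \<le> (\<eta> * g ^ n)\<^sup>2" for x
        by (intro power_mono blk) simp
    qed simp
    also have "\<dots> = (\<eta> * g ^ n)\<^sup>2" by simp
    finally show ?thesis .
  qed
  from dyadic_partition_annulus[OF d] obtain r R
    where r: "0 < r" "\<forall>x. norm x < r \<or> R < norm x \<longrightarrow> \<theta> x = 0" by (elim exE conjE)
  \<comment> \<open>The bump vanishes below radius \<open>r\<close>, so a frequency of size at most
    2^m is invisible to dyadic blocks of index m + c and beyond. The extra unit in \<open>N\<close>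
    counts the low-frequency block.\<close>
  obtain c where c: "(1 / 2) ^ c < r" using real_arch_pow_inv[OF r(1), of "1 / 2"] by auto
  define N where "N m = Suc (m + c)" for m
  have one: "(\<Sum>n<N m. lp_symbol \<phi> \<theta> n k) = 1" if k: "fnorm k \<le> 2 ^ m" for k m
  proof -
    have z: "\<theta> ((1 / 2 ^ j) *\<^sub>R freq k) = 0" if "j \<ge> m + c" for j
    proof (rule r(2)[rule_format, OF disjI1])
      have "norm ((1 / 2 ^ j) *\<^sub>R freq k) = fnorm k / 2 ^ j" by simp
      also have "\<dots> \<le> 2 ^ m / 2 ^ (m + c)"
        using k that by (intro frac_le power_increasing) auto
      also have "\<dots> = (1 / 2) ^ c" by (simp add: power_add power_divide)
      finally show "norm ((1 / 2 ^ j) *\<^sub>R freq k) < r" using c by simp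
    qed
    have "(\<lambda>j. \<theta> ((1 / 2 ^ j) *\<^sub>R freq k)) sums (1 - \<phi> (freq k))"
      by (rule dyadic_partition_sums[OF d])
    moreover have "(\<lambda>j. \<theta> ((1 / 2 ^ j) *\<^sub>R freq k)) sums (\<Sum>j<m + c. \<theta> ((1 / 2 ^ j) *\<^sub>R freq k))"
      using z by (intro sums_finite) (auto simp: not_less)
    ultimately have "(\<Sum>j<m + c. \<theta> ((1 / 2 ^ j) *\<^sub>R freq k)) = 1 - \<phi> (freq k)"
      by (rule sums_unique2[symmetric])
    then show ?thesis unfolding N_def sum_lp_symbol by simp
  qed
  define K where "K = 1 / (g - 1) + real (Suc c)"
  have K: "K > 0" using g by (simp add: K_def add_pos_nonneg)
  have Nm: "real (N m) \<le> K * g ^ m" for m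
  proof -
    \<comment> \<open>Bernoulli's inequality turns the linear count of blocks into one power of
      \<open>g\<close>.\<close>
    have "1 + real m * (g - 1) \<le> g ^ m"
      using Bernoulli_inequality[of "g - 1" m] g by simp
    then have 1: "real m \<le> g ^ m / (g - 1)" using g by (simp add: field_simps)
    have "1 \<le> g ^ m" using g by (intro one_le_power) simp
    then have "real (Suc c) * 1 \<le> real (Suc c) * g ^ m" by (intro mult_left_mono) auto
    with 1 show ?thesis by (simp add: N_def K_def algebra_simps)
  qed
  have "coeff_growth T (K\<^sup>2 * \<eta>\<^sup>2 * g ^ (2 * Suc c))"
    unfolding coeff_growth_def
  proof (intro conjI allI impI)
    fix m :: nat and F :: "(int \<times> int) set" assume F: "finite F" "\<forall>k\<in>F. fnorm k \<le> 2 ^ m"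
    have "(\<Sum>k\<in>F. (cmod (T k))\<^sup>2) \<le> (\<Sum>k\<in>F. real (N m) * (\<Sum>n<N m. (lp_symbol \<phi> \<theta> n k * cmod (T k))\<^sup>2))"
    proof (rule sum_mono)
      fix k assume "k \<in> F"
      \<comment> \<open>The symbols sum to 1 over the relevant blocks; writing the coefficient this
        way prepares Cauchy-Schwarz in the block index.\<close>
      then have "cmod (T k) = (\<Sum>n<N m. 1 * (lp_symbol \<phi> \<theta> n k * cmod (T k)))"
        using F one[of k m] by (simp add: sum_distrib_right[symmetric])
      then have "(cmod (T k))\<^sup>2 = (\<Sum>n<N m. 1 * (lp_symbol \<phi> \<theta> n k * cmod (T k)))\<^sup>2"
        by (rule arg_cong)
      also have "\<dots> \<le> (\<Sum>n<N m. 1\<^sup>2) * (\<Sum>n<N m. (lp_symbol \<phi> \<theta> n k * cmod (T k))\<^sup>2)"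
        by (rule Cauchy_Schwarz_ineq_sum)
      finally show "(cmod (T k))\<^sup>2 \<le> real (N m) * (\<Sum>n<N m. (lp_symbol \<phi> \<theta> n k * cmod (T k))\<^sup>2)"
        by simp
    qed
    also have "\<dots> = real (N m) * (\<Sum>n<N m. \<Sum>k\<in>F. (lp_symbol \<phi> \<theta> n k * cmod (T k))\<^sup>2)"
      by (subst sum.swap) (simp add: sum_distrib_left)
    also have "\<dots> \<le> real (N m) * (\<Sum>n<N m. (\<eta> * g ^ N m)\<^sup>2)"
    proof (intro mult_left_mono sum_mono)
      fix n assume "n \<in> {..<N m}"
      then have "\<eta> * g ^ n \<le> \<eta> * g ^ N m"
        using g \<eta> by (intro mult_left_mono power_increasing) auto
      then have "(\<eta> * g ^ n)\<^sup>2 \<le> (\<eta> * g ^ N m)\<^sup>2"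
        using g \<eta> by (intro power_mono) auto
      with bl2[OF F(1), of n] show "(\<Sum>k\<in>F. (lp_symbol \<phi> \<theta> n k * cmod (T k))\<^sup>2) \<le> (\<eta> * g ^ N m)\<^sup>2"
        by simp
    qed simp
    also have "\<dots> = (real (N m))\<^sup>2 * (\<eta> * g ^ N m)\<^sup>2"
      by (simp add: power2_eq_square)
    also have "\<dots> \<le> (K * g ^ m)\<^sup>2 * (\<eta> * g ^ N m)\<^sup>2"
      by (intro mult_right_mono power_mono Nm) auto
    also have "\<dots> = K\<^sup>2 * \<eta>\<^sup>2 * g ^ (2 * Suc c) * (g ^ 4) ^ m"
    proof -
      have "(g ^ m)\<^sup>2 * (g ^ N m)\<^sup>2 = g ^ (2 * Suc c) * (g ^ 4) ^ m"
        unfolding N_def power_mult[symmetric] power_add[symmetric] by (rule arg_cong[where f = "power g"]) simp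
      then show ?thesis by (simp only: power_mult_distrib mult_ac)
    qed
    finally show "(\<Sum>k\<in>F. (cmod (T k))\<^sup>2) \<le> K\<^sup>2 * \<eta>\<^sup>2 * g ^ (2 * Suc c) * (1 / qr) ^ m"
      by (simp add: g4)
  qed (use K g in simp)
  then show thesis by (rule that)
qed

section \<open>The form for given realisations of the noise\<close>

lemma L2_measurable: "f \<in> L2 \<Longrightarrow> f \<in> borel_measurable borel"
  by (simp add: L2_def)

lemma L2_norm_nonneg: "0 \<le> L2_norm f"
  by (simp add: L2_norm_def)

text \<open>The weight is bounded almost everywhere only, since it will be a function of the class
  \<open>X\<close>. It is absorbed pointwise first, which leaves Cauchy-Schwarz for absolute
  values.\<close>

lemma L2_cauchy_schwarz_weighted:
  assumes f: "f \<in> L2" and g: "g \<in> L2" and w: "w \<in> borel_measurable borel"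
    and M: "AE x in torus. \<bar>w x\<bar> \<le> M"
  shows "integrable torus (\<lambda>x. f x * g x * w x)"
    and "\<bar>LINT x|torus. f x * g x * w x\<bar> \<le> M * L2_norm f * L2_norm g"
proof -
  have [measurable]: "f \<in> borel_measurable borel" "g \<in> borel_measurable borel" "w \<in> borel_measurable borel"
    using f g w by (auto intro: L2_measurable)
  define af where "af x = complex_of_real \<bar>f x\<bar>" for x
  define ag where "ag x = complex_of_real \<bar>g x\<bar>" for x
  have af: "sq_int af" and ag: "sq_int ag"
    using f g by (auto simp: af_def[abs_def] ag_def[abs_def] sq_int_def L2_def)
  have M0: "M \<ge> 0"
  proof -
    have "AE x in torus. 0 \<le> M" using M by eventually_elim simp
    then show ?thesis by simp
  qed
  have int: "integrable torus (\<lambda>x. M * (\<bar>f x\<bar> * \<bar>g x\<bar>))"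
    using integrable_Re[OF integrable_sq_int_mult[OF af ag]] by (simp add: af_def ag_def)
  have le: "AE x in torus. norm (f x * g x * w x) \<le> M * (\<bar>f x\<bar> * \<bar>g x\<bar>)"
    using M
  proof eventually_elim
    case (elim x)
    have "\<bar>f x\<bar> * \<bar>g x\<bar> * \<bar>w x\<bar> \<le> \<bar>f x\<bar> * \<bar>g x\<bar> * M"
      using elim by (intro mult_left_mono) auto
    then show ?case by (simp add: abs_mult mult_ac)
  qed
  have le': "AE x in torus. norm (f x * g x * w x) \<le> norm (M * (\<bar>f x\<bar> * \<bar>g x\<bar>))"
    using le by eventually_elim simp
  show 1: "integrable torus (\<lambda>x. f x * g x * w x)"
    by (rule Bochner_Integration.integrable_bound[OF int _ le']) simp
  have "\<bar>LINT x|torus. f x * g x * w x\<bar> \<le> (LINT x|torus. norm (f x * g x * w x))"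
    using integral_norm_bound[of torus "\<lambda>x. f x * g x * w x"] by simp
  also have "\<dots> \<le> (LINT x|torus. M * (\<bar>f x\<bar> * \<bar>g x\<bar>))"
    by (rule integral_mono_AE[OF integrable_norm[OF 1] int le])
  also have "\<dots> = M * (LINT x|torus. \<bar>f x\<bar> * \<bar>g x\<bar>)" by simp
  also have "(LINT x|torus. \<bar>f x\<bar> * \<bar>g x\<bar>) \<le> L2_norm f * L2_norm g"
  proof (rule power2_le_imp_le)
    have "(LINT x|torus. af x * ag x) = (LINT x|torus. complex_of_real (\<bar>f x\<bar> * \<bar>g x\<bar>))"
      by (simp add: af_def ag_def)
    also have "\<dots> = complex_of_real (LINT x|torus. \<bar>f x\<bar> * \<bar>g x\<bar>)"
      by (rule integral_complex_of_real)
    finally have "(LINT x|torus. \<bar>f x\<bar> * \<bar>g x\<bar>)\<^sup>2 = (cmod (LINT x|torus. af x * ag x))\<^sup>2"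
      by (simp only: norm_of_real power2_abs)
    also have "\<dots> \<le> (LINT x|torus. (cmod (af x))\<^sup>2) * (LINT x|torus. (cmod (ag x))\<^sup>2)"
      by (rule integral_cauchy_schwarz[OF af ag])
    also have "\<dots> = (L2_norm f * L2_norm g)\<^sup>2"
      by (simp add: power_mult_distrib L2_norm_sq af_def ag_def)
    finally show "(LINT x|torus. \<bar>f x\<bar> * \<bar>g x\<bar>)\<^sup>2 \<le> (L2_norm f * L2_norm g)\<^sup>2" .
  qed (simp add: L2_norm_nonneg)
  then have "M * (LINT x|torus. \<bar>f x\<bar> * \<bar>g x\<bar>) \<le> M * (L2_norm f * L2_norm g)"
    using M0 by (rule mult_left_mono)
  finally show "\<bar>LINT x|torus. f x * g x * w x\<bar> \<le> M * L2_norm f * L2_norm g"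
    by (simp add: mult.assoc)
qed

lemma H1_norm_nonneg: "0 \<le> H1_norm v"
  unfolding H1_norm_def by (intro real_sqrt_ge_zero add_nonneg_nonneg sum_nonneg zero_le_power2)

lemma L2_norm_le_H1_norm: "L2_norm v \<le> H1_norm v"
  and L2_norm_weak_deriv_le: "b \<in> Basis \<Longrightarrow> L2_norm (weak_deriv b v) \<le> H1_norm v"
proof -
  have H: "H1_norm v \<ge> 0" by (rule H1_norm_nonneg)
  have s: "0 \<le> (\<Sum>b\<in>Basis. (L2_norm (weak_deriv b v))\<^sup>2)" by (intro sum_nonneg) simp
  then have "(L2_norm v)\<^sup>2 \<le> (H1_norm v)\<^sup>2" unfolding H1_norm_sq by simp
  then show "L2_norm v \<le> H1_norm v" using H by (rule power2_le_imp_le)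
  assume b: "b \<in> Basis"
  have "(L2_norm (weak_deriv b v))\<^sup>2 \<le> (\<Sum>b\<in>Basis. (L2_norm (weak_deriv b v))\<^sup>2)"
    using b by (intro member_le_sum) auto
  then have "(L2_norm (weak_deriv b v))\<^sup>2 \<le> (H1_norm v)\<^sup>2"
    unfolding H1_norm_sq using zero_le_power2[of "L2_norm v"] by linarith
  then show "L2_norm (weak_deriv b v) \<le> H1_norm v" using H by (rule power2_le_imp_le)
qed

lemma abs_exp_diff_le:
  fixes a b c :: real
  assumes "a \<le> c" "b \<le> c"
  shows "\<bar>exp a - exp b\<bar> \<le> exp c * \<bar>a - b\<bar>"
proof -
  have *: "exp a - exp b \<le> exp c * \<bar>a - b\<bar>" if "a \<le> c" for a b :: real
  proof -
    have "exp a - exp b = exp a * (1 - exp (b - a))"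
      by (simp add: right_diff_distrib exp_add[symmetric])
    also have "\<dots> \<le> exp a * \<bar>a - b\<bar>"
    proof (rule mult_left_mono)
      show "1 - exp (b - a) \<le> \<bar>a - b\<bar>"
        using exp_ge_add_one_self[of "b - a"] abs_ge_self[of "a - b"] by linarith
    qed simp
    also have "\<dots> \<le> exp c * \<bar>a - b\<bar>"
      using that by (intro mult_right_mono) auto
    finally show ?thesis .
  qed
  show ?thesis using *[OF assms(1), of b] *[OF assms(2), of a] by (simp add: abs_le_iff abs_minus_commute)
qed

text \<open>The properties of one realisation used in the estimates. The form is written with the
  representative \<open>X\<close>, whereas shifts need the continuous periodic \<open>Xt\<close>;
  the two are linked only almost everywhere on the fundamental domain.\<close>

locale anderson_data =
  fixes \<phi> \<theta> X Xt :: "real \<times> real \<Rightarrow> real" and W :: distribution and R K CW z :: real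
  assumes dyadic: "dyadic_partition \<phi> \<theta>"
    and X_L2: "X \<in> L2"
    and Xt_eq: "AE x in torus. X x = Xt x"
    and Xt_unif: "unif_trig (\<lambda>x. complex_of_real (Xt x))"
    and Xt_bound: "\<And>x. \<bar>Xt x\<bar> \<le> R"
    and Xt_increment: "\<And>b m x. b \<in> Basis \<Longrightarrow> \<bar>Xt (x + hstep m *\<^sub>R b) - Xt x\<bar> \<le> K * qr ^ m"
    and W_growth: "coeff_growth W CW"
begin

definition E :: "real \<times> real \<Rightarrow> complex" where
  "E x = complex_of_real (exp (2 * Xt x))"

definition M :: real where
  "M = exp (2 * R)"

lemma M_pos: "M > 0"
  by (simp add: M_def)

lemma E_unif: "unif_trig E"
  unfolding E_def[abs_def]
  by (rule unif_trig_compose[where F = "\<lambda>t. exp (2 * t)", OF Xt_unif Xt_bound]) (intro continuous_intros)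

lemma E_bound: "cmod (E x) \<le> M"
  using Xt_bound[of x] by (simp add: E_def M_def abs_le_iff)

lemma E_increment:
  assumes "b \<in> Basis"
  shows "cmod (E (x + hstep m *\<^sub>R b) - E x) \<le> (2 * M * K) * qr ^ m"
proof -
  let ?y = "x + hstep m *\<^sub>R b"
  have "cmod (E ?y - E x) = \<bar>exp (2 * Xt ?y) - exp (2 * Xt x)\<bar>"
    unfolding E_def of_real_diff[symmetric] by (rule norm_of_real)
  also have "\<dots> \<le> M * \<bar>2 * Xt ?y - 2 * Xt x\<bar>"
    unfolding M_def using Xt_bound[of ?y] Xt_bound[of x] by (intro abs_exp_diff_le) auto
  also have "\<dots> = M * (2 * \<bar>Xt ?y - Xt x\<bar>)"
    by (simp only: right_diff_distrib[symmetric] abs_mult abs_numeral)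
  also have "\<dots> \<le> M * (2 * (K * qr ^ m))"
    using Xt_increment[OF assms, of x m] M_pos by (intro mult_left_mono) auto
  finally show ?thesis by simp
qed

lemma exp_X_measurable [measurable]: "(\<lambda>x. exp (2 * X x)) \<in> borel_measurable borel"
  using L2_measurable[OF X_L2] by measurable

lemma exp_X_bound: "AE x in torus. \<bar>exp (2 * X x)\<bar> \<le> M"
  using Xt_eq
proof eventually_elim
  case (elim x)
  then show ?case using Xt_bound[of x] by (simp add: M_def abs_le_iff)
qed

lemma exp_X_lower: "AE x in torus. 1 / M \<le> exp (2 * X x)"
  using Xt_eq
proof eventually_elim
  case (elim x)
  have "1 / M = exp (- 2 * R)" by (simp add: M_def exp_minus inverse_eq_divide)
  also have "\<dots> \<le> exp (2 * X x)" using Xt_bound[of x] elim by (simp add: abs_le_iff)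
  finally show ?case .
qed

lemma product_integrable: "v1 \<in> L2 \<Longrightarrow> v2 \<in> L2 \<Longrightarrow> integrable torus (\<lambda>x. v1 x * v2 x * exp (2 * X x))"
  using exp_X_bound by (intro L2_cauchy_schwarz_weighted) auto

lemma product_integral_le:
  "v1 \<in> L2 \<Longrightarrow> v2 \<in> L2 \<Longrightarrow> \<bar>LINT x|torus. v1 x * v2 x * exp (2 * X x)\<bar> \<le> M * L2_norm v1 * L2_norm v2"
  using exp_X_bound by (intro L2_cauchy_schwarz_weighted) auto

text \<open>Passage from \<open>X\<close> to \<open>Xt\<close> under the integral; after it the
  weight can be translated.\<close>

lemma fourier_coeff_product:
  assumes v: "v1 \<in> L2" "v2 \<in> L2"
  shows "fourier_coeff (\<lambda>x. v1 x * v2 x * exp (2 * X x)) k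
    = fcoef (\<lambda>x. complex_of_real (v1 x) * complex_of_real (v2 x) * E x) k"
  unfolding fourier_coeff_def fcoef_def
proof (rule integral_cong_AE)
  have [measurable]: "v1 \<in> borel_measurable borel" "v2 \<in> borel_measurable borel" "E \<in> borel_measurable borel"
    using v unif_trig_measurable[OF E_unif] by (auto intro: L2_measurable)
  show "(\<lambda>x. complex_of_real (v1 x * v2 x * exp (2 * X x)) * cis (- (freq k \<bullet> x))) \<in> borel_measurable torus"
    by measurable
  show "(\<lambda>x. complex_of_real (v1 x) * complex_of_real (v2 x) * E x * cis (- (freq k \<bullet> x))) \<in> borel_measurable torus"
    by measurable
  show "AE x in torus. complex_of_real (v1 x * v2 x * exp (2 * X x)) * cis (- (freq k \<bullet> x))
      = complex_of_real (v1 x) * complex_of_real (v2 x) * E x * cis (- (freq k \<bullet> x))"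
    using Xt_eq by eventually_elim (simp add: E_def)
qed

text \<open>The zero mode is controlled by L2 norms alone. The other frequencies give the square
  root of the symmetric expression in the block estimate, in which each product has one factor
  measured in order 3/4 only.\<close>

lemma bracket_bound:
  "\<exists>\<kappa>\<ge>0. \<forall>v1\<in>H1. \<forall>v2\<in>H1. \<forall>B1 B2.
     (\<forall>A. finite A \<longrightarrow> nwt A (fourier_coeff v1) \<le> B1) \<longrightarrow> (\<forall>A. finite A \<longrightarrow> nwt A (fourier_coeff v2) \<le> B2) \<longrightarrow>
     \<bar>bracket \<phi> \<theta> W (\<lambda>x. v1 x * v2 x * exp (2 * X x))\<bar>
       \<le> \<kappa> * (L2_norm v1 * L2_norm v2) + \<kappa> * sqrt ((H1_norm v1)\<^sup>2 * B2 + B1 * (H1_norm v2)\<^sup>2)"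
proof (rule block_estimate_H1)
  fix C :: real
  assume C: "C > 0"
    "\<And>v1 v2 E M K b m F B1 B2. v1 \<in> H1 \<Longrightarrow> v2 \<in> H1 \<Longrightarrow> unif_trig E \<Longrightarrow> (\<And>x. cmod (E x) \<le> M) \<Longrightarrow> b \<in> Basis \<Longrightarrow>
      (\<And>x. cmod (E (x + hstep m *\<^sub>R b) - E x) \<le> K * qr ^ m) \<Longrightarrow> finite F \<Longrightarrow>
      (\<And>k. k \<in> F \<Longrightarrow> 2 ^ m \<le> \<bar>freq k \<bullet> b\<bar> \<and> \<bar>freq k \<bullet> b\<bar> \<le> 2 ^ Suc m) \<Longrightarrow>
      (\<And>A. finite A \<Longrightarrow> nwt A (fourier_coeff v1) \<le> B1) \<Longrightarrow> (\<And>A. finite A \<Longrightarrow> nwt A (fourier_coeff v2) \<le> B2) \<Longrightarrow>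
      (\<Sum>k\<in>F. (cmod (fcoef (\<lambda>x. complex_of_real (v1 x) * complex_of_real (v2 x) * E x) k))\<^sup>2)
        \<le> C * (M\<^sup>2 + K\<^sup>2) * (qr ^ m)\<^sup>2 * ((H1_norm v1)\<^sup>2 * B2 + B1 * (H1_norm v2)\<^sup>2)"
  define C1 where "C1 = C * (M\<^sup>2 + (2 * M * K)\<^sup>2)"
  define c0 where "c0 = 2 / (qr * (1 - sqrt qr))"
  have C1: "C1 \<ge> 0" using C(1) by (simp add: C1_def)
  have c0: "c0 \<ge> 0" using qr_bounds by (simp add: c0_def)
  have CW: "CW \<ge> 0" using W_growth by (simp add: coeff_growth_def)
  \<comment> \<open>A single constant for the zero mode and for the remaining sum, depending on the
    realisation but not on \<open>v1\<close>, \<open>v2\<close>, \<open>B1\<close>,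
    \<open>B2\<close>.\<close>
  define \<kappa> where "\<kappa> = cmod (W 0) * M + c0 * sqrt (CW * C1)"
  have \<kappa>1: "cmod (W 0) * M \<le> \<kappa>" and \<kappa>2: "c0 * sqrt (CW * C1) \<le> \<kappa>"
    using M_pos c0 CW C1 by (simp_all add: \<kappa>_def)
  have \<kappa>0: "\<kappa> \<ge> 0" using \<kappa>1 M_pos by (simp add: order_trans[rotated])
  have main: "\<bar>bracket \<phi> \<theta> W (\<lambda>x. v1 x * v2 x * exp (2 * X x))\<bar>
       \<le> \<kappa> * (L2_norm v1 * L2_norm v2) + \<kappa> * sqrt ((H1_norm v1)\<^sup>2 * B2 + B1 * (H1_norm v2)\<^sup>2)"
    if v1: "v1 \<in> H1" and v2: "v2 \<in> H1" and B1: "\<forall>A. finite A \<longrightarrow> nwt A (fourier_coeff v1) \<le> B1"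
      and B2: "\<forall>A. finite A \<longrightarrow> nwt A (fourier_coeff v2) \<le> B2" for v1 v2 B1 B2
  proof (rule abs_bracket_le[OF dyadic])
    let ?f = "\<lambda>x. v1 x * v2 x * exp (2 * X x)"
    let ?Q = "(H1_norm v1)\<^sup>2 * B2 + B1 * (H1_norm v2)\<^sup>2"
    have L2: "v1 \<in> L2" "v2 \<in> L2" using v1 v2 by (auto intro: H1_L2)
    show "integrable torus ?f" by (rule product_integrable[OF L2])
    fix F :: "(int \<times> int) set" assume F: "finite F"
    have B: "B1 \<ge> 0" "B2 \<ge> 0"
      using B1[rule_format, of "{}"] B2[rule_format, of "{}"] by (simp_all add: nwt_def)
    have Q: "?Q \<ge> 0" using B by simp
    have "(\<Sum>k\<in>F. cmod (W k) * cmod (fourier_coeff ?f k))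
        \<le> cmod (W 0) * cmod (fourier_coeff ?f 0) + 2 / (qr * (1 - sqrt qr)) * sqrt (CW * (C1 * ?Q))"
    proof (rule pairing_bound[OF W_growth _ norm_ge_zero _ F])
      show "0 \<le> C1 * ?Q" using C1 Q by simp
      fix m :: nat and b :: "real \<times> real" and S :: "(int \<times> int) set"
      assume b: "b \<in> Basis" and S: "finite S"
        and Sm: "\<And>k. k \<in> S \<Longrightarrow> 2 ^ m \<le> \<bar>freq k \<bullet> b\<bar> \<and> \<bar>freq k \<bullet> b\<bar> \<le> 2 ^ Suc m"
      have "(\<Sum>k\<in>S. (cmod (fourier_coeff ?f k))\<^sup>2)
          = (\<Sum>k\<in>S. (cmod (fcoef (\<lambda>x. complex_of_real (v1 x) * complex_of_real (v2 x) * E x) k))\<^sup>2)"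
        by (simp only: fourier_coeff_product[OF L2])
      also have "\<dots> \<le> C * (M\<^sup>2 + (2 * M * K)\<^sup>2) * (qr ^ m)\<^sup>2 * ?Q"
        by (rule C(2)[OF v1 v2 E_unif E_bound b E_increment[OF b] S Sm B1[rule_format] B2[rule_format]])
      also have "\<dots> = C1 * ?Q * (qr ^ m)\<^sup>2" by (simp add: C1_def)
      finally show "(\<Sum>k\<in>S. (cmod (fourier_coeff ?f k))\<^sup>2) \<le> C1 * ?Q * (qr ^ m)\<^sup>2" .
    qed
    also have "\<dots> \<le> cmod (W 0) * (M * L2_norm v1 * L2_norm v2) + c0 * sqrt (CW * (C1 * ?Q))"
    proof -
      have "fourier_coeff ?f 0 = complex_of_real (LINT x|torus. ?f x)"
        unfolding fourier_coeff_def by (simp flip: integral_complex_of_real)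
      then have "cmod (fourier_coeff ?f 0) \<le> M * L2_norm v1 * L2_norm v2"
        using product_integral_le[OF L2] by (simp only: norm_of_real)
      then show ?thesis by (auto simp: c0_def intro!: mult_left_mono)
    qed
    also have "\<dots> = (cmod (W 0) * M) * (L2_norm v1 * L2_norm v2) + (c0 * sqrt (CW * C1)) * sqrt ?Q"
      using CW C1 Q by (simp add: real_sqrt_mult mult_ac)
    also have "\<dots> \<le> \<kappa> * (L2_norm v1 * L2_norm v2) + \<kappa> * sqrt ?Q"
      using \<kappa>1 \<kappa>2 Q L2_norm_nonneg by (intro add_mono mult_right_mono) auto
    finally show "(\<Sum>k\<in>F. cmod (W k) * cmod (fourier_coeff ?f k))
       \<le> \<kappa> * (L2_norm v1 * L2_norm v2) + \<kappa> * sqrt ?Q" .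
  qed
  show ?thesis
  proof (intro exI[of _ \<kappa>] conjI ballI allI impI)
    fix v1 v2 B1 B2
    assume "v1 \<in> H1" "v2 \<in> H1" "\<forall>A. finite A \<longrightarrow> nwt A (fourier_coeff v1) \<le> B1"
      "\<forall>A. finite A \<longrightarrow> nwt A (fourier_coeff v2) \<le> B2"
    then show "\<bar>bracket \<phi> \<theta> W (\<lambda>x. v1 x * v2 x * exp (2 * X x))\<bar>
       \<le> \<kappa> * (L2_norm v1 * L2_norm v2) + \<kappa> * sqrt ((H1_norm v1)\<^sup>2 * B2 + B1 * (H1_norm v2)\<^sup>2)"
      by (rule main)
  qed (rule \<kappa>0)
qed

lemma anderson_form_eq:
  "anderson_form \<phi> \<theta> X W z (\<lambda>x. exp (X x) * v1 x) (\<lambda>x. exp (X x) * v2 x)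
    = (LINT x|torus. (\<Sum>b\<in>Basis. weak_deriv b v1 x * weak_deriv b v2 x) * exp (2 * X x))
      - bracket \<phi> \<theta> W (\<lambda>x. v1 x * v2 x * exp (2 * X x)) + z * (LINT x|torus. v1 x * v2 x * exp (2 * X x))"
proof -
  have "(\<lambda>x. exp (- X x) * (exp (X x) * v x)) = v" for v
    by (rule ext) (simp add: mult.assoc[symmetric] exp_add[symmetric])
  then show ?thesis by (simp add: anderson_form_def Let_def)
qed

lemma form_norm_sq:
  "(form_norm X (\<lambda>x. exp (X x) * v x))\<^sup>2 = (L2_norm (\<lambda>x. exp (X x) * v x))\<^sup>2 + (H1_norm v)\<^sup>2"
proof -
  have "(\<lambda>x. exp (- X x) * (exp (X x) * v x)) = v"
    by (rule ext) (simp add: mult.assoc[symmetric] exp_add[symmetric])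
  then show ?thesis by (simp add: form_norm_def)
qed

lemma form_norm_nonneg: "0 \<le> form_norm X u"
  by (simp add: form_norm_def)

lemma H1_norm_le_form_norm: "H1_norm v \<le> form_norm X (\<lambda>x. exp (X x) * v x)"
proof (rule power2_le_imp_le)
  show "(H1_norm v)\<^sup>2 \<le> (form_norm X (\<lambda>x. exp (X x) * v x))\<^sup>2"
    unfolding form_norm_sq by simp
qed (rule form_norm_nonneg)

lemma gradient_integrable:
  assumes "v1 \<in> H1" "v2 \<in> H1" "b \<in> Basis"
  shows "integrable torus (\<lambda>x. weak_deriv b v1 x * weak_deriv b v2 x * exp (2 * X x))"
  using assms by (intro product_integrable weak_deriv_L2)

lemma gradient_integral_eq:
  assumes "v1 \<in> H1" "v2 \<in> H1"
  shows "(LINT x|torus. (\<Sum>b\<in>Basis. weak_deriv b v1 x * weak_deriv b v2 x) * exp (2 * X x))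
    = (\<Sum>b\<in>Basis. LINT x|torus. weak_deriv b v1 x * weak_deriv b v2 x * exp (2 * X x))"
  unfolding sum_distrib_right
  by (intro Bochner_Integration.integral_sum gradient_integrable assms)

theorem continuity:
  "\<exists>C>0. \<forall>u1\<in>form_domain X. \<forall>u2\<in>form_domain X.
     \<bar>anderson_form \<phi> \<theta> X W z u1 u2\<bar> \<le> C * form_norm X u1 * form_norm X u2"
proof -
  from bracket_bound obtain \<kappa> where \<kappa>: "\<kappa> \<ge> 0" and
    bracket: "\<forall>v1\<in>H1. \<forall>v2\<in>H1. \<forall>B1 B2.
     (\<forall>A. finite A \<longrightarrow> nwt A (fourier_coeff v1) \<le> B1) \<longrightarrow> (\<forall>A. finite A \<longrightarrow> nwt A (fourier_coeff v2) \<le> B2) \<longrightarrow>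
     \<bar>bracket \<phi> \<theta> W (\<lambda>x. v1 x * v2 x * exp (2 * X x))\<bar>
       \<le> \<kappa> * (L2_norm v1 * L2_norm v2) + \<kappa> * sqrt ((H1_norm v1)\<^sup>2 * B2 + B1 * (H1_norm v2)\<^sup>2)"
    by (elim exE conjE)
  \<comment> \<open>Two coordinate directions for the gradient term; for the bracket one
    \<open>\<kappa>\<close> from the zero mode and two from the square root, which equals twice the
    product of the H1 norms; then the term with \<open>z\<close>.\<close>
  define C where "C = 2 * M + 3 * \<kappa> + \<bar>z\<bar> * M"
  have C: "C > 0" using M_pos \<kappa> by (simp add: C_def add_pos_nonneg)
  have main: "\<bar>anderson_form \<phi> \<theta> X W z (\<lambda>x. exp (X x) * v1 x) (\<lambda>x. exp (X x) * v2 x)\<bar> \<le> C * (H1_norm v1 * H1_norm v2)"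
    if v1: "v1 \<in> H1" and v2: "v2 \<in> H1" for v1 v2
  proof -
    let ?h1 = "H1_norm v1" and ?h2 = "H1_norm v2"
    have L2: "v1 \<in> L2" "v2 \<in> L2" using v1 v2 by (auto intro: H1_L2)
    have h: "?h1 \<ge> 0" "?h2 \<ge> 0" by (auto intro: H1_norm_nonneg)
    have l: "L2_norm v1 * L2_norm v2 \<le> ?h1 * ?h2"
      using h by (intro mult_mono L2_norm_le_H1_norm L2_norm_nonneg) auto
    have t1: "\<bar>\<Sum>b\<in>Basis. LINT x|torus. weak_deriv b v1 x * weak_deriv b v2 x * exp (2 * X x)\<bar> \<le> 2 * M * (?h1 * ?h2)"
    proof -
      have "\<bar>\<Sum>b\<in>Basis. LINT x|torus. weak_deriv b v1 x * weak_deriv b v2 x * exp (2 * X x)\<bar>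
          \<le> (\<Sum>b\<in>(Basis :: (real \<times> real) set). M * (?h1 * ?h2))"
      proof (rule order_trans[OF sum_abs], rule sum_mono)
        fix b :: "real \<times> real" assume b: "b \<in> Basis"
        have "\<bar>LINT x|torus. weak_deriv b v1 x * weak_deriv b v2 x * exp (2 * X x)\<bar>
            \<le> M * L2_norm (weak_deriv b v1) * L2_norm (weak_deriv b v2)"
          by (rule product_integral_le[OF weak_deriv_L2[OF v1 b] weak_deriv_L2[OF v2 b]])
        also have "\<dots> = M * (L2_norm (weak_deriv b v1) * L2_norm (weak_deriv b v2))" by simp
        also have "\<dots> \<le> M * (?h1 * ?h2)"
          using M_pos h b by (intro mult_left_mono mult_mono L2_norm_weak_deriv_le L2_norm_nonneg) auto
        finally show "\<bar>LINT x|torus. weak_deriv b v1 x * weak_deriv b v2 x * exp (2 * X x)\<bar> \<le> M * (?h1 * ?h2)" .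
      qed
      then show ?thesis by simp
    qed
    have t2: "\<bar>bracket \<phi> \<theta> W (\<lambda>x. v1 x * v2 x * exp (2 * X x))\<bar> \<le> 3 * \<kappa> * (?h1 * ?h2)"
    proof -
      have n: "\<forall>A. finite A \<longrightarrow> nwt A (fourier_coeff v) \<le> 2 * (H1_norm v)\<^sup>2" if "v \<in> H1" for v
        using order_trans[OF nwt_le_nH nH_fourier_le[OF that]] by blast
      have "\<bar>bracket \<phi> \<theta> W (\<lambda>x. v1 x * v2 x * exp (2 * X x))\<bar>
         \<le> \<kappa> * (L2_norm v1 * L2_norm v2) + \<kappa> * sqrt (?h1\<^sup>2 * (2 * ?h2\<^sup>2) + (2 * ?h1\<^sup>2) * ?h2\<^sup>2)"
        by (rule bracket[rule_format, OF v1 v2 n[OF v1, rule_format] n[OF v2, rule_format]])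
      also have "?h1\<^sup>2 * (2 * ?h2\<^sup>2) + (2 * ?h1\<^sup>2) * ?h2\<^sup>2 = (2 * (?h1 * ?h2))\<^sup>2"
        by (simp add: power_mult_distrib)
      also have "sqrt ((2 * (?h1 * ?h2))\<^sup>2) = 2 * (?h1 * ?h2)"
        using h by (simp only: real_sqrt_abs) simp
      also have "\<kappa> * (L2_norm v1 * L2_norm v2) \<le> \<kappa> * (?h1 * ?h2)"
        using l \<kappa> by (rule mult_left_mono)
      finally show ?thesis by (simp add: algebra_simps)
    qed
    have t3: "\<bar>z * (LINT x|torus. v1 x * v2 x * exp (2 * X x))\<bar> \<le> \<bar>z\<bar> * M * (?h1 * ?h2)"
    proof -
      have "\<bar>LINT x|torus. v1 x * v2 x * exp (2 * X x)\<bar> \<le> M * (L2_norm v1 * L2_norm v2)"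
        using product_integral_le[OF L2] by (simp only: mult.assoc)
      also have "\<dots> \<le> M * (?h1 * ?h2)" using l M_pos by (intro mult_left_mono) auto
      finally have "\<bar>z\<bar> * \<bar>LINT x|torus. v1 x * v2 x * exp (2 * X x)\<bar> \<le> \<bar>z\<bar> * (M * (?h1 * ?h2))"
        by (intro mult_left_mono) auto
      then show ?thesis by (simp only: abs_mult mult.assoc)
    qed
    have "C * (?h1 * ?h2) = 2 * M * (?h1 * ?h2) + 3 * \<kappa> * (?h1 * ?h2) + \<bar>z\<bar> * M * (?h1 * ?h2)"
      by (simp add: C_def algebra_simps)
    then show ?thesis
      unfolding anderson_form_eq gradient_integral_eq[OF v1 v2] using t1 t2 t3 by linarith
  qed
  show ?thesis
  proof (intro exI conjI ballI)
    fix u1 u2 assume "u1 \<in> form_domain X" "u2 \<in> form_domain X"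
    then obtain v1 v2 where u: "u1 = (\<lambda>x. exp (X x) * v1 x)" "u2 = (\<lambda>x. exp (X x) * v2 x)" and v: "v1 \<in> H1" "v2 \<in> H1"
      unfolding form_domain_def by blast
    have "\<bar>anderson_form \<phi> \<theta> X W z u1 u2\<bar> \<le> C * (H1_norm v1 * H1_norm v2)"
      unfolding u by (rule main[OF v])
    also have "\<dots> \<le> C * (form_norm X u1 * form_norm X u2)"
      unfolding u using C by (intro mult_left_mono mult_mono H1_norm_le_form_norm form_norm_nonneg H1_norm_nonneg) auto
    finally show "\<bar>anderson_form \<phi> \<theta> X W z u1 u2\<bar> \<le> C * form_norm X u1 * form_norm X u2"
      by (simp only: mult.assoc)
  qed (rule C)
qed

text \<open>Serves twice in the coercivity proof: for the weak derivatives, to bound the gradient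
  term from below, and for \<open>v\<close> itself, to return from the norm of \<open>v\<close> to
  that of \<open>u\<close>.\<close>

lemma L2_norm_exp_X_ge:
  assumes v: "v \<in> L2"
  shows "(1 / M) * (L2_norm v)\<^sup>2 \<le> (L2_norm (\<lambda>x. exp (X x) * v x))\<^sup>2"
proof -
  have "(1 / M) * (L2_norm v)\<^sup>2 = (LINT x|torus. (1 / M) * (v x * v x))"
    by (simp add: L2_norm_def power2_eq_square)
  also have "\<dots> \<le> (LINT x|torus. v x * v x * exp (2 * X x))"
  proof (rule integral_mono_AE)
    show "integrable torus (\<lambda>x. (1 / M) * (v x * v x))"
      using v by (simp add: L2_def power2_eq_square)
    show "integrable torus (\<lambda>x. v x * v x * exp (2 * X x))" by (rule product_integrable[OF v v])
    show "AE x in torus. (1 / M) * (v x * v x) \<le> v x * v x * exp (2 * X x)"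
      using exp_X_lower
    proof eventually_elim
      case (elim x)
      then have "(v x * v x) * (1 / M) \<le> (v x * v x) * exp (2 * X x)" by (rule mult_left_mono) simp
      then show ?case by (simp only: mult.commute)
    qed
  qed
  also have "\<dots> = (LINT x|torus. (exp (X x) * v x)\<^sup>2)"
    by (intro Bochner_Integration.integral_cong refl) (simp add: power_mult_distrib power2_eq_square exp_add[symmetric])
  also have "\<dots> = (L2_norm (\<lambda>x. exp (X x) * v x))\<^sup>2" by (simp add: L2_norm_def)
  finally show ?thesis .
qed

theorem coercivity:
  "\<exists>\<delta>>0. \<exists>C'>0. \<forall>u\<in>form_domain X.
     anderson_form \<phi> \<theta> X W z u u + C' * (L2_norm u)\<^sup>2 \<ge> \<delta> * (form_norm X u)\<^sup>2"
proof -
  from bracket_bound obtain \<kappa> where \<kappa>: "\<kappa> \<ge> 0" and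
    bracket: "\<forall>v1\<in>H1. \<forall>v2\<in>H1. \<forall>B1 B2.
     (\<forall>A. finite A \<longrightarrow> nwt A (fourier_coeff v1) \<le> B1) \<longrightarrow> (\<forall>A. finite A \<longrightarrow> nwt A (fourier_coeff v2) \<le> B2) \<longrightarrow>
     \<bar>bracket \<phi> \<theta> W (\<lambda>x. v1 x * v2 x * exp (2 * X x))\<bar>
       \<le> \<kappa> * (L2_norm v1 * L2_norm v2) + \<kappa> * sqrt ((H1_norm v1)\<^sup>2 * B2 + B1 * (H1_norm v2)\<^sup>2)"
    by (elim exE conjE)
  define a where "a = 1 / M"
  have a: "a > 0" using M_pos by (simp add: a_def)
  \<comment> \<open>Tuned so that the bracket consumes at most half of the gradient term. Adding 1
    to \<open>\<kappa>\<close> avoids a division by zero.\<close>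
  define \<epsilon> where "\<epsilon> = a / (4 * (\<kappa> + 1))"
  have \<epsilon>: "\<epsilon> > 0" using a \<kappa> by (simp add: \<epsilon>_def)
  have \<epsilon>\<kappa>: "2 * \<kappa> * \<epsilon> \<le> a / 2"
  proof -
    have "2 * \<kappa> * \<epsilon> \<le> (4 * (\<kappa> + 1) * \<epsilon>) / 2" using \<epsilon> by (simp add: algebra_simps)
    also have "4 * (\<kappa> + 1) * \<epsilon> = a" using \<kappa> by (simp add: \<epsilon>_def)
    finally show ?thesis .
  qed
  \<comment> \<open>Interpolation with parameter \<epsilon>^2 puts \<epsilon>^(-6) in front of the
    L2 norm. Under the square root it meets the H1 norm, and the cross term of (2 \<epsilon> h^2 + y
    l^2)^2 dominates as soon as \<epsilon> y = \<epsilon>^(-6).\<close>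
  define y where "y = (1 / \<epsilon>) ^ 7"
  have y: "y > 0" using \<epsilon> by (simp add: y_def)
  define C2 where "C2 = a + \<kappa> + \<kappa> * y + \<bar>z\<bar> * M"
  have C2: "C2 \<ge> 0" using a \<kappa> y M_pos by (simp add: C2_def)
  have main: "anderson_form \<phi> \<theta> X W z (\<lambda>x. exp (X x) * v x) (\<lambda>x. exp (X x) * v x)
      \<ge> a / 2 * (H1_norm v)\<^sup>2 - C2 * (L2_norm v)\<^sup>2" if v: "v \<in> H1" for v
  proof -
    let ?h = "H1_norm v" and ?l = "L2_norm v"
    have L2: "v \<in> L2" using v by (rule H1_L2)
    have t1: "a * (?h\<^sup>2 - ?l\<^sup>2) \<le> (\<Sum>b\<in>Basis. LINT x|torus. weak_deriv b v x * weak_deriv b v x * exp (2 * X x))"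
    proof -
      have "a * (?h\<^sup>2 - ?l\<^sup>2) = (\<Sum>b\<in>Basis. a * (L2_norm (weak_deriv b v))\<^sup>2)"
        unfolding H1_norm_sq by (simp add: sum_distrib_left)
      also have "\<dots> \<le> (\<Sum>b\<in>Basis. LINT x|torus. weak_deriv b v x * weak_deriv b v x * exp (2 * X x))"
      proof (rule sum_mono)
        fix b :: "real \<times> real" assume b: "b \<in> Basis"
        have "a * (L2_norm (weak_deriv b v))\<^sup>2 \<le> (L2_norm (\<lambda>x. exp (X x) * weak_deriv b v x))\<^sup>2"
          unfolding a_def by (rule L2_norm_exp_X_ge[OF weak_deriv_L2[OF v b]])
        also have "\<dots> = (LINT x|torus. (exp (X x) * weak_deriv b v x)\<^sup>2)" by (simp add: L2_norm_def)
        also have "\<dots> = (LINT x|torus. weak_deriv b v x * weak_deriv b v x * exp (2 * X x))"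
          by (intro Bochner_Integration.integral_cong refl) (simp add: power_mult_distrib power2_eq_square exp_add[symmetric])
        finally show "a * (L2_norm (weak_deriv b v))\<^sup>2
            \<le> (LINT x|torus. weak_deriv b v x * weak_deriv b v x * exp (2 * X x))" .
      qed
      finally show ?thesis .
    qed
    have t2: "\<bar>bracket \<phi> \<theta> W (\<lambda>x. v x * v x * exp (2 * X x))\<bar> \<le> \<kappa> * ?l\<^sup>2 + \<kappa> * (2 * \<epsilon> * ?h\<^sup>2 + y * ?l\<^sup>2)"
    proof -
      let ?B = "2 * \<epsilon>\<^sup>2 * ?h\<^sup>2 + (1 / \<epsilon>\<^sup>2) ^ 3 * ?l\<^sup>2"
      have n: "nwt A (fourier_coeff v) \<le> ?B" if "finite A" for A
        using nwt_fourier_le[OF v that, of "\<epsilon>\<^sup>2"] \<epsilon> by simp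
      have "\<bar>bracket \<phi> \<theta> W (\<lambda>x. v x * v x * exp (2 * X x))\<bar>
         \<le> \<kappa> * (?l * ?l) + \<kappa> * sqrt (?h\<^sup>2 * ?B + ?B * ?h\<^sup>2)"
        by (rule bracket[rule_format, OF v v n n])
      also have "sqrt (?h\<^sup>2 * ?B + ?B * ?h\<^sup>2) \<le> 2 * \<epsilon> * ?h\<^sup>2 + y * ?l\<^sup>2"
      proof (rule real_le_lsqrt)
        have 1: "\<epsilon> * y = (1 / \<epsilon>\<^sup>2) ^ 3"
          using \<epsilon> by (simp add: y_def field_simps eval_nat_numeral)
        have "(2 * \<epsilon> * ?h\<^sup>2 + y * ?l\<^sup>2)\<^sup>2 = 4 * \<epsilon>\<^sup>2 * (?h\<^sup>2 * ?h\<^sup>2) + 4 * (\<epsilon> * y) * (?h\<^sup>2 * ?l\<^sup>2) + (y * ?l\<^sup>2)\<^sup>2"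
          by (simp add: power2_eq_square algebra_simps)
        moreover have "?h\<^sup>2 * ?B + ?B * ?h\<^sup>2 = 4 * \<epsilon>\<^sup>2 * (?h\<^sup>2 * ?h\<^sup>2) + 2 * (\<epsilon> * y) * (?h\<^sup>2 * ?l\<^sup>2)"
          unfolding 1 by (simp add: algebra_simps)
        moreover have "0 \<le> (\<epsilon> * y) * (?h\<^sup>2 * ?l\<^sup>2)" using \<epsilon> y by simp
        ultimately show "?h\<^sup>2 * ?B + ?B * ?h\<^sup>2 \<le> (2 * \<epsilon> * ?h\<^sup>2 + y * ?l\<^sup>2)\<^sup>2"
          using zero_le_power2[of "y * ?l\<^sup>2"] by linarith
        show "0 \<le> 2 * \<epsilon> * ?h\<^sup>2 + y * ?l\<^sup>2" using \<epsilon> y by simp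
      qed
      then have "\<kappa> * sqrt (?h\<^sup>2 * ?B + ?B * ?h\<^sup>2) \<le> \<kappa> * (2 * \<epsilon> * ?h\<^sup>2 + y * ?l\<^sup>2)"
        using \<kappa> by (rule mult_left_mono)
      finally show ?thesis by (simp add: power2_eq_square)
    qed
    have t3: "- (\<bar>z\<bar> * M * ?l\<^sup>2) \<le> z * (LINT x|torus. v x * v x * exp (2 * X x))"
    proof -
      have "\<bar>z\<bar> * \<bar>LINT x|torus. v x * v x * exp (2 * X x)\<bar> \<le> \<bar>z\<bar> * (M * ?l * ?l)"
        by (intro mult_left_mono product_integral_le[OF L2 L2]) simp
      then have "\<bar>z * (LINT x|torus. v x * v x * exp (2 * X x))\<bar> \<le> \<bar>z\<bar> * M * ?l\<^sup>2"
        by (simp only: abs_mult power2_eq_square mult.assoc)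
      then show ?thesis by linarith
    qed
    have t4: "\<kappa> * (2 * \<epsilon> * ?h\<^sup>2) \<le> a / 2 * ?h\<^sup>2"
      using mult_right_mono[OF \<epsilon>\<kappa>, of "?h\<^sup>2"] by (simp add: mult_ac)
    have "C2 * ?l\<^sup>2 = a * ?l\<^sup>2 + \<kappa> * ?l\<^sup>2 + \<kappa> * (y * ?l\<^sup>2) + \<bar>z\<bar> * M * ?l\<^sup>2"
      by (simp add: C2_def algebra_simps)
    moreover have "\<kappa> * (2 * \<epsilon> * ?h\<^sup>2 + y * ?l\<^sup>2) = \<kappa> * (2 * \<epsilon> * ?h\<^sup>2) + \<kappa> * (y * ?l\<^sup>2)"
      "a * (?h\<^sup>2 - ?l\<^sup>2) = a / 2 * ?h\<^sup>2 + a / 2 * ?h\<^sup>2 - a * ?l\<^sup>2"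
      by (simp_all add: algebra_simps)
    ultimately show ?thesis
      unfolding anderson_form_eq gradient_integral_eq[OF v v] using t1 t2 t3 t4 by linarith
  qed
  show ?thesis
  proof (intro exI conjI ballI)
    show "a / 2 > 0" using a by simp
    \<comment> \<open>\<open>M\<close> is the cost of replacing the L2 norm of \<open>v\<close> by
      that of \<open>u\<close>; the half of \<open>a\<close> covers the L2 part contained in the
      form norm.\<close>
    show "C2 * M + a / 2 > 0" using C2 M_pos a by (simp add: add_nonneg_pos)
    fix u assume "u \<in> form_domain X"
    then obtain v where u: "u = (\<lambda>x. exp (X x) * v x)" and v: "v \<in> H1"
      unfolding form_domain_def by blast
    have "C2 * (L2_norm v)\<^sup>2 = C2 * M * ((1 / M) * (L2_norm v)\<^sup>2)" using M_pos by simp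
    also have "\<dots> \<le> C2 * M * (L2_norm u)\<^sup>2"
      unfolding u using C2 M_pos by (intro mult_left_mono L2_norm_exp_X_ge H1_L2 v) auto
    finally have "C2 * (L2_norm v)\<^sup>2 \<le> C2 * M * (L2_norm u)\<^sup>2" .
    moreover have "a / 2 * (form_norm X u)\<^sup>2 = a / 2 * (L2_norm u)\<^sup>2 + a / 2 * (H1_norm v)\<^sup>2"
      unfolding u form_norm_sq by (simp add: algebra_simps)
    moreover have "a / 2 * (H1_norm v)\<^sup>2 - C2 * (L2_norm v)\<^sup>2 \<le> anderson_form \<phi> \<theta> X W z u u"
      unfolding u by (rule main[OF v])
    moreover have "(C2 * M + a / 2) * (L2_norm u)\<^sup>2 = C2 * M * (L2_norm u)\<^sup>2 + a / 2 * (L2_norm u)\<^sup>2"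
      by (simp add: algebra_simps)
    ultimately show "a / 2 * (form_norm X u)\<^sup>2 \<le> anderson_form \<phi> \<theta> X W z u u + (C2 * M + a / 2) * (L2_norm u)\<^sup>2"
      by linarith
  qed
qed

end

section \<open>Fourth moments of Gaussian trigonometric polynomials\<close>

context prob_space
begin

text \<open>A centred Gaussian of variance \<open>s\<close> attains the last inequality with
  equality. The relation survives sums of independent variables, so the law of such a sum never has
  to be identified.\<close>

definition fourth_moment_bound :: "('a \<Rightarrow> real) \<Rightarrow> real \<Rightarrow> bool" where
  "fourth_moment_bound Y s \<longleftrightarrow> Y \<in> borel_measurable M \<and> 0 \<le> s \<and> integrable M (\<lambda>\<omega>. Y \<omega> ^ 4) \<and>
     expectation Y = 0 \<and> expectation (\<lambda>\<omega>. (Y \<omega>)\<^sup>2) \<le> s \<and> expectation (\<lambda>\<omega>. Y \<omega> ^ 4) \<le> 3 * s\<^sup>2"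

lemma integrable_power_le_4:
  fixes Y :: "'a \<Rightarrow> real"
  assumes [measurable]: "Y \<in> borel_measurable M" and Y: "integrable M (\<lambda>\<omega>. Y \<omega> ^ 4)" and k: "k \<le> 4"
  shows "integrable M (\<lambda>\<omega>. Y \<omega> ^ k)"
proof (rule Bochner_Integration.integrable_bound)
  show "integrable M (\<lambda>\<omega>. 1 + Y \<omega> ^ 4)" using Y by simp
  have "\<bar>y\<bar> ^ k \<le> 1 + \<bar>y\<bar> ^ 4" for y :: real
  proof (cases "\<bar>y\<bar> \<le> 1")
    case True
    then have "\<bar>y\<bar> ^ k \<le> 1" by (intro power_le_one) auto
    then show ?thesis by (simp add: add_increasing2)
  next
    case False
    then have "\<bar>y\<bar> ^ k \<le> \<bar>y\<bar> ^ 4" using k by (intro power_increasing) auto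
    then show ?thesis by simp
  qed
  then show "AE \<omega> in M. norm (Y \<omega> ^ k) \<le> norm (1 + Y \<omega> ^ 4)"
    by (intro AE_I2) (simp add: power_abs)
qed measurable

text \<open>In the expansion of the fourth power the mixed terms of odd degree vanish by
  independence and centring, and the rest is at most 3 s^2 + 6 s t + 3 t^2 = 3 (s + t)^2.\<close>

lemma fourth_moment_bound_add:
  assumes Y: "fourth_moment_bound Y s" and S: "fourth_moment_bound S t" and ind: "indep_var borel Y borel S"
  shows "fourth_moment_bound (\<lambda>\<omega>. Y \<omega> + S \<omega>) (s + t)"
proof -
  have [measurable]: "Y \<in> borel_measurable M" "S \<in> borel_measurable M"
    using Y S by (auto simp: fourth_moment_bound_def)
  have st: "s \<ge> 0" "t \<ge> 0" using Y S by (auto simp: fourth_moment_bound_def)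
  have iY: "integrable M (\<lambda>\<omega>. Y \<omega> ^ k)" if "k \<le> 4" for k
  proof (rule integrable_power_le_4)
    show "integrable M (\<lambda>\<omega>. Y \<omega> ^ 4)" using Y by (simp add: fourth_moment_bound_def)
  qed (use that in simp_all)
  have iS: "integrable M (\<lambda>\<omega>. S \<omega> ^ k)" if "k \<le> 4" for k
  proof (rule integrable_power_le_4)
    show "integrable M (\<lambda>\<omega>. S \<omega> ^ 4)" using S by (simp add: fourth_moment_bound_def)
  qed (use that in simp_all)
  have ind': "indep_var borel (\<lambda>\<omega>. Y \<omega> ^ j) borel (\<lambda>\<omega>. S \<omega> ^ k)" for j k
    using indep_var_compose[OF ind, of "\<lambda>y. y ^ j" borel "\<lambda>y. y ^ k" borel] by (simp add: comp_def)
  have prod: "integrable M (\<lambda>\<omega>. Y \<omega> ^ j * S \<omega> ^ k)"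
    "expectation (\<lambda>\<omega>. Y \<omega> ^ j * S \<omega> ^ k) = expectation (\<lambda>\<omega>. Y \<omega> ^ j) * expectation (\<lambda>\<omega>. S \<omega> ^ k)"
    if "j \<le> 4" "k \<le> 4" for j k
    using indep_var_integrable[OF ind' iY[OF that(1)] iS[OF that(2)]]
      indep_var_lebesgue_integral[OF ind' iY[OF that(1)] iS[OF that(2)]] by simp_all
  have e1: "expectation (\<lambda>\<omega>. Y \<omega> ^ 1) = 0" "expectation (\<lambda>\<omega>. S \<omega> ^ 1) = 0"
    using Y S by (simp_all add: fourth_moment_bound_def)
  have e2: "expectation (\<lambda>\<omega>. Y \<omega> ^ 2) \<le> s" "expectation (\<lambda>\<omega>. S \<omega> ^ 2) \<le> t"
    using Y S by (simp_all add: fourth_moment_bound_def)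
  have e2': "0 \<le> expectation (\<lambda>\<omega>. Y \<omega> ^ 2)" "0 \<le> expectation (\<lambda>\<omega>. S \<omega> ^ 2)"
    by simp_all
  have e4: "expectation (\<lambda>\<omega>. Y \<omega> ^ 4) \<le> 3 * s\<^sup>2" "expectation (\<lambda>\<omega>. S \<omega> ^ 4) \<le> 3 * t\<^sup>2"
    using Y S by (simp_all add: fourth_moment_bound_def)
  have x2: "(\<lambda>\<omega>. (Y \<omega> + S \<omega>)\<^sup>2) = (\<lambda>\<omega>. Y \<omega> ^ 2 + 2 * (Y \<omega> ^ 1 * S \<omega> ^ 1) + S \<omega> ^ 2)"
    by (rule ext) (simp add: power2_eq_square algebra_simps)
  have x4: "(\<lambda>\<omega>. (Y \<omega> + S \<omega>) ^ 4) = (\<lambda>\<omega>. Y \<omega> ^ 4 + 4 * (Y \<omega> ^ 3 * S \<omega> ^ 1) + 6 * (Y \<omega> ^ 2 * S \<omega> ^ 2)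
      + 4 * (Y \<omega> ^ 1 * S \<omega> ^ 3) + S \<omega> ^ 4)"
    by (rule ext) (simp add: eval_nat_numeral algebra_simps)
  have i4: "integrable M (\<lambda>\<omega>. Y \<omega> ^ 4)" "integrable M (\<lambda>\<omega>. 4 * (Y \<omega> ^ 3 * S \<omega> ^ 1))"
    "integrable M (\<lambda>\<omega>. 6 * (Y \<omega> ^ 2 * S \<omega> ^ 2))" "integrable M (\<lambda>\<omega>. 4 * (Y \<omega> ^ 1 * S \<omega> ^ 3))"
    "integrable M (\<lambda>\<omega>. S \<omega> ^ 4)"
    by (intro integrable_mult_right prod iY iS; simp)+
  show ?thesis
    unfolding fourth_moment_bound_def
  proof (intro conjI)
    show "(\<lambda>\<omega>. Y \<omega> + S \<omega>) \<in> borel_measurable M" by measurable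
    show "0 \<le> s + t" using st by simp
    show "integrable M (\<lambda>\<omega>. (Y \<omega> + S \<omega>) ^ 4)"
      unfolding x4 by (intro Bochner_Integration.integrable_add i4)
    show "expectation (\<lambda>\<omega>. Y \<omega> + S \<omega>) = 0"
      using iY[of 1] iS[of 1] e1 by simp
    have "expectation (\<lambda>\<omega>. (Y \<omega> + S \<omega>)\<^sup>2)
        = expectation (\<lambda>\<omega>. Y \<omega> ^ 2) + 2 * expectation (\<lambda>\<omega>. Y \<omega> ^ 1 * S \<omega> ^ 1) + expectation (\<lambda>\<omega>. S \<omega> ^ 2)"
    proof -
      have "integrable M (\<lambda>\<omega>. Y \<omega> ^ 2)" "integrable M (\<lambda>\<omega>. 2 * (Y \<omega> ^ 1 * S \<omega> ^ 1))" "integrable M (\<lambda>\<omega>. S \<omega> ^ 2)"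
        by (intro integrable_mult_right prod iY iS; simp)+
      then show ?thesis
        unfolding x2 by (simp only: Bochner_Integration.integral_add Bochner_Integration.integrable_add integral_mult_right_zero)
    qed
    also have "expectation (\<lambda>\<omega>. Y \<omega> ^ 1 * S \<omega> ^ 1) = 0"
      using prod(2)[of 1 1] e1 by simp
    finally show "expectation (\<lambda>\<omega>. (Y \<omega> + S \<omega>)\<^sup>2) \<le> s + t" using e2 by simp
    have "expectation (\<lambda>\<omega>. (Y \<omega> + S \<omega>) ^ 4)
        = expectation (\<lambda>\<omega>. Y \<omega> ^ 4) + 4 * expectation (\<lambda>\<omega>. Y \<omega> ^ 3 * S \<omega> ^ 1)
          + 6 * expectation (\<lambda>\<omega>. Y \<omega> ^ 2 * S \<omega> ^ 2) + 4 * expectation (\<lambda>\<omega>. Y \<omega> ^ 1 * S \<omega> ^ 3) + expectation (\<lambda>\<omega>. S \<omega> ^ 4)"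
      unfolding x4 using i4
      by (simp only: Bochner_Integration.integral_add Bochner_Integration.integrable_add integral_mult_right_zero)
    also have "expectation (\<lambda>\<omega>. Y \<omega> ^ 3 * S \<omega> ^ 1) = 0" using prod(2)[of 3 1] e1 by simp
    also have "expectation (\<lambda>\<omega>. Y \<omega> ^ 1 * S \<omega> ^ 3) = 0" using prod(2)[of 1 3] e1 by simp
    also have "expectation (\<lambda>\<omega>. Y \<omega> ^ 2 * S \<omega> ^ 2) \<le> s * t"
      using prod(2)[of 2 2] mult_mono[OF e2 st(1) e2'(2)] by simp
    finally have "expectation (\<lambda>\<omega>. (Y \<omega> + S \<omega>) ^ 4) \<le> 3 * s\<^sup>2 + 6 * (s * t) + 3 * t\<^sup>2"
      using e4 by linarith
    then show "expectation (\<lambda>\<omega>. (Y \<omega> + S \<omega>) ^ 4) \<le> 3 * (s + t)\<^sup>2"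
      by (simp add: power2_eq_square algebra_simps)
  qed
qed

lemma fourth_moment_bound_sum:
  assumes "finite I" "indep_vars (\<lambda>_. borel) Y I" "\<And>i. i \<in> I \<Longrightarrow> fourth_moment_bound (Y i) (s i)"
  shows "fourth_moment_bound (\<lambda>\<omega>. \<Sum>i\<in>I. Y i \<omega>) (\<Sum>i\<in>I. s i)"
  using assms
proof (induction I rule: finite_induct)
  case empty
  show ?case by (simp add: fourth_moment_bound_def)
next
  case (insert i I)
  have "fourth_moment_bound (\<lambda>\<omega>. Y i \<omega> + (\<Sum>i\<in>I. Y i \<omega>)) (s i + (\<Sum>i\<in>I. s i))"
  proof (rule fourth_moment_bound_add)
    show "fourth_moment_bound (\<lambda>\<omega>. \<Sum>i\<in>I. Y i \<omega>) (\<Sum>i\<in>I. s i)"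
      using insert.prems by (intro insert.IH) (auto intro: indep_vars_subset)
    show "indep_var borel (Y i) borel (\<lambda>\<omega>. \<Sum>i\<in>I. Y i \<omega>)"
      using insert.hyps insert.prems(1) by (rule indep_vars_sum)
  qed (use insert.prems in simp)
  then show ?case using insert.hyps by simp
qed

lemma normal_half_moments:
  assumes U: "distributed M lborel U (normal_density 0 (1 / sqrt 2))"
  shows "integrable M (\<lambda>\<omega>. U \<omega> ^ k)" "expectation U = 0"
    "expectation (\<lambda>\<omega>. (U \<omega>)\<^sup>2) = 1 / 2" "expectation (\<lambda>\<omega>. U \<omega> ^ 4) = 3 / 4"
proof -
  have \<sigma>: "0 < 1 / sqrt (2::real)" by simp
  have int: "expectation (\<lambda>\<omega>. U \<omega> ^ k) = (LINT x|lborel. normal_density 0 (1 / sqrt 2) x * (x - 0) ^ k)" for k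
    using distributed_integral[OF U, of "\<lambda>x. x ^ k"] by simp
  show "integrable M (\<lambda>\<omega>. U \<omega> ^ k)"
    using distributed_integrable[OF U, of "\<lambda>x. x ^ k"] integrable_normal_moment[OF \<sigma>, of 0 k] by simp
  show "expectation U = 0"
    using int[of 1] integral_normal_moment_odd[OF \<sigma>, of 0 0] by simp
  show "expectation (\<lambda>\<omega>. (U \<omega>)\<^sup>2) = 1 / 2"
    unfolding int using integral_normal_moment_even[OF \<sigma>, of 0 1] by (simp add: power_divide fact_numeral)
  show "expectation (\<lambda>\<omega>. U \<omega> ^ 4) = 3 / 4"
    unfolding int using integral_normal_moment_even[OF \<sigma>, of 0 2] by (simp add: power_divide fact_numeral)
qed

text \<open>The crude bound |Re (c z)| \<le> |c| |z| doubles the variance, but the constants still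
  fit: the fourth moment is at most 16 |c|^4 times 2 * 3/4 + 2 * 3/4, that is 48 |c|^4 = 3 (4
  |c|^2)^2.\<close>

lemma fourth_moment_bound_gaussian:
  assumes Z: "std_complex_gaussian M Z"
  shows "fourth_moment_bound (\<lambda>\<omega>. 2 * Re (c * Z \<omega>)) (4 * (cmod c)\<^sup>2)"
proof -
  have U: "distributed M lborel (\<lambda>\<omega>. Re (Z \<omega>)) (normal_density 0 (1 / sqrt 2))"
    and V: "distributed M lborel (\<lambda>\<omega>. Im (Z \<omega>)) (normal_density 0 (1 / sqrt 2))"
    using Z by (simp_all add: std_complex_gaussian_def)
  have [measurable]: "(\<lambda>\<omega>. Re (Z \<omega>)) \<in> borel_measurable M" "(\<lambda>\<omega>. Im (Z \<omega>)) \<in> borel_measurable M"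
    using distributed_measurable[OF U] distributed_measurable[OF V] by simp_all
  have meas[measurable]: "(\<lambda>\<omega>. 2 * Re (c * Z \<omega>)) \<in> borel_measurable M" by simp
  note mu = normal_half_moments[OF U] and mv = normal_half_moments[OF V]
  have le2: "(2 * Re (c * z))\<^sup>2 \<le> 4 * (cmod c)\<^sup>2 * ((Re z)\<^sup>2 + (Im z)\<^sup>2)" for z
  proof -
    have "(Re (c * z))\<^sup>2 \<le> (cmod (c * z))\<^sup>2"
      by (metis abs_Re_le_cmod abs_ge_zero power2_abs power_mono)
    also have "\<dots> = (cmod c)\<^sup>2 * ((Re z)\<^sup>2 + (Im z)\<^sup>2)"
      by (simp only: norm_mult power_mult_distrib cmod_power2[of z])
    finally show ?thesis unfolding power_mult_distrib by simp
  qed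
  have le4: "(2 * Re (c * z)) ^ 4 \<le> 16 * (cmod c) ^ 4 * (2 * Re z ^ 4 + 2 * Im z ^ 4)" for z
  proof -
    have "(2 * Re (c * z)) ^ 4 = ((2 * Re (c * z))\<^sup>2)\<^sup>2" by (simp add: power_mult[symmetric])
    also have "\<dots> \<le> (4 * (cmod c)\<^sup>2 * ((Re z)\<^sup>2 + (Im z)\<^sup>2))\<^sup>2"
      by (intro power_mono le2) simp
    also have "\<dots> = 16 * (cmod c) ^ 4 * ((Re z)\<^sup>2 + (Im z)\<^sup>2)\<^sup>2"
      by (simp add: power_mult_distrib power_mult[symmetric])
    also have "\<dots> \<le> 16 * (cmod c) ^ 4 * (2 * Re z ^ 4 + 2 * Im z ^ 4)"
    proof (rule mult_left_mono)
      show "((Re z)\<^sup>2 + (Im z)\<^sup>2)\<^sup>2 \<le> 2 * Re z ^ 4 + 2 * Im z ^ 4"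
        using zero_le_power2[of "(Re z)\<^sup>2 - (Im z)\<^sup>2"] by (simp add: power2_eq_square eval_nat_numeral algebra_simps)
    qed simp
    finally show ?thesis .
  qed
  have int4: "integrable M (\<lambda>\<omega>. 16 * (cmod c) ^ 4 * (2 * Re (Z \<omega>) ^ 4 + 2 * Im (Z \<omega>) ^ 4))"
    using mu(1)[of 4] mv(1)[of 4] by simp
  have int2: "integrable M (\<lambda>\<omega>. 4 * (cmod c)\<^sup>2 * ((Re (Z \<omega>))\<^sup>2 + (Im (Z \<omega>))\<^sup>2))"
    using mu(1)[of 2] mv(1)[of 2] by simp
  have i4: "integrable M (\<lambda>\<omega>. (2 * Re (c * Z \<omega>)) ^ 4)"
  proof (rule Bochner_Integration.integrable_bound[OF int4])
    show "AE \<omega> in M. norm ((2 * Re (c * Z \<omega>)) ^ 4) \<le> norm (16 * (cmod c) ^ 4 * (2 * Re (Z \<omega>) ^ 4 + 2 * Im (Z \<omega>) ^ 4))"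
    proof (intro AE_I2)
      fix \<omega>
      have "norm ((2 * Re (c * Z \<omega>)) ^ 4) = (2 * Re (c * Z \<omega>)) ^ 4"
        unfolding real_norm_def by (intro abs_of_nonneg zero_le_even_power) simp
      also have "\<dots> \<le> 16 * (cmod c) ^ 4 * (2 * Re (Z \<omega>) ^ 4 + 2 * Im (Z \<omega>) ^ 4)" by (rule le4)
      also have "\<dots> \<le> norm (16 * (cmod c) ^ 4 * (2 * Re (Z \<omega>) ^ 4 + 2 * Im (Z \<omega>) ^ 4))"
        unfolding real_norm_def by (rule abs_ge_self)
      finally show "norm ((2 * Re (c * Z \<omega>)) ^ 4) \<le> norm (16 * (cmod c) ^ 4 * (2 * Re (Z \<omega>) ^ 4 + 2 * Im (Z \<omega>) ^ 4))" .
    qed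
  qed (intro borel_measurable_power meas)
  have i2: "integrable M (\<lambda>\<omega>. (2 * Re (c * Z \<omega>))\<^sup>2)"
    by (rule integrable_power_le_4[OF meas i4]) simp
  show ?thesis
    unfolding fourth_moment_bound_def
  proof (intro conjI meas i4)
    show "0 \<le> 4 * (cmod c)\<^sup>2" by simp
    show "expectation (\<lambda>\<omega>. 2 * Re (c * Z \<omega>)) = 0"
      using mu(1)[of 1] mv(1)[of 1] mu(2) mv(2) by simp
    have "expectation (\<lambda>\<omega>. (2 * Re (c * Z \<omega>))\<^sup>2) \<le> expectation (\<lambda>\<omega>. 4 * (cmod c)\<^sup>2 * ((Re (Z \<omega>))\<^sup>2 + (Im (Z \<omega>))\<^sup>2))"
      by (rule integral_mono[OF i2 int2 le2])
    also have "\<dots> = 4 * (cmod c)\<^sup>2"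
      using mu(1)[of 2] mv(1)[of 2] mu(3) mv(3) by simp
    finally show "expectation (\<lambda>\<omega>. (2 * Re (c * Z \<omega>))\<^sup>2) \<le> 4 * (cmod c)\<^sup>2" .
    have "expectation (\<lambda>\<omega>. (2 * Re (c * Z \<omega>)) ^ 4)
        \<le> expectation (\<lambda>\<omega>. 16 * (cmod c) ^ 4 * (2 * Re (Z \<omega>) ^ 4 + 2 * Im (Z \<omega>) ^ 4))"
      by (rule integral_mono[OF i4 int4 le4])
    also have "\<dots> = 48 * (cmod c) ^ 4"
      using mu(1)[of 4] mv(1)[of 4] mu(4) mv(4) by simp
    also have "\<dots> = 3 * (4 * (cmod c)\<^sup>2)\<^sup>2"
      by (simp add: power_mult_distrib power_mult[symmetric])
    finally show "expectation (\<lambda>\<omega>. (2 * Re (c * Z \<omega>)) ^ 4) \<le> 3 * (4 * (cmod c)\<^sup>2)\<^sup>2" .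
  qed
qed

end

section \<open>Real trigonometric polynomials with random coefficients\<close>

definition half_plane :: "(int \<times> int) set" where
  "half_plane = {k. k = 0 \<or> 0 < fst k \<or> fst k = 0 \<and> 0 < snd k}"

lemma half_plane_uminus: "k \<noteq> 0 \<Longrightarrow> - k \<in> half_plane \<longleftrightarrow> k \<notin> half_plane"
  by (cases k) (auto simp: half_plane_def zero_prod_def)

text \<open>Joining \<open>k\<close> with \<open>- k\<close> expresses the polynomial through one
  coefficient of each pair, which is the family in which the noise is independent.\<close>

lemma trig_half_plane:
  assumes A: "finite A" "0 \<notin> A" "uminus ` A = A" and c: "\<And>k. k \<in> A \<Longrightarrow> c (- k) = cnj (c k)"
  shows "trig A c x = complex_of_real (\<Sum>k\<in>A \<inter> half_plane. 2 * Re (c k * cis (freq k \<bullet> x)))"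
proof -
  let ?t = "\<lambda>k. c k * cis (freq k \<bullet> x)"
  have "trig A c x = (\<Sum>k\<in>A \<inter> half_plane. ?t k) + (\<Sum>k\<in>A - half_plane. ?t k)"
    unfolding trig_def using A(1) by (rule sum.Int_Diff)
  also have "(\<Sum>k\<in>A - half_plane. ?t k) = (\<Sum>k\<in>A \<inter> half_plane. ?t (- k))"
  proof (rule sum.reindex_bij_betw[symmetric], rule bij_betwI[where g = uminus])
    show "uminus \<in> A \<inter> half_plane \<rightarrow> A - half_plane"
    proof
      fix k assume "k \<in> A \<inter> half_plane"
      then have "k \<noteq> 0" "k \<in> A" "k \<in> half_plane" using A(2) by auto
      moreover have "- k \<in> A" using A(3) \<open>k \<in> A\<close> by blast
      ultimately show "- k \<in> A - half_plane" using half_plane_uminus by blast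
    qed
    show "uminus \<in> A - half_plane \<rightarrow> A \<inter> half_plane"
    proof
      fix k assume "k \<in> A - half_plane"
      then have "k \<noteq> 0" "k \<in> A" "k \<notin> half_plane" using A(2) by auto
      moreover have "- k \<in> A" using A(3) \<open>k \<in> A\<close> by blast
      ultimately show "- k \<in> A \<inter> half_plane" using half_plane_uminus by blast
    qed
  qed auto
  also have "(\<Sum>k\<in>A \<inter> half_plane. ?t k) + (\<Sum>k\<in>A \<inter> half_plane. ?t (- k))
      = (\<Sum>k\<in>A \<inter> half_plane. complex_of_real (2 * Re (?t k)))"
    unfolding sum.distrib[symmetric]
  proof (rule sum.cong[OF refl])
    fix k assume "k \<in> A \<inter> half_plane"
    then have "?t (- k) = cnj (?t k)" using c by (simp add: freq_uminus cis_cnj)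
    then show "?t k + ?t (- k) = complex_of_real (2 * Re (?t k))" by (simp only: complex_add_cnj)
  qed
  finally show ?thesis by simp
qed

text \<open>The square of the polynomial has its spectrum in the box of radius 2N, which has (4N +
  1)^2 points. Cauchy-Schwarz over these coefficients and Parseval give the supremum of the square
  in terms of its L2 norm.\<close>

lemma cmod_trig_pow4_le:
  assumes A: "finite A" "A \<subseteq> fbox N"
  shows "cmod (trig A c x) ^ 4 \<le> (4 * real N + 1)\<^sup>2 * (LINT x|torus. cmod (trig A c x) ^ 4)"
proof -
  define d where "d k = (if k \<in> A then c k else 0)" for k
  define S where "S = (\<lambda>(k, l). k + l) ` (A \<times> A)"
  define e where "e n = (\<Sum>k\<in>A. c k * d (n - k))" for n
  have d0: "d k = 0" if "k \<notin> A" for k using that by (simp add: d_def)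
  have S: "finite S" using A by (simp add: S_def)
  have "trig A c x = trig A d x" for x
    unfolding trig_def d_def by (intro sum.cong) auto
  then have sq: "(trig A c x)\<^sup>2 = trig S e x" for x
    using trig_mult[where A = A and B = A and c = c and d = d and x = x, OF A(1) A(1) d0] by (simp add: S_def e_def[abs_def] power2_eq_square)
  have sq': "cmod (trig A c x) ^ 4 = (cmod (trig S e x))\<^sup>2" for x
    by (simp add: sq[symmetric] norm_power power_mult[symmetric])
  have "(cmod (trig S e x))\<^sup>2 \<le> (\<Sum>n\<in>S. 1 * cmod (e n))\<^sup>2"
    using cmod_trig_le[of S e x] by (intro power_mono) auto
  also have "\<dots> \<le> (\<Sum>n\<in>S. 1\<^sup>2) * (\<Sum>n\<in>S. (cmod (e n))\<^sup>2)"
    by (rule Cauchy_Schwarz_ineq_sum)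
  also have "\<dots> = real (card S) * (LINT x|torus. cmod (trig A c x) ^ 4)"
    by (simp add: sq' parseval_trig[OF S])
  also have "\<dots> \<le> (4 * real N + 1)\<^sup>2 * (LINT x|torus. cmod (trig A c x) ^ 4)"
  proof (rule mult_right_mono)
    have "S \<subseteq> fbox (2 * N)"
    proof
      fix n assume "n \<in> S"
      then obtain k l where kl: "k \<in> A" "l \<in> A" "n = k + l" by (auto simp: S_def)
      then have "k \<in> fbox N" "l \<in> fbox N" using A(2) by auto
      then show "n \<in> fbox (2 * N)" unfolding kl(3) by (cases k; cases l) (simp add: fbox_def)
    qed
    then have "card S \<le> card (fbox (2 * N))" by (intro card_mono) auto
    also have "\<dots> = (4 * N + 1)\<^sup>2"
      by (simp add: fbox_def card_cartesian_product power2_eq_square nat_add_distrib nat_mult_distrib)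
    finally have "real (card S) \<le> real ((4 * N + 1)\<^sup>2)" by (rule of_nat_mono)
    then show "real (card S) \<le> (4 * real N + 1)\<^sup>2" by (simp add: add.commute)
  qed simp
  finally show ?thesis by (simp only: sq')
qed

text \<open>By Fubini it is enough to fix \<open>x\<close>, where the polynomial is almost surely a
  sum of independent centred variables with total variance bound 4 times the sum of the |a k|^2;
  hence 48 = 3 * 4^2.\<close>

lemma white_noise_fourth_moment:
  assumes M: "prob_space M" and \<xi>: "white_noise M \<xi>"
    and A: "finite A" "0 \<notin> A" "uminus ` A = A" and a: "\<And>k. k \<in> A \<Longrightarrow> a (- k) = cnj (a k)"
  shows "(\<integral>\<^sup>+ \<omega>. (\<integral>\<^sup>+ x. ennreal (cmod (trig A (\<lambda>k. a k * \<xi> k \<omega>) x) ^ 4) \<partial>torus) \<partial>M)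
      \<le> ennreal (48 * (\<Sum>k\<in>A. (cmod (a k))\<^sup>2)\<^sup>2)"
proof -
  interpret prob_space M by fact
  interpret T: pair_sigma_finite M torus ..
  have \<xi>m[measurable]: "\<xi> k \<in> borel_measurable M" for k using \<xi> unfolding white_noise_def by blast
  let ?P = "\<lambda>\<omega> x. trig A (\<lambda>k. a k * \<xi> k \<omega>) x"
  have meas: "(\<lambda>(\<omega>, x). ennreal (cmod (?P \<omega> x) ^ 4)) \<in> borel_measurable (M \<Otimes>\<^sub>M torus)"
    unfolding trig_def by measurable
  have pt: "(\<integral>\<^sup>+ \<omega>. ennreal (cmod (?P \<omega> x) ^ 4) \<partial>M) \<le> ennreal (48 * (\<Sum>k\<in>A. (cmod (a k))\<^sup>2)\<^sup>2)" for x
  proof -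
    define Y where "Y k \<omega> = 2 * Re ((a k * cis (freq k \<bullet> x)) * \<xi> k \<omega>)" for k \<omega>
    let ?I = "A \<inter> half_plane"
    have "indep_vars (\<lambda>_. borel) \<xi> half_plane"
      using \<xi> unfolding white_noise_def half_plane_def by blast
    then have "indep_vars (\<lambda>_. borel) \<xi> ?I" by (rule indep_vars_subset) simp
    then have "indep_vars (\<lambda>_. borel) (\<lambda>k \<omega>. 2 * Re ((a k * cis (freq k \<bullet> x)) * \<xi> k \<omega>)) ?I"
      by (rule indep_vars_compose2) measurable
    then have ind: "indep_vars (\<lambda>_. borel) Y ?I" by (simp only: Y_def[abs_def])
    have "fourth_moment_bound (Y k) (4 * (cmod (a k))\<^sup>2)" if "k \<in> ?I" for k
    proof -
      have "k \<noteq> 0" using that A(2) by auto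
      then have "std_complex_gaussian M (\<xi> k)" using \<xi> unfolding white_noise_def by blast
      from fourth_moment_bound_gaussian[OF this, of "a k * cis (freq k \<bullet> x)"]
      show ?thesis by (simp add: Y_def[abs_def] norm_mult)
    qed
    then have fm: "fourth_moment_bound (\<lambda>\<omega>. \<Sum>k\<in>?I. Y k \<omega>) (\<Sum>k\<in>?I. 4 * (cmod (a k))\<^sup>2)"
      using A(1) ind by (intro fourth_moment_bound_sum) auto
    have "AE \<omega> in M. real_distribution (\<lambda>k. \<xi> k \<omega>)" using \<xi> unfolding white_noise_def by blast
    then have "AE \<omega> in M. ennreal (cmod (?P \<omega> x) ^ 4) = ennreal ((\<Sum>k\<in>?I. Y k \<omega>) ^ 4)"
    proof eventually_elim
      case (elim \<omega>)
      have "?P \<omega> x = complex_of_real (\<Sum>k\<in>?I. 2 * Re (a k * \<xi> k \<omega> * cis (freq k \<bullet> x)))"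
        using elim a by (intro trig_half_plane A) (auto simp: real_distribution_def)
      also have "(\<Sum>k\<in>?I. 2 * Re (a k * \<xi> k \<omega> * cis (freq k \<bullet> x))) = (\<Sum>k\<in>?I. Y k \<omega>)"
        unfolding Y_def by (intro sum.cong refl arg_cong[where f = "\<lambda>z. 2 * Re z"]) (simp only: mult_ac)
      finally have "cmod (?P \<omega> x) ^ 4 = \<bar>\<Sum>k\<in>?I. Y k \<omega>\<bar> ^ 4" by (simp only: norm_of_real)
      also have "\<dots> = (\<Sum>k\<in>?I. Y k \<omega>) ^ 4" by (rule power_even_abs) simp
      finally show ?case by (rule arg_cong)
    qed
    then have "(\<integral>\<^sup>+ \<omega>. ennreal (cmod (?P \<omega> x) ^ 4) \<partial>M) = (\<integral>\<^sup>+ \<omega>. ennreal ((\<Sum>k\<in>?I. Y k \<omega>) ^ 4) \<partial>M)"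
      by (rule nn_integral_cong_AE)
    also have "\<dots> = ennreal (expectation (\<lambda>\<omega>. (\<Sum>k\<in>?I. Y k \<omega>) ^ 4))"
      using fm unfolding fourth_moment_bound_def by (intro nn_integral_eq_integral) auto
    also have "\<dots> \<le> ennreal (48 * (\<Sum>k\<in>A. (cmod (a k))\<^sup>2)\<^sup>2)"
    proof (rule ennreal_leI)
      have "expectation (\<lambda>\<omega>. (\<Sum>k\<in>?I. Y k \<omega>) ^ 4) \<le> 3 * (\<Sum>k\<in>?I. 4 * (cmod (a k))\<^sup>2)\<^sup>2"
        using fm unfolding fourth_moment_bound_def by blast
      also have "\<dots> \<le> 3 * (\<Sum>k\<in>A. 4 * (cmod (a k))\<^sup>2)\<^sup>2"
        using A(1) by (intro mult_left_mono power_mono sum_mono2 sum_nonneg) auto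
      also have "\<dots> = 48 * (\<Sum>k\<in>A. (cmod (a k))\<^sup>2)\<^sup>2"
        by (simp add: sum_distrib_left[symmetric] power_mult_distrib)
      finally show "expectation (\<lambda>\<omega>. (\<Sum>k\<in>?I. Y k \<omega>) ^ 4) \<le> 48 * (\<Sum>k\<in>A. (cmod (a k))\<^sup>2)\<^sup>2" .
    qed
    finally show ?thesis .
  qed
  have "(\<integral>\<^sup>+ \<omega>. (\<integral>\<^sup>+ x. ennreal (cmod (?P \<omega> x) ^ 4) \<partial>torus) \<partial>M)
      = (\<integral>\<^sup>+ x. (\<integral>\<^sup>+ \<omega>. ennreal (cmod (?P \<omega> x) ^ 4) \<partial>M) \<partial>torus)"
    using T.Fubini'[OF meas] by simp
  also have "\<dots> \<le> (\<integral>\<^sup>+ x. ennreal (48 * (\<Sum>k\<in>A. (cmod (a k))\<^sup>2)\<^sup>2) \<partial>torus)"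
    by (intro nn_integral_mono pt)
  also have "\<dots> = ennreal (48 * (\<Sum>k\<in>A. (cmod (a k))\<^sup>2)\<^sup>2)"
    using torus.emeasure_space_1 by simp
  finally show ?thesis .
qed

section \<open>Regularity of the field \<open>X\<close>\<close>

text \<open>Annuli in the maximum norm, which tile the boxes of radius 2^J - 1 exactly; dyadic sums
  are therefore a subsequence of the Fourier partial sums.\<close>

definition dblock :: "nat \<Rightarrow> (int \<times> int) set" where
  "dblock j = {k. 2 ^ j \<le> max \<bar>fst k\<bar> \<bar>snd k\<bar> \<and> max \<bar>fst k\<bar> \<bar>snd k\<bar> < 2 ^ Suc j}"

lemma dblock_subset_fbox: "dblock j \<subseteq> fbox (2 ^ Suc j)"
proof
  fix k assume "k \<in> dblock j"
  then have "\<bar>fst k\<bar> \<le> 2 ^ Suc j" "\<bar>snd k\<bar> \<le> 2 ^ Suc j" by (auto simp: dblock_def)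
  then show "k \<in> fbox (2 ^ Suc j)" by (cases k) (auto simp: fbox_def)
qed

lemma finite_dblock [simp]: "finite (dblock j)"
  using dblock_subset_fbox finite_fbox by (rule finite_subset)

lemma zero_notin_dblock: "0 \<notin> dblock j"
  by (simp add: dblock_def)

lemma uminus_dblock: "uminus ` dblock j = dblock j"
proof
  show "uminus ` dblock j \<subseteq> dblock j" by (auto simp: dblock_def)
  show "dblock j \<subseteq> uminus ` dblock j"
  proof
    fix k assume "k \<in> dblock j"
    then have "- k \<in> dblock j" by (simp add: dblock_def)
    then show "k \<in> uminus ` dblock j" by (rule rev_image_eqI) simp
  qed
qed

lemma two_power_square: "((2 :: 'a :: comm_semiring_1) ^ j)\<^sup>2 = 4 ^ j"
proof -
  have "((2 :: 'a) ^ j)\<^sup>2 = (2\<^sup>2) ^ j" by (simp only: power_mult[symmetric] mult.commute)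
  then show ?thesis by simp
qed

lemma card_dblock: "real (card (dblock j)) \<le> 25 * 4 ^ j"
proof -
  have "card (dblock j) \<le> card (fbox (2 ^ Suc j))"
    by (intro card_mono dblock_subset_fbox) simp
  also have "\<dots> = (4 * 2 ^ j + 1)\<^sup>2"
    by (simp add: fbox_def card_cartesian_product power2_eq_square nat_add_distrib nat_mult_distrib nat_power_eq)
  also have "\<dots> \<le> (5 * 2 ^ j)\<^sup>2" by (intro power_mono) auto
  also have "\<dots> = 25 * 4 ^ j" by (simp add: power_mult_distrib two_power_square)
  finally have "real (card (dblock j)) \<le> real (25 * 4 ^ j)" by (rule of_nat_mono)
  then show ?thesis by simp
qed

lemma dblock_fnorm_ge: "k \<in> dblock j \<Longrightarrow> 2 ^ j \<le> fnorm k"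
proof -
  assume k: "k \<in> dblock j"
  have "(2::real) ^ j = real_of_int (2 ^ j)" by simp
  also have "\<dots> \<le> real_of_int (max \<bar>fst k\<bar> \<bar>snd k\<bar>)"
    using k unfolding dblock_def of_int_le_iff by blast
  also have "\<dots> \<le> fnorm k" using abs_fst_le_fnorm[of k] abs_snd_le_fnorm[of k] by simp
  finally show ?thesis .
qed

lemma dblock_inner_le:
  assumes k: "k \<in> dblock j" and b: "b \<in> Basis"
  shows "\<bar>freq k \<bullet> b\<bar> \<le> 2 ^ Suc j"
proof -
  have "\<bar>freq k \<bullet> b\<bar> \<le> real_of_int (max \<bar>fst k\<bar> \<bar>snd k\<bar>)"
    using b by (auto simp: freq_def Basis_prod_def)
  also have "\<dots> \<le> real_of_int (2 ^ Suc j)"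
    using k unfolding dblock_def of_int_le_iff by auto
  finally show ?thesis by simp
qed

lemma fbox_dyadic_Suc:
  "fbox (2 ^ Suc J - 1) = fbox (2 ^ J - 1) \<union> dblock J" "fbox (2 ^ J - 1) \<inter> dblock J = {}"
proof -
  have f: "k \<in> fbox (2 ^ J - 1) \<longleftrightarrow> max \<bar>fst k\<bar> \<bar>snd k\<bar> < 2 ^ J" for k J
  proof -
    have "k \<in> fbox (2 ^ J - 1) \<longleftrightarrow> \<bar>fst k\<bar> \<le> int (2 ^ J - 1) \<and> \<bar>snd k\<bar> \<le> int (2 ^ J - 1)"
      by (cases k) (auto simp: fbox_def)
    also have "int (2 ^ J - 1) = 2 ^ J - 1" by (simp add: of_nat_diff)
    finally show ?thesis by auto
  qed
  have g: "k \<in> dblock J \<longleftrightarrow> 2 ^ J \<le> max \<bar>fst k\<bar> \<bar>snd k\<bar> \<and> max \<bar>fst k\<bar> \<bar>snd k\<bar> < 2 ^ Suc J" for k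
    by (simp only: dblock_def mem_Collect_eq)
  have "(2::int) ^ J \<le> 2 ^ Suc J" by simp
  then show "fbox (2 ^ Suc J - 1) = fbox (2 ^ J - 1) \<union> dblock J"
    unfolding set_eq_iff Un_iff f g by (auto simp only: not_le)
  show "fbox (2 ^ J - 1) \<inter> dblock J = {}"
    unfolding set_eq_iff Int_iff f g by (auto simp only: not_le)
qed

lemma trig_fbox_dyadic:
  "trig (fbox (2 ^ J - 1)) c x = c 0 + (\<Sum>j<J. trig (dblock j) c x)"
proof (induction J)
  case 0
  have "fbox 0 = {0}" by (auto simp: fbox_def zero_prod_def)
  then show ?case by (simp add: trig_def)
next
  case (Suc J)
  have "trig (fbox (2 ^ Suc J - 1)) c x = trig (fbox (2 ^ J - 1)) c x + trig (dblock J) c x"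
    unfolding fbox_dyadic_Suc(1) unfolding trig_def
    by (rule sum.union_disjoint[OF finite_fbox finite_dblock fbox_dyadic_Suc(2)])
  then show ?case using Suc by simp
qed

lemma two_power_eq_qr: "(2::real) ^ j = 1 / (qr ^ j) ^ 8"
proof -
  have "(qr ^ j) ^ 8 = (qr ^ 8) ^ j" by (simp only: power_mult[symmetric] mult.commute)
  then show ?thesis by (simp add: qr_8 power_divide)
qed

text \<open>A weighted sum over all \<open>m\<close> and \<open>j\<close> of fourth moments has
  finite expectation, hence is finite almost surely and bounds every single term. This gives one
  random constant for all scales and all steps simultaneously.\<close>

lemma white_noise_blocks:
  assumes M: "prob_space M" and \<xi>: "white_noise M \<xi>"
    and a: "\<And>m j k. a m j (- k) = cnj (a m j k)"
    and sum: "\<And>m j. (\<Sum>k\<in>dblock j. (cmod (a m j k))\<^sup>2) \<le> 400 * (qr ^ m) ^ 4 * (qr ^ j) ^ 12"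
  shows "AE \<omega> in M. \<exists>K\<ge>0. \<forall>m j x. cmod (trig (dblock j) (\<lambda>k. a m j k * \<xi> k \<omega>) x) \<le> K * qr ^ m * qr ^ j"
proof -
  interpret prob_space M by fact
  have \<xi>m[measurable]: "\<xi> k \<in> borel_measurable M" for k using \<xi> unfolding white_noise_def by blast
  let ?P = "\<lambda>m j \<omega> x. trig (dblock j) (\<lambda>k. a m j k * \<xi> k \<omega>) x"
  define Z where "Z m j \<omega> = (\<integral>\<^sup>+ x. ennreal (cmod (?P m j \<omega> x) ^ 4) \<partial>torus)" for m j \<omega>
  have Zm[measurable]: "Z m j \<in> borel_measurable M" for m j
    unfolding Z_def[abs_def] trig_def by measurable
  define c :: real where "c = 48 * 400\<^sup>2"
  have EZ: "(\<integral>\<^sup>+ \<omega>. Z m j \<omega> \<partial>M) \<le> ennreal (c * (qr ^ m) ^ 8 * (qr ^ j) ^ 24)" for m j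
  proof -
    have "(\<integral>\<^sup>+ \<omega>. Z m j \<omega> \<partial>M) \<le> ennreal (48 * (\<Sum>k\<in>dblock j. (cmod (a m j k))\<^sup>2)\<^sup>2)"
      unfolding Z_def
      by (rule white_noise_fourth_moment[where a = "a m j", OF M \<xi> finite_dblock zero_notin_dblock uminus_dblock a])
    also have "\<dots> \<le> ennreal (48 * (400 * (qr ^ m) ^ 4 * (qr ^ j) ^ 12)\<^sup>2)"
      by (intro ennreal_leI mult_left_mono power_mono sum sum_nonneg) auto
    also have "48 * (400 * (qr ^ m) ^ 4 * (qr ^ j) ^ 12)\<^sup>2 = c * (qr ^ m) ^ 8 * (qr ^ j) ^ 24"
      by (simp add: c_def power_mult_distrib power_mult[of "qr ^ m" 4 2, symmetric] power_mult[of "qr ^ j" 12 2, symmetric])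
    finally show ?thesis .
  qed
  \<comment> \<open>The expectations decay like \<open>(qr ^ m) ^ 8 * (qr ^ j) ^ 24\<close>. The
    weight leaves \<open>(qr ^ m) ^ 4 * (qr ^ j) ^ 4\<close> for summability. Of the remaining
    decay, the supremum bound costs 4^j, that is \<open>(qr ^ j) ^ 16\<close>, so a fourth power of
    each rate survives.\<close>
  define w where "w m j = 1 / ((qr ^ m) ^ 4 * (qr ^ j) ^ 20)" for m j
  have w: "w m j > 0" for m j using qr_bounds by (simp add: w_def)
  define T where "T \<omega> = (\<Sum>m. \<Sum>j. ennreal (w m j) * Z m j \<omega>)" for \<omega>
  have Tm: "T \<in> borel_measurable M" unfolding T_def[abs_def] by measurable
  define u where "u = qr ^ 4"
  have u: "0 < u" "u < 1" using qr_bounds by (auto simp: u_def power_less_one_iff)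
  have "(\<integral>\<^sup>+ \<omega>. T \<omega> \<partial>M) = (\<Sum>m. \<integral>\<^sup>+ \<omega>. (\<Sum>j. ennreal (w m j) * Z m j \<omega>) \<partial>M)"
    unfolding T_def by (rule nn_integral_suminf) measurable
  also have "\<dots> = (\<Sum>m. \<Sum>j. \<integral>\<^sup>+ \<omega>. ennreal (w m j) * Z m j \<omega> \<partial>M)"
    by (intro arg_cong[where f = suminf] ext nn_integral_suminf) measurable
  also have "\<dots> = (\<Sum>m. \<Sum>j. ennreal (w m j) * (\<integral>\<^sup>+ \<omega>. Z m j \<omega> \<partial>M))"
    by (intro arg_cong[where f = suminf] ext nn_integral_cmult) measurable
  also have "\<dots> \<le> (\<Sum>m. \<Sum>j. ennreal (c * u ^ m * u ^ j))"
  proof (intro suminf_le allI)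
    fix m j
    have "ennreal (w m j) * (\<integral>\<^sup>+ \<omega>. Z m j \<omega> \<partial>M) \<le> ennreal (w m j) * ennreal (c * (qr ^ m) ^ 8 * (qr ^ j) ^ 24)"
      by (intro mult_left_mono EZ) simp
    also have "\<dots> = ennreal (w m j * (c * (qr ^ m) ^ 8 * (qr ^ j) ^ 24))"
      by (rule ennreal_mult'[symmetric]) (rule less_imp_le[OF w])
    also have "w m j * (c * (qr ^ m) ^ 8 * (qr ^ j) ^ 24) = c * ((qr ^ m) ^ 8 / (qr ^ m) ^ 4) * ((qr ^ j) ^ 24 / (qr ^ j) ^ 20)"
      by (simp add: w_def)
    also have "(qr ^ m) ^ 8 / (qr ^ m) ^ 4 = (qr ^ m) ^ 4"
      using qr_bounds power_diff[of "qr ^ m" 4 8] by simp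
    also have "(qr ^ j) ^ 24 / (qr ^ j) ^ 20 = (qr ^ j) ^ 4"
      using qr_bounds power_diff[of "qr ^ j" 20 24] by simp
    also have "c * (qr ^ m) ^ 4 * (qr ^ j) ^ 4 = c * u ^ m * u ^ j"
      unfolding u_def power_mult[symmetric] by (simp only: mult.commute)
    finally show "ennreal (w m j) * (\<integral>\<^sup>+ \<omega>. Z m j \<omega> \<partial>M) \<le> ennreal (c * u ^ m * u ^ j)" .
  qed auto
  also have "\<dots> = (\<Sum>m. ennreal (c * u ^ m * (1 / (1 - u))))"
    using u by (intro arg_cong[where f = suminf] ext suminf_ennreal_eq sums_mult geometric_sums) (auto simp: c_def)
  also have "\<dots> = ennreal (c * (1 / (1 - u)) * (1 / (1 - u)))"
  proof (rule suminf_ennreal_eq)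
    show "(\<lambda>m. c * u ^ m * (1 / (1 - u))) sums (c * (1 / (1 - u)) * (1 / (1 - u)))"
      using u by (intro sums_mult2 sums_mult geometric_sums) auto
  qed (use u in \<open>auto simp: c_def\<close>)
  finally have "(\<integral>\<^sup>+ \<omega>. T \<omega> \<partial>M) \<noteq> \<infinity>"
    by (auto simp: top_unique)
  then have "AE \<omega> in M. T \<omega> \<noteq> \<infinity>"
    by (rule nn_integral_PInf_AE[OF Tm])
  then show ?thesis
  proof eventually_elim
    case (elim \<omega>)
    define t where "t = enn2real (T \<omega>)"
    have t: "t \<ge> 0" "T \<omega> = ennreal t" using elim by (auto simp: t_def less_top)
    \<comment> \<open>Being at least 1, \<open>K\<close> is below its fourth power, so
      \<open>81 * t\<close> is too; this spares taking a fourth root.\<close>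
    define K where "K = 81 * t + 1"
    have K: "K \<ge> 1" using t by (simp add: K_def)
    have "cmod (?P m j \<omega> x) \<le> K * qr ^ m * qr ^ j" for m j x
    proof -
      let ?I = "LINT x|torus. cmod (?P m j \<omega> x) ^ 4"
      have I: "Z m j \<omega> = ennreal ?I"
        unfolding Z_def
      proof (rule nn_integral_eq_integral)
        show "integrable torus (\<lambda>x. cmod (?P m j \<omega> x) ^ 4)"
          by (rule integrable_torus_bounded[where B = "(\<Sum>k\<in>dblock j. cmod (a m j k * \<xi> k \<omega>)) ^ 4"])
             (auto intro!: power_mono cmod_trig_le)
      qed simp
      have "ennreal (w m j) * Z m j \<omega> \<le> (\<Sum>j. ennreal (w m j) * Z m j \<omega>)"
        using sum_le_suminf[of "\<lambda>j. ennreal (w m j) * Z m j \<omega>" "{j}"] by simp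
      also have "\<dots> \<le> T \<omega>"
        unfolding T_def using sum_le_suminf[of "\<lambda>m. \<Sum>j. ennreal (w m j) * Z m j \<omega>" "{m}"] by simp
      finally have "ennreal (w m j * ?I) \<le> ennreal t"
        unfolding I t(2) ennreal_mult'[OF less_imp_le[OF w], symmetric] .
      then have wI: "w m j * ?I \<le> t" using t(1) by (simp only: ennreal_le_iff)
      have "?I = (w m j * ?I) * ((qr ^ m) ^ 4 * (qr ^ j) ^ 20)" using qr_bounds by (simp add: w_def)
      also have "\<dots> \<le> t * ((qr ^ m) ^ 4 * (qr ^ j) ^ 20)" using wI qr_bounds by (intro mult_right_mono) auto
      finally have I2: "?I \<le> t * ((qr ^ m) ^ 4 * (qr ^ j) ^ 20)" .
      have "cmod (?P m j \<omega> x) ^ 4 \<le> (4 * real (2 ^ Suc j) + 1)\<^sup>2 * ?I"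
        by (rule cmod_trig_pow4_le[OF finite_dblock dblock_subset_fbox])
      \<comment> \<open>The block lies in the box of radius 2^(j+1), and 4 * 2^(j+1) + 1 \<le> 9 *
        2^j.\<close>
      also have "\<dots> \<le> (9 * 2 ^ j)\<^sup>2 * (t * ((qr ^ m) ^ 4 * (qr ^ j) ^ 20))"
        by (intro mult_mono power_mono I2) auto
      also have "\<dots> = 81 * t * (qr ^ m) ^ 4 * (((2 ^ j) * (qr ^ j) ^ 8)\<^sup>2 * (qr ^ j) ^ 4)"
      proof -
        have "(qr ^ j) ^ 20 = ((qr ^ j) ^ 8)\<^sup>2 * (qr ^ j) ^ 4"
          unfolding power_mult[of "qr ^ j", symmetric] power_add[of "qr ^ j", symmetric] by simp
        then show ?thesis by (simp add: power_mult_distrib)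
      qed
      also have "2 ^ j * (qr ^ j) ^ 8 = 1"
        using qr_bounds unfolding two_power_eq_qr by simp
      also have "81 * t * (qr ^ m) ^ 4 * (1\<^sup>2 * (qr ^ j) ^ 4) \<le> K ^ 4 * (qr ^ m) ^ 4 * (qr ^ j) ^ 4"
      proof -
        have "K ^ 1 \<le> K ^ 4" using K by (intro power_increasing) auto
        then have "81 * t \<le> K ^ 4" by (simp add: K_def)
        then have "81 * t * ((qr ^ m) ^ 4 * (qr ^ j) ^ 4) \<le> K ^ 4 * ((qr ^ m) ^ 4 * (qr ^ j) ^ 4)"
          using qr_bounds by (intro mult_right_mono) auto
        then show ?thesis by (simp add: mult.assoc)
      qed
      also have "\<dots> = (K * qr ^ m * qr ^ j) ^ 4" by (simp only: power_mult_distrib)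
      finally show ?thesis
        by (rule power_le_imp_le_base[of _ 3, simplified]) (use K qr_bounds in simp)
    qed
    then show ?case using K by (intro exI[of _ K]) auto
  qed
qed

text \<open>Fourier multiplier of the inverse Laplacian on mean-zero functions: the deterministic
  part of the coefficients of \<open>X\<close>.\<close>

definition green_coeff :: "int \<times> int \<Rightarrow> complex" where
  "green_coeff k = (if k = 0 then 0 else - 1 / complex_of_real ((fnorm k)\<^sup>2))"

lemma X_coeff_eq: "X_coeff \<xi> \<omega> k = green_coeff k * \<xi> k \<omega>"
  by (simp add: X_coeff_def green_coeff_def)

lemma green_coeff_uminus: "green_coeff (- k) = cnj (green_coeff k)"
  by (simp add: green_coeff_def freq_uminus)

lemma green_coeff_sq_le:
  assumes "k \<in> dblock j"
  shows "(cmod (green_coeff k))\<^sup>2 \<le> (1 / 4) ^ j * (1 / 4) ^ j"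
proof -
  have k: "2 ^ j \<le> fnorm k" by (rule dblock_fnorm_ge[OF assms])
  have "k \<noteq> 0" using assms zero_notin_dblock by blast
  have pos: "0 < fnorm k" using less_le_trans[OF _ k, of 0] by simp
  from \<open>k \<noteq> 0\<close> have "cmod (green_coeff k) = 1 / (fnorm k)\<^sup>2"
    by (simp add: green_coeff_def norm_divide norm_power)
  also have "\<dots> \<le> 1 / (2 ^ j)\<^sup>2"
    using k pos by (intro divide_left_mono power_mono mult_pos_pos zero_less_power) auto
  also have "\<dots> = (1 / 4) ^ j" unfolding two_power_square by (simp add: power_divide)
  finally have "(cmod (green_coeff k))\<^sup>2 \<le> ((1 / 4) ^ j)\<^sup>2" by (intro power_mono) auto
  then show ?thesis by (simp only: power2_eq_square)
qed

lemma quarter_power_eq_qr: "(1 / 4 :: real) ^ j = (qr ^ j) ^ 16"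
proof -
  have "(qr ^ j) ^ 16 = ((qr ^ 8) ^ j)\<^sup>2"
    unfolding power_mult[symmetric] by (rule arg_cong[where f = "power qr"]) simp
  also have "\<dots> = (1 / 4) ^ j" by (simp add: qr_8 power_divide two_power_square)
  finally show ?thesis ..
qed

lemma dblock_sum_le:
  fixes r :: real
  assumes "\<And>k. k \<in> dblock j \<Longrightarrow> f k \<le> r" "r \<ge> 0"
  shows "(\<Sum>k\<in>dblock j. f k) \<le> 25 * 4 ^ j * r"
proof -
  have "(\<Sum>k\<in>dblock j. f k) \<le> real (card (dblock j)) * r"
    using sum_bounded_above[of "dblock j" f r] assms by simp
  also have "\<dots> \<le> 25 * 4 ^ j * r" using card_dblock assms(2) by (rule mult_right_mono)
  finally show ?thesis .
qed

text \<open>About 4^j frequencies of size 16^(-j) each give 4^(-j), the 16th power of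
  \<open>qr ^ j\<close>. The weaker constant and power are those of the increments, so that one
  probabilistic lemma covers both.\<close>

lemma green_coeff_sum: "(\<Sum>k\<in>dblock j. (cmod (green_coeff k))\<^sup>2) \<le> 400 * (qr ^ j) ^ 12"
proof -
  have "(\<Sum>k\<in>dblock j. (cmod (green_coeff k))\<^sup>2) \<le> 25 * 4 ^ j * ((1 / 4) ^ j * (1 / 4) ^ j)"
    by (intro dblock_sum_le green_coeff_sq_le) auto
  also have "\<dots> = 25 * (4 ^ j * (1 / 4) ^ j) * (1 / 4) ^ j" by (simp only: mult.assoc)
  also have "4 ^ j * (1 / 4 :: real) ^ j = 1" by (simp add: power_divide)
  also have "25 * 1 * (1 / 4) ^ j \<le> 400 * (qr ^ j) ^ 12"
  proof -
    have "(qr ^ j) ^ 16 \<le> (qr ^ j) ^ 12" using qr_bounds by (intro power_decreasing power_le_one) auto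
    moreover have "0 \<le> (qr ^ j) ^ 12" using qr_bounds by simp
    ultimately show ?thesis unfolding quarter_power_eq_qr by linarith
  qed
  finally show ?thesis .
qed

text \<open>The squared phase is at most 4 times the square root of the angle, which is of order
  2^(j-m). This gains \<open>(qr ^ m) ^ 4\<close> and costs \<open>(qr ^ j) ^ 4\<close> against the
  variance, leaving 16 - 4 = 12 powers; the constant is 25 * 16.\<close>

lemma green_coeff_increment_sum:
  assumes b: "b \<in> Basis"
  shows "(\<Sum>k\<in>dblock j. (cmod (green_coeff k * (cis (freq k \<bullet> (hstep m *\<^sub>R b)) - 1)))\<^sup>2) \<le> 400 * (qr ^ m) ^ 4 * (qr ^ j) ^ 12"
proof -
  let ?r = "(1 / 4) ^ j * (1 / 4) ^ j * (16 * (qr ^ m) ^ 4 * (1 / (qr ^ j) ^ 4))"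
  have "(\<Sum>k\<in>dblock j. (cmod (green_coeff k * (cis (freq k \<bullet> (hstep m *\<^sub>R b)) - 1)))\<^sup>2) \<le> 25 * 4 ^ j * ?r"
  proof (rule dblock_sum_le)
    fix k assume k: "k \<in> dblock j"
    let ?\<theta> = "freq k \<bullet> (hstep m *\<^sub>R b)"
    have "(cmod (cis ?\<theta> - 1))\<^sup>2 \<le> 4 * sqrt \<bar>?\<theta>\<bar>" by (rule cmod_cis_diff_sq_le)
    also have "sqrt \<bar>?\<theta>\<bar> \<le> sqrt (hstep m) * sqrt (2 ^ Suc j)"
      using dblock_inner_le[OF k b] hstep_pos[of m]
      by (simp add: abs_mult real_sqrt_mult[symmetric] mult_left_mono del: power_Suc)
    also have "sqrt (2 ^ Suc j) \<le> 2 * (1 / (qr ^ j) ^ 4)"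
    proof (rule real_le_lsqrt)
      have "(2 * (1 / (qr ^ j) ^ 4))\<^sup>2 = 4 * 2 ^ j"
        by (simp add: two_power_eq_qr power_mult_distrib power_divide power_mult[of "qr ^ j" 4 2, symmetric])
      then show "2 ^ Suc j \<le> (2 * (1 / (qr ^ j) ^ 4))\<^sup>2" by simp
    qed (use qr_bounds in auto)
    also have "sqrt (hstep m) * (2 * (1 / (qr ^ j) ^ 4)) \<le> (2 * (qr ^ m) ^ 4) * (2 * (1 / (qr ^ j) ^ 4))"
      using qr_bounds by (intro mult_right_mono sqrt_hstep_le) auto
    finally have "(cmod (cis ?\<theta> - 1))\<^sup>2 \<le> 16 * (qr ^ m) ^ 4 * (1 / (qr ^ j) ^ 4)"
      using hstep_pos[of m] by (simp add: mult_left_mono mult_ac)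
    then show "(cmod (green_coeff k * (cis ?\<theta> - 1)))\<^sup>2 \<le> ?r"
      unfolding norm_mult power_mult_distrib by (intro mult_mono green_coeff_sq_le[OF k]) auto
  qed (use qr_bounds in simp)
  also have "25 * 4 ^ j * ?r = 400 * (4 ^ j * (1 / 4) ^ j) * (qr ^ m) ^ 4 * ((1 / 4) ^ j / (qr ^ j) ^ 4)"
    by (simp only: mult_ac divide_inverse)
  also have "4 ^ j * (1 / 4 :: real) ^ j = 1" by (simp add: power_divide)
  also have "(1 / 4) ^ j / (qr ^ j) ^ 4 = (qr ^ j) ^ 12"
    unfolding quarter_power_eq_qr using qr_bounds power_diff[of "qr ^ j" 4 16] by simp
  finally show ?thesis by simp
qed

definition regular_field :: "(real \<times> real \<Rightarrow> real) \<Rightarrow> (real \<times> real \<Rightarrow> real) \<Rightarrow> real \<Rightarrow> real \<Rightarrow> bool" where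
  "regular_field X Xt R K \<longleftrightarrow> X \<in> L2 \<and> (AE x in torus. X x = Xt x) \<and> unif_trig (\<lambda>x. complex_of_real (Xt x)) \<and>
     (\<forall>x. \<bar>Xt x\<bar> \<le> R) \<and> (\<forall>b\<in>Basis. \<forall>m x. \<bar>Xt (x + hstep m *\<^sub>R b) - Xt x\<bar> \<le> K * qr ^ m)"

text \<open>The block series converges uniformly at a geometric rate and \<open>Xt\<close> is its
  sum. Its dyadic partial sums also converge to \<open>X\<close> in L2, so \<open>X\<close> and
  \<open>Xt\<close> agree almost everywhere.\<close>

lemma regular_field_of_blocks:
  assumes X: "X \<in> L2" and Xc: "\<And>k. fourier_coeff X k = c k" and c0: "c 0 = 0"
    and c: "\<And>k. c (- k) = cnj (c k)" and K: "K \<ge> 0"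
    and bd: "\<And>j x. cmod (trig (dblock j) c x) \<le> K * qr ^ j"
    and inc: "\<And>b m j x. b \<in> Basis \<Longrightarrow>
      cmod (trig (dblock j) (\<lambda>k. c k * (cis (freq k \<bullet> (hstep m *\<^sub>R b)) - 1)) x) \<le> K * qr ^ m * qr ^ j"
  shows "\<exists>Xt R K. regular_field X Xt R K"
proof -
  \<comment> \<open>Manifestly real form of the block, so that the limit is a real function by
    construction.\<close>
  define Y where "Y j x = (\<Sum>k\<in>dblock j \<inter> half_plane. 2 * Re (c k * cis (freq k \<bullet> x)))" for j x
  have Y: "trig (dblock j) c x = complex_of_real (Y j x)" for j x
    unfolding Y_def by (intro trig_half_plane finite_dblock zero_notin_dblock uminus_dblock c)
  have Yb: "\<bar>Y j x\<bar> \<le> K * qr ^ j" for j x using bd[of j x] by (simp add: Y)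
  have geo: "(\<lambda>j. a * qr ^ j) sums (a * (1 / (1 - qr)))" for a
    using qr_bounds by (intro sums_mult geometric_sums) auto
  have Ysm: "summable (\<lambda>j. \<bar>Y j x\<bar>)" for x
    by (rule summable_comparison_test'[OF sums_summable[OF geo[of K]]]) (use Yb in simp)
  define Xt where "Xt x = (\<Sum>j. Y j x)" for x
  define S where "S J x = (\<Sum>j<J. Y j x)" for J x
  have Ysm': "summable (\<lambda>j. Y j x)" for x using Ysm by (rule summable_rabs_cancel)
  have tail: "\<bar>Xt x - S J x\<bar> \<le> K / (1 - qr) * qr ^ J" for J x
  proof -
    have "Xt x - S J x = (\<Sum>j. Y (j + J) x)"
      unfolding Xt_def S_def using suminf_minus_initial_segment[OF Ysm'[of x], of J] by simp
    also have "\<bar>\<dots>\<bar> \<le> (\<Sum>j. \<bar>Y (j + J) x\<bar>)"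
      by (rule summable_rabs) (use Ysm[of x] summable_iff_shift[of "\<lambda>j. \<bar>Y j x\<bar>" J] in simp)
    also have "\<dots> \<le> (\<Sum>j. (K * qr ^ J) * qr ^ j)"
    proof (rule suminf_le)
      show "\<bar>Y (j + J) x\<bar> \<le> (K * qr ^ J) * qr ^ j" for j
        using Yb[of "j + J" x] by (simp add: power_add mult_ac)
      show "summable (\<lambda>j. \<bar>Y (j + J) x\<bar>)" using Ysm[of x] summable_iff_shift[of "\<lambda>j. \<bar>Y j x\<bar>" J] by simp
      show "summable (\<lambda>j. (K * qr ^ J) * qr ^ j)" using geo by (rule sums_summable)
    qed
    also have "\<dots> = (K * qr ^ J) * (1 / (1 - qr))" using geo[of "K * qr ^ J"] by (rule sums_unique[symmetric])
    finally show ?thesis by (simp add: mult_ac)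
  qed
  have St: "complex_of_real (S J x) = trig (fbox (2 ^ J - 1)) c x" for J x
    unfolding trig_fbox_dyadic S_def by (simp add: c0 Y)
  have lim0: "(\<lambda>J. K / (1 - qr) * qr ^ J) \<longlonglongrightarrow> 0"
    using tendsto_mult_right_zero[OF LIMSEQ_power_zero[of qr], of "K / (1 - qr)"] qr_bounds by simp
  have unif: "unif_trig (\<lambda>x. complex_of_real (Xt x))"
  proof (rule unif_trig_limit)
    fix \<epsilon> :: real assume "\<epsilon> > 0"
    with lim0 have "\<forall>\<^sub>F J in sequentially. K / (1 - qr) * qr ^ J < \<epsilon>" by (rule order_tendstoD)
    then obtain J where J: "K / (1 - qr) * qr ^ J < \<epsilon>" by (auto dest: eventually_happens'[OF sequentially_bot])
    have "cmod (complex_of_real (Xt x) - trig (fbox (2 ^ J - 1)) c x) \<le> \<epsilon>" for x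
      unfolding St[symmetric] of_real_diff[symmetric] norm_of_real using tail[of x J] J by linarith
    then show "\<exists>g. unif_trig g \<and> (\<forall>x. cmod (complex_of_real (Xt x) - g x) \<le> \<epsilon>)"
      by (intro exI[of _ "trig (fbox (2 ^ J - 1)) c"] conjI allI unif_trig_trig finite_fbox)
  qed
  have bound: "\<bar>Xt x\<bar> \<le> K / (1 - qr)" for x using tail[of x 0] by (simp add: S_def)
  have incr: "\<bar>Xt (x + hstep m *\<^sub>R b) - Xt x\<bar> \<le> K / (1 - qr) * qr ^ m" if b: "b \<in> Basis" for b m x
  proof -
    let ?y = "x + hstep m *\<^sub>R b"
    have Yi: "\<bar>Y j ?y - Y j x\<bar> \<le> (K * qr ^ m) * qr ^ j" for j
    proof -
      have "complex_of_real (Y j ?y - Y j x) = trig (dblock j) c ?y - trig (dblock j) c x" by (simp only: Y of_real_diff)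
      also have "\<dots> = trig (dblock j) (\<lambda>k. c k * (cis (freq k \<bullet> (hstep m *\<^sub>R b)) - 1)) x"
        by (simp only: trig_shift trig_diff right_diff_distrib mult_1_right)
      finally show ?thesis using inc[OF b, of j m x] by (metis norm_of_real)
    qed
    have sm: "summable (\<lambda>j. \<bar>Y j ?y - Y j x\<bar>)"
      by (rule summable_comparison_test'[OF sums_summable[OF geo[of "K * qr ^ m"]]]) (use Yi in simp)
    have "Xt ?y - Xt x = (\<Sum>j. Y j ?y - Y j x)" unfolding Xt_def by (rule suminf_diff[OF Ysm' Ysm'])
    also have "\<bar>\<dots>\<bar> \<le> (\<Sum>j. \<bar>Y j ?y - Y j x\<bar>)" by (rule summable_rabs[OF sm])
    also have "\<dots> \<le> (\<Sum>j. (K * qr ^ m) * qr ^ j)"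
      by (rule suminf_le[OF Yi sm sums_summable[OF geo]])
    also have "\<dots> = (K * qr ^ m) * (1 / (1 - qr))" using geo[of "K * qr ^ m"] by (rule sums_unique[symmetric])
    finally show ?thesis by (simp add: mult_ac)
  qed
  have AE: "AE x in torus. X x = Xt x"
  proof -
    let ?X = "\<lambda>x. complex_of_real (X x)" and ?Xt = "\<lambda>x. complex_of_real (Xt x)"
    have sqX: "sq_int ?X" by (rule L2_sq_int[OF X])
    have sqXt: "sq_int ?Xt" by (rule unif_trig_sq_int[OF unif])
    have fc: "fcoef ?X = c" by (rule ext) (simp add: fourier_coeff_eq_fcoef[symmetric] Xc)
    have sub: "strict_mono (\<lambda>J::nat. 2 ^ J - 1 :: nat)"
      by (rule strict_monoI) (simp add: diff_less_mono)
    have "(\<lambda>J. LINT x|torus. (cmod (?X x - trig (fbox (2 ^ J - 1)) c x))\<^sup>2) \<longlonglongrightarrow> 0"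
      using LIMSEQ_subseq_LIMSEQ[OF fourier_partial_sums_tendsto[OF sqX] sub] unfolding fc comp_def .
    moreover have "(\<lambda>J. (K / (1 - qr) * qr ^ J)\<^sup>2) \<longlonglongrightarrow> 0"
      using tendsto_power[OF lim0, of 2] by simp
    ultimately have lim: "(\<lambda>J. 2 * (LINT x|torus. (cmod (?X x - trig (fbox (2 ^ J - 1)) c x))\<^sup>2)
        + 2 * (K / (1 - qr) * qr ^ J)\<^sup>2) \<longlonglongrightarrow> 2 * 0 + 2 * 0"
      by (intro tendsto_add tendsto_mult tendsto_const)
    have le: "(LINT x|torus. (cmod (?X x - ?Xt x))\<^sup>2)
        \<le> 2 * (LINT x|torus. (cmod (?X x - trig (fbox (2 ^ J - 1)) c x))\<^sup>2) + 2 * (K / (1 - qr) * qr ^ J)\<^sup>2" for J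
    proof -
      let ?S = "trig (fbox (2 ^ J - 1)) c"
      have "(LINT x|torus. (cmod (?X x - ?Xt x))\<^sup>2)
          \<le> 2 * (LINT x|torus. (cmod (?X x - ?S x))\<^sup>2) + 2 * (LINT x|torus. (cmod (?S x - ?Xt x))\<^sup>2)"
        using sqX sqXt by (intro integral_sq_triangle sq_int_diff sq_int_trig)
      also have "(LINT x|torus. (cmod (?S x - ?Xt x))\<^sup>2) \<le> (LINT x|torus. (K / (1 - qr) * qr ^ J)\<^sup>2)"
      proof (rule integral_mono)
        show "integrable torus (\<lambda>x. (cmod (?S x - ?Xt x))\<^sup>2)"
          using sq_int_diff[OF sq_int_trig sqXt] unfolding sq_int_def by blast
        fix x
        have "cmod (?S x - ?Xt x) = \<bar>Xt x - S J x\<bar>"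
          unfolding St[symmetric] of_real_diff[symmetric] norm_of_real by (rule abs_minus_commute)
        then show "(cmod (?S x - ?Xt x))\<^sup>2 \<le> (K / (1 - qr) * qr ^ J)\<^sup>2"
          using tail[of x J] by (intro power_mono) auto
      qed simp
      finally show ?thesis by simp
    qed
    \<comment> \<open>The L2 distance does not depend on \<open>J\<close>, whereas its upper bound
      tends to 0.\<close>
    have "(LINT x|torus. (cmod (?X x - ?Xt x))\<^sup>2) \<le> 2 * 0 + 2 * 0"
      by (rule LIMSEQ_le_const[OF lim]) (use le in blast)
    then have "(LINT x|torus. (cmod (?X x - ?Xt x))\<^sup>2) = 0"
      using Bochner_Integration.integral_nonneg[of torus "\<lambda>x. (cmod (?X x - ?Xt x))\<^sup>2"]
      by (intro antisym) simp_all
    then have "AE x in torus. (cmod (?X x - ?Xt x))\<^sup>2 = 0"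
      using sq_int_diff[OF sqX sqXt] unfolding sq_int_def
      by (subst (asm) integral_nonneg_eq_0_iff_AE) auto
    then show ?thesis by eventually_elim (simp flip: of_real_diff)
  qed
  show ?thesis
    unfolding regular_field_def using X AE unif bound incr by blast
qed

theorem X_regular:
  assumes M: "prob_space M" and \<xi>: "white_noise M \<xi>" and X: "is_X M \<xi> X"
  shows "AE \<omega> in M. \<exists>Xt R K. regular_field (X \<omega>) Xt R K"
proof -
  have real: "AE \<omega> in M. real_distribution (\<lambda>k. \<xi> k \<omega>)" using \<xi> unfolding white_noise_def by blast
  \<comment> \<open>The blocks themselves are treated as increments that vanish unless
    \<open>m = 0\<close>; at \<open>m = 0\<close> the factor \<open>qr ^ m\<close> is 1.\<close>
  have base: "AE \<omega> in M. \<exists>K\<ge>0. \<forall>m j x. cmod (trig (dblock j) (\<lambda>k. (if m = 0 then green_coeff k else 0) * \<xi> k \<omega>) x) \<le> K * qr ^ m * qr ^ j"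
  proof (rule white_noise_blocks[OF M \<xi>])
    show "(\<Sum>k\<in>dblock j. (cmod (if m = 0 then green_coeff k else 0))\<^sup>2) \<le> 400 * (qr ^ m) ^ 4 * (qr ^ j) ^ 12" for m j
      using green_coeff_sum[of j] qr_bounds by (cases "m = 0") auto
  qed (simp add: green_coeff_uminus)
  have incr: "AE \<omega> in M. \<exists>K\<ge>0. \<forall>m j x.
      cmod (trig (dblock j) (\<lambda>k. green_coeff k * (cis (freq k \<bullet> (hstep m *\<^sub>R b)) - 1) * \<xi> k \<omega>) x) \<le> K * qr ^ m * qr ^ j"
    if b: "b \<in> Basis" for b
    by (rule white_noise_blocks[OF M \<xi> _ green_coeff_increment_sum[OF b]]) (simp add: green_coeff_uminus freq_uminus cis_cnj)
  have "AE \<omega> in M. \<forall>b\<in>Basis. \<exists>K\<ge>0. \<forall>m j x.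
      cmod (trig (dblock j) (\<lambda>k. green_coeff k * (cis (freq k \<bullet> (hstep m *\<^sub>R b)) - 1) * \<xi> k \<omega>) x) \<le> K * qr ^ m * qr ^ j"
    by (rule AE_finite_allI[OF finite_Basis incr])
  with base real X[unfolded is_X_def] show ?thesis
  proof eventually_elim
    case (elim \<omega>)
    let ?c = "X_coeff \<xi> \<omega>"
    from elim(1) obtain K0 where K0: "K0 \<ge> 0"
      "\<forall>m j x. cmod (trig (dblock j) (\<lambda>k. (if m = 0 then green_coeff k else 0) * \<xi> k \<omega>) x) \<le> K0 * qr ^ m * qr ^ j"
      by (elim exE conjE)
    from bchoice[OF elim(4)] obtain Kb where Kb: "\<forall>b\<in>Basis. Kb b \<ge> 0 \<and> (\<forall>m j x.
      cmod (trig (dblock j) (\<lambda>k. green_coeff k * (cis (freq k \<bullet> (hstep m *\<^sub>R b)) - 1) * \<xi> k \<omega>) x) \<le> Kb b * qr ^ m * qr ^ j)"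
      by (elim exE)
    define K where "K = K0 + (\<Sum>b\<in>Basis. Kb b)"
    have sumn: "0 \<le> (\<Sum>b\<in>Basis. Kb b)" using Kb by (intro sum_nonneg) auto
    have ceq: "?c = (\<lambda>k. green_coeff k * \<xi> k \<omega>)" by (rule ext) (rule X_coeff_eq)
    show ?case
    proof (rule regular_field_of_blocks[where c = ?c and K = K])
      show "X \<omega> \<in> L2" using elim(3) by blast
      show "fourier_coeff (X \<omega>) k = ?c k" for k using elim(3) by blast
      show "?c 0 = 0" by (simp add: X_coeff_def)
      show "?c (- k) = cnj (?c k)" for k
        using elim(2)[unfolded real_distribution_def, rule_format, of k] by (simp add: ceq green_coeff_uminus)
      show "K \<ge> 0" using K0(1) sumn by (simp add: K_def)
      show "cmod (trig (dblock j) ?c x) \<le> K * qr ^ j" for j x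
      proof -
        have "cmod (trig (dblock j) ?c x) \<le> K0 * qr ^ j"
          using K0(2)[rule_format, of j 0 x] by (simp add: ceq)
        also have "\<dots> \<le> K * qr ^ j" using sumn qr_bounds by (intro mult_right_mono) (auto simp: K_def)
        finally show ?thesis .
      qed
      fix b m j x assume b: "b \<in> (Basis :: (real \<times> real) set)"
      have "Kb b \<le> (\<Sum>b\<in>Basis. Kb b)" using b Kb by (intro member_le_sum) auto
      then have "Kb b \<le> K" using K0(1) by (simp add: K_def)
      have eq: "(\<lambda>k. ?c k * (cis (freq k \<bullet> (hstep m *\<^sub>R b)) - 1)) = (\<lambda>k. green_coeff k * (cis (freq k \<bullet> (hstep m *\<^sub>R b)) - 1) * \<xi> k \<omega>)"
        by (rule ext) (simp only: ceq mult_ac)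
      have "cmod (trig (dblock j) (\<lambda>k. ?c k * (cis (freq k \<bullet> (hstep m *\<^sub>R b)) - 1)) x) \<le> Kb b * qr ^ m * qr ^ j"
        unfolding eq using Kb b by blast
      also have "\<dots> \<le> K * qr ^ m * qr ^ j"
        using \<open>Kb b \<le> K\<close> qr_bounds by (intro mult_right_mono) auto
      finally show "cmod (trig (dblock j) (\<lambda>k. ?c k * (cis (freq k \<bullet> (hstep m *\<^sub>R b)) - 1)) x) \<le> K * qr ^ m * qr ^ j" .
    qed
  qed
qed

section \<open>Decay of the mollifier\<close>

lemma has_real_derivative_along:
  fixes f :: "real \<times> real \<Rightarrow> real"
  assumes "f differentiable at (y + t *\<^sub>R b)"
  shows "((\<lambda>t. f (y + t *\<^sub>R b)) has_real_derivative frechet_derivative f (at (y + t *\<^sub>R b)) b) (at t)"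
proof -
  let ?D = "frechet_derivative f (at (y + t *\<^sub>R b))"
  have D: "(f has_derivative ?D) (at (y + t *\<^sub>R b))"
    using assms by (simp add: frechet_derivative_works)
  have "((\<lambda>t. y + t *\<^sub>R b) has_derivative (\<lambda>s. s *\<^sub>R b)) (at t)"
    by (auto intro!: derivative_eq_intros)
  from has_derivative_compose[OF this D] have "((\<lambda>t. f (y + t *\<^sub>R b)) has_derivative (\<lambda>s. ?D (s *\<^sub>R b))) (at t)" .
  moreover have "?D (s *\<^sub>R b) = ?D b * s" for s
    using linear_scale[OF has_derivative_linear[OF D], of s b] by simp
  ultimately show ?thesis by (simp add: has_field_derivative_def)
qed

text \<open>The mean value theorem is applied to the even part of \<open>f\<close>, whose derivative
  at s is g s - g (-s), and then to \<open>g\<close> between -s and s.\<close>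

lemma second_difference_bound:
  fixes f g g' :: "real \<Rightarrow> real"
  assumes h: "h > 0" and f: "\<And>t. (f has_real_derivative g t) (at t)" and g: "\<And>t. (g has_real_derivative g' t) (at t)"
    and S: "\<And>t. \<bar>t\<bar> \<le> h \<Longrightarrow> \<bar>g' t\<bar> \<le> S"
  shows "\<bar>f h + f (- h) - 2 * f 0\<bar> \<le> 2 * h\<^sup>2 * S"
proof -
  have u: "((\<lambda>t. f t + f (- t)) has_real_derivative g t - g (- t)) (at t)" for t
    using DERIV_add[OF f[of t] DERIV_mirror[THEN iffD1, OF f[of "- t"]]] by simp
  obtain s where s: "0 < s" "s < h" "(f h + f (- h)) - (f 0 + f (- 0)) = (h - 0) * (g s - g (- s))"
    using MVT2[of 0 h "\<lambda>t. f t + f (- t)" "\<lambda>t. g t - g (- t)"] h u by blast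
  obtain r where r: "- s < r" "r < s" "g s - g (- s) = (s - (- s)) * g' r"
    using MVT2[of "- s" s g g'] s g by fastforce
  have "f h + f (- h) - 2 * f 0 = h * (2 * s * g' r)" using s(3) r(3) by simp
  then have "\<bar>f h + f (- h) - 2 * f 0\<bar> = \<bar>h * (2 * s * g' r)\<bar>" by (rule arg_cong)
  also have "\<dots> = h * (2 * s * \<bar>g' r\<bar>)"
    using h s(1) by (simp add: abs_mult)
  also have "\<dots> \<le> h * (2 * h * S)"
    using h s r S[of r] by (intro mult_left_mono mult_mono) auto
  finally show ?thesis by (simp add: power2_eq_square mult_ac)
qed

lemma C_k_2D:
  assumes "C_k 2 f" "b \<in> Basis"
  shows "f differentiable at x" "(\<lambda>x. frechet_derivative f (at x) b) differentiable at x"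
    "continuous_on UNIV (\<lambda>x. frechet_derivative (\<lambda>x. frechet_derivative f (at x) b) (at x) b)"
  using assms unfolding numeral_2_eq_2 C_k.simps by blast+

lemma integrable_indicator_cball:
  "integrable lborel (indicator (cball a r) :: 'a :: euclidean_space \<Rightarrow> real)"
  by (rule integrable_real_indicator) (simp, rule emeasure_lborel_cball_finite)

text \<open>A shift by half a wavelength of the character changes its sign, so pairing it with the
  second difference of \<open>\<rho>\<close> gives -4 times the integral, while that difference is
  of order h^2 with h of order 1/|k|. The constant depends on \<epsilon>, which is harmless because
  each \<epsilon> is used separately.\<close>

lemma mollifier_decay:
  assumes \<rho>: "mollifier \<rho>" and \<epsilon>: "\<epsilon> > 0"
  shows "\<exists>C\<ge>0. \<forall>k. k \<noteq> 0 \<longrightarrow>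
    cmod (LINT y|lborel. complex_of_real (\<rho> y) * cis (- (\<epsilon> * (freq k \<bullet> y)))) \<le> C / (fnorm k)\<^sup>2"
proof -
  have C2: "C_k 2 \<rho>" using \<rho> unfolding mollifier_def smooth_def by blast
  from \<rho> have "\<exists>R. \<forall>x. R < norm x \<longrightarrow> \<rho> x = 0" unfolding mollifier_def by (elim conjE)
  then obtain R0 where R0: "\<forall>x. R0 < norm x \<longrightarrow> \<rho> x = 0" by (elim exE)
  define R where "R = max R0 0"
  have R: "R \<ge> 0" "\<rho> x = 0" if "R < norm x" for x using R0[rule_format, of x] that by (simp_all add: R_def)
  have R_nonneg: "R \<ge> 0" by (simp add: R_def)
  \<comment> \<open>Half a wavelength for frequency component 1, the largest step that occurs.
    Second differences are supported in radius \<open>R + h0\<close>, and the segments they involve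
    stay in radius \<open>R + 2 * h0\<close>.\<close>
  define h0 where "h0 = pi / \<epsilon>"
  have h0: "h0 > 0" using \<epsilon> by (simp add: h0_def)
  let ?K = "cball (0 :: real \<times> real) (R + 2 * h0)"
  let ?d2 = "\<lambda>b x. frechet_derivative (\<lambda>x. frechet_derivative \<rho> (at x) b) (at x) b"
  have "\<exists>S. \<forall>x\<in>?K. \<bar>?d2 b x\<bar> \<le> S" if b: "b \<in> Basis" for b
  proof -
    have "continuous_on ?K (?d2 b)"
      using C_k_2D(3)[OF C2 b] by (rule continuous_on_subset) simp
    then have "bounded (?d2 b ` ?K)"
      by (intro compact_imp_bounded compact_continuous_image) auto
    then show ?thesis unfolding bounded_iff by auto
  qed
  then have "\<forall>b\<in>Basis. \<exists>S. \<forall>x\<in>?K. \<bar>?d2 b x\<bar> \<le> S" by blast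
  from bchoice[OF this] obtain Sb where Sb: "\<forall>b\<in>Basis. \<forall>x\<in>?K. \<bar>?d2 b x\<bar> \<le> Sb b" by (elim exE)
  define S where "S = (\<Sum>b\<in>(Basis :: (real \<times> real) set). \<bar>Sb b\<bar>)"
  have S: "\<bar>?d2 b x\<bar> \<le> S" if "b \<in> Basis" "x \<in> ?K" for b x
  proof -
    have "\<bar>?d2 b x\<bar> \<le> \<bar>Sb b\<bar>" using Sb that by force
    also have "\<dots> \<le> S" unfolding S_def using that(1) by (intro member_le_sum) auto
    finally show ?thesis .
  qed
  have S0: "S \<ge> 0" unfolding S_def by (intro sum_nonneg) simp
  have diff: "\<rho> differentiable at x" for x
    using C_k_2D(1)[OF C2 SOME_Basis] .
  have cont: "continuous_on UNIV \<rho>"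
    using diff by (intro continuous_at_imp_continuous_on ballI differentiable_imp_continuous_within)
  then have \<rho>m[measurable]: "\<rho> \<in> borel_measurable borel" by (rule borel_measurable_continuous_onI)
  have second: "\<bar>\<rho> (y + h *\<^sub>R b) + \<rho> (y - h *\<^sub>R b) - 2 * \<rho> y\<bar> \<le> 2 * h\<^sup>2 * S * indicator (cball 0 (R + h0)) y"
    if b: "b \<in> Basis" and h: "0 < h" "h \<le> h0" for y h b
  proof (cases "y \<in> cball 0 (R + h0)")
    case True
    have nb: "norm b = 1" using b by simp
    have in_K: "y + t *\<^sub>R b \<in> ?K" if "\<bar>t\<bar> \<le> h" for t
    proof -
      have "norm (y + t *\<^sub>R b) \<le> norm y + \<bar>t\<bar>" using norm_triangle_ineq[of y "t *\<^sub>R b"] nb by simp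
      then show ?thesis using True that h by simp
    qed
    have "\<bar>\<rho> (y + h *\<^sub>R b) + \<rho> (y + (- h) *\<^sub>R b) - 2 * \<rho> (y + 0 *\<^sub>R b)\<bar> \<le> 2 * h\<^sup>2 * S"
      by (rule second_difference_bound[OF h(1) has_real_derivative_along[OF C_k_2D(1)[OF C2 b]]
            has_real_derivative_along[OF C_k_2D(2)[OF C2 b]] S[OF b in_K]])
    then show ?thesis using True by simp
  next
    case False
    have nb: "norm b = 1" using b by simp
    have z: "\<rho> (y + t *\<^sub>R b) = 0" if "\<bar>t\<bar> \<le> h" for t
    proof (rule R(2))
      have "norm y \<le> norm (y + t *\<^sub>R b) + \<bar>t\<bar>" using norm_triangle_ineq4[of "y + t *\<^sub>R b" "t *\<^sub>R b"] nb by simp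
      then show "R < norm (y + t *\<^sub>R b)" using False that h by simp
    qed
    have "\<rho> (y + h *\<^sub>R b) = 0" "\<rho> (y - h *\<^sub>R b) = 0" "\<rho> y = 0"
      using z[of h] z[of "- h"] z[of 0] h by simp_all
    then show ?thesis using False by simp
  qed
  define V where "V = measure lborel (cball (0 :: real \<times> real) (R + h0))"
  have V: "V \<ge> 0" by (simp add: V_def)
  have "compact (\<rho> ` cball 0 R)" using cont by (intro compact_continuous_image continuous_on_subset[OF cont]) auto
  then obtain B where B: "\<forall>x\<in>cball 0 R. \<bar>\<rho> x\<bar> \<le> B"
    using compact_imp_bounded[of "\<rho> ` cball 0 R"] unfolding bounded_iff by auto
  have \<rho>_le: "\<bar>\<rho> y\<bar> \<le> \<bar>B\<bar> * indicator (cball 0 R) y" for y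
  proof (cases "y \<in> cball 0 R")
    case True
    then have "\<bar>\<rho> y\<bar> \<le> B" using B by blast
    then show ?thesis using True by simp
  next
    case False
    then show ?thesis using R(2)[of y] by simp
  qed
  have int: "integrable lborel (\<lambda>y. complex_of_real (\<rho> y) * cis (g y))"
    if [measurable]: "g \<in> borel_measurable borel" for g :: "real \<times> real \<Rightarrow> real"
  proof (rule Bochner_Integration.integrable_bound)
    show "integrable lborel (\<lambda>y. \<bar>B\<bar> * indicator (cball (0 :: real \<times> real) R) y :: real)"
      by (intro integrable_mult_right integrable_indicator_cball)
    show "AE y in lborel. norm (complex_of_real (\<rho> y) * cis (g y)) \<le> norm (\<bar>B\<bar> * indicator (cball 0 R) y :: real)"
      using \<rho>_le by (intro AE_I2) (simp add: norm_mult abs_mult)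
  qed measurable
  \<comment> \<open>From the final substitution h \<le> 4 h0 / |k|: the square of 4, divided by the
    2 in \<open>S * V / 2\<close>.\<close>
  define C where "C = 8 * (pi / \<epsilon>)\<^sup>2 * S * V"
  have C: "C \<ge> 0" using S0 V by (simp add: C_def)
  have "cmod (LINT y|lborel. complex_of_real (\<rho> y) * cis (- (\<epsilon> * (freq k \<bullet> y)))) \<le> C / (fnorm k)\<^sup>2"
    if k: "k \<noteq> 0" for k
  proof -
    obtain m b where b: "b \<in> Basis" and kb: "2 ^ m \<le> \<bar>freq k \<bullet> b\<bar>" "fnorm k \<le> 2 ^ (m + 2)"
      using dyadic_index[OF k] by metis
    have kb1: "1 \<le> \<bar>freq k \<bullet> b\<bar>" using kb(1) one_le_power[of "2 :: real" m] by linarith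
    have k4: "fnorm k \<le> 4 * \<bar>freq k \<bullet> b\<bar>" using kb by simp
    have kpos: "fnorm k > 0"
      using abs_inner_le_fnorm[OF b, of k] kb1 by linarith
    define h where "h = h0 / \<bar>freq k \<bullet> b\<bar>"
    have h: "0 < h" "h \<le> h0" using h0 kb1 by (simp_all add: h_def field_simps)
    define e where "e y = cis (- (\<epsilon> * (freq k \<bullet> y)))" for y
    have em[measurable]: "e \<in> borel_measurable borel" unfolding e_def[abs_def] by measurable
    define I where "I = (LINT y|lborel. complex_of_real (\<rho> y) * e y)"
    have angle: "\<epsilon> * (freq k \<bullet> (h *\<^sub>R b)) = pi \<or> \<epsilon> * (freq k \<bullet> (h *\<^sub>R b)) = - pi"
      using kb1 \<epsilon> by (auto simp: h_def h0_def abs_if)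
    have shift: "(LINT y|lborel. complex_of_real (\<rho> (y + v)) * e y) = - I"
      and shift_int: "integrable lborel (\<lambda>y. complex_of_real (\<rho> (y + v)) * e y)"
      if v: "v = h *\<^sub>R b \<or> v = - (h *\<^sub>R b)" for v
    proof -
      have ev: "e (y - v) = - e y" for y
      proof -
        have "\<epsilon> * (freq k \<bullet> v) = pi \<or> \<epsilon> * (freq k \<bullet> v) = - pi" using angle v by auto
        then have "cis (\<epsilon> * (freq k \<bullet> v)) = - 1" by (auto simp: complex_eq_iff)
        moreover have "e (y - v) = e y * cis (\<epsilon> * (freq k \<bullet> v))"
          by (simp add: e_def inner_diff_right cis_mult algebra_simps)
        ultimately show ?thesis by simp
      qed
      have 0: "integrable lborel (\<lambda>y. complex_of_real (\<rho> y) * e (y - v))"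
        unfolding e_def by (rule int) measurable
      have 1: "integrable (distr lborel borel ((+) v)) (\<lambda>y. complex_of_real (\<rho> y) * e (y - v))"
        using 0 by (simp add: lborel_distr_plus)
      then show "integrable lborel (\<lambda>y. complex_of_real (\<rho> (y + v)) * e y)"
        by (subst (asm) integrable_distr_eq) (auto simp: add.commute)
      have "(LINT y|lborel. complex_of_real (\<rho> y) * e (y - v))
          = (LINT y|distr lborel borel ((+) v). complex_of_real (\<rho> y) * e (y - v))"
        by (simp add: lborel_distr_plus)
      also have "\<dots> = (LINT y|lborel. complex_of_real (\<rho> (y + v)) * e y)"
        by (subst integral_distr) (auto simp: add.commute)
      finally show "(LINT y|lborel. complex_of_real (\<rho> (y + v)) * e y) = - I"
        unfolding ev I_def by simp
    qed
    have int0: "integrable lborel (\<lambda>y. complex_of_real (\<rho> y) * e y)"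
      unfolding e_def by (rule int) measurable
    let ?D = "\<lambda>y. \<rho> (y + h *\<^sub>R b) + \<rho> (y - h *\<^sub>R b) - 2 * \<rho> y"
    have s1: "(LINT y|lborel. complex_of_real (\<rho> (y + h *\<^sub>R b)) * e y) = - I"
      "integrable lborel (\<lambda>y. complex_of_real (\<rho> (y + h *\<^sub>R b)) * e y)"
      using shift[of "h *\<^sub>R b"] shift_int[of "h *\<^sub>R b"] by simp_all
    have s2: "(LINT y|lborel. complex_of_real (\<rho> (y - h *\<^sub>R b)) * e y) = - I"
      "integrable lborel (\<lambda>y. complex_of_real (\<rho> (y - h *\<^sub>R b)) * e y)"
      using shift[of "- (h *\<^sub>R b)"] shift_int[of "- (h *\<^sub>R b)"] by simp_all
    \<comment> \<open>The two shifted terms contribute -I each and the central one -2 I, so nothing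
      cancels.\<close>
    have "(LINT y|lborel. complex_of_real (?D y) * e y) = (LINT y|lborel.
        (complex_of_real (\<rho> (y + h *\<^sub>R b)) * e y + complex_of_real (\<rho> (y - h *\<^sub>R b)) * e y) - 2 * (complex_of_real (\<rho> y) * e y))"
      by (intro Bochner_Integration.integral_cong refl) (simp add: algebra_simps)
    also have "\<dots> = (- I + - I) - 2 * I"
      using s1 s2 int0 unfolding I_def[symmetric]
      by (simp only: Bochner_Integration.integral_diff Bochner_Integration.integral_add
          Bochner_Integration.integrable_add integrable_mult_right integral_mult_right_zero I_def[symmetric])
    finally have "4 * cmod I = cmod (LINT y|lborel. complex_of_real (?D y) * e y)"
      by (simp add: norm_mult flip: norm_minus_cancel[of "_ - _"])
    also have "\<dots> \<le> (LINT y|lborel. norm (complex_of_real (?D y) * e y))"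
      by (rule integral_norm_bound)
    also have "\<dots> \<le> (LINT y|lborel. 2 * h\<^sup>2 * S * indicator (cball (0 :: real \<times> real) (R + h0)) y)"
    proof (rule integral_mono_AE)
      have "integrable lborel (\<lambda>y. (complex_of_real (\<rho> (y + h *\<^sub>R b)) * e y + complex_of_real (\<rho> (y - h *\<^sub>R b)) * e y)
          - 2 * (complex_of_real (\<rho> y) * e y))"
        using s1(2) s2(2) int0 by (intro Bochner_Integration.integrable_diff Bochner_Integration.integrable_add integrable_mult_right)
      then have "integrable lborel (\<lambda>y. complex_of_real (?D y) * e y)"
        by (simp add: algebra_simps)
      then show "integrable lborel (\<lambda>y. norm (complex_of_real (?D y) * e y))" by (rule integrable_norm)
      show "integrable lborel (\<lambda>y. 2 * h\<^sup>2 * S * indicator (cball (0 :: real \<times> real) (R + h0)) y)"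
        by (intro integrable_mult_right integrable_indicator_cball)
      show "AE y in lborel. norm (complex_of_real (?D y) * e y) \<le> 2 * h\<^sup>2 * S * indicator (cball 0 (R + h0)) y"
      proof (rule AE_I2)
        fix y
        have "norm (complex_of_real (?D y) * e y) = \<bar>?D y\<bar>"
          by (simp only: norm_mult norm_of_real e_def norm_cis mult_1_right)
        then show "norm (complex_of_real (?D y) * e y) \<le> 2 * h\<^sup>2 * S * indicator (cball 0 (R + h0)) y"
          using second[OF b h] by simp
      qed
    qed
    also have "\<dots> = 2 * h\<^sup>2 * S * V" by (simp add: V_def)
    finally have I: "cmod I \<le> h\<^sup>2 * (S * V / 2)" by (simp add: mult_ac)
    have "h \<le> 4 * h0 / fnorm k"
      using h0 k4 kb1 kpos by (simp add: h_def field_simps)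
    then have "h\<^sup>2 \<le> (4 * h0 / fnorm k)\<^sup>2" using h by (intro power_mono) auto
    then have "h\<^sup>2 * (S * V / 2) \<le> (4 * h0 / fnorm k)\<^sup>2 * (S * V / 2)"
      using S0 V by (intro mult_right_mono) auto
    also have "\<dots> = C / (fnorm k)\<^sup>2" by (simp add: C_def h0_def power_divide power_mult_distrib)
    finally have "h\<^sup>2 * (S * V / 2) \<le> C / (fnorm k)\<^sup>2" .
    from order_trans[OF I this] show ?thesis unfolding I_def e_def .
  qed
  then show ?thesis using C by (intro exI[of _ C] conjI allI impI)
qed

section \<open>Regularity of the Wick square\<close>

lemma summable_on_complex_iff_abs:
  fixes f :: "'a \<Rightarrow> complex"
  shows "f summable_on A \<longleftrightarrow> (\<lambda>k. norm (f k)) summable_on A"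
proof
  assume f: "f summable_on A"
  have "(\<lambda>k. norm (Re (f k))) summable_on A" "(\<lambda>k. norm (Im (f k))) summable_on A"
    by (rule summable_on_iff_abs_summable_on_real[THEN iffD1, OF summable_on_bounded_linear[OF bounded_linear_Re f]])
      (rule summable_on_iff_abs_summable_on_real[THEN iffD1, OF summable_on_bounded_linear[OF bounded_linear_Im f]])
  then have "(\<lambda>k. norm (Re (f k)) + norm (Im (f k))) summable_on A"
    by (rule summable_on_add)
  then have "(\<lambda>k. norm (norm (Re (f k)) + norm (Im (f k)))) summable_on A"
    by (rule summable_on_iff_abs_summable_on_real[THEN iffD1])
  then show "(\<lambda>k. norm (f k)) summable_on A"
  proof (rule Infinite_Sum.abs_summable_on_comparison_test)
    show "norm (f k) \<le> norm (norm (Re (f k)) + norm (Im (f k)))" for k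
      using cmod_le[of "f k"] by simp
  qed
qed (rule abs_summable_summable)

text \<open>Absolute summability expressed with countably many boxes and integer bounds, so that for
  random coefficients it is visibly a measurable event.\<close>

definition fourier_bounded :: "(int \<times> int \<Rightarrow> complex) \<Rightarrow> bool" where
  "fourier_bounded a \<longleftrightarrow> (\<exists>B::nat. \<forall>N. (\<Sum>k\<in>fbox N. cmod (a k)) \<le> real B)"

lemma filterlim_fbox: "filterlim fbox (finite_subsets_at_top UNIV) sequentially"
  unfolding filterlim_iff eventually_finite_subsets_at_top
proof (intro allI impI)
  fix P :: "(int \<times> int) set \<Rightarrow> bool"
  assume "\<exists>X. finite X \<and> X \<subseteq> UNIV \<and> (\<forall>Y. finite Y \<and> X \<subseteq> Y \<and> Y \<subseteq> UNIV \<longrightarrow> P Y)"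
  then obtain X where X: "finite X" "\<forall>Y. finite Y \<and> X \<subseteq> Y \<and> Y \<subseteq> UNIV \<longrightarrow> P Y" by blast
  obtain N where N: "X \<subseteq> fbox N" using finite_subset_fbox[OF X(1)] by blast
  have "P (fbox n)" if "n \<ge> N" for n
    using X(2) N fbox_mono[OF that] by simp
  then show "\<forall>\<^sub>F n in sequentially. P (fbox n)" unfolding eventually_sequentially by blast
qed

lemma fourier_bounded_iff_summable:
  "fourier_bounded a \<longleftrightarrow> (\<lambda>k. a k * cis (freq k \<bullet> x)) summable_on UNIV"
proof -
  have "(\<lambda>k. a k * cis (freq k \<bullet> x)) summable_on UNIV
      \<longleftrightarrow> bdd_above (sum (\<lambda>k. cmod (a k)) ` {F. F \<subseteq> UNIV \<and> finite F})"
    unfolding summable_on_complex_iff_abs Infinite_Sum.abs_summable_iff_bdd_above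
    by (simp only: norm_mult norm_cis mult_1_right)
  also have "\<dots> \<longleftrightarrow> fourier_bounded a"
  proof
    assume "bdd_above (sum (\<lambda>k. cmod (a k)) ` {F. F \<subseteq> UNIV \<and> finite F})"
    then obtain B where B: "\<And>F. finite F \<Longrightarrow> (\<Sum>k\<in>F. cmod (a k)) \<le> B"
      unfolding bdd_above_def by blast
    have "(\<Sum>k\<in>fbox N. cmod (a k)) \<le> real (nat \<lceil>B\<rceil>)" for N
      by (rule order_trans[OF B[OF finite_fbox] real_nat_ceiling_ge])
    then show "fourier_bounded a" unfolding fourier_bounded_def by blast
  next
    assume "fourier_bounded a"
    then obtain B :: nat where B: "\<And>N. (\<Sum>k\<in>fbox N. cmod (a k)) \<le> real B"
      unfolding fourier_bounded_def by blast
    have "(\<Sum>k\<in>F. cmod (a k)) \<le> real B" if F: "finite F" for F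
    proof -
      obtain N where "F \<subseteq> fbox N" using finite_subset_fbox[OF F] by blast
      then have "(\<Sum>k\<in>F. cmod (a k)) \<le> (\<Sum>k\<in>fbox N. cmod (a k))" by (intro sum_mono2) auto
      then show ?thesis using B[of N] by linarith
    qed
    then show "bdd_above (sum (\<lambda>k. cmod (a k)) ` {F. F \<subseteq> UNIV \<and> finite F})"
      by (intro bdd_aboveI[of _ "real B"]) blast
  qed
  finally show ?thesis by (rule sym)
qed

lemma fourier_series_tendsto:
  assumes "fourier_bounded a"
  shows "(\<lambda>N. Re (trig (fbox N) a x)) \<longlonglongrightarrow> fourier_series a x"
proof -
  have "(\<lambda>k. a k * cis (freq k \<bullet> x)) summable_on UNIV"
    using assms by (simp only: fourier_bounded_iff_summable[of a x])
  from filterlim_compose[OF infsum_tendsto[OF this] filterlim_fbox]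
  have "(\<lambda>N. trig (fbox N) a x) \<longlonglongrightarrow> (\<Sum>\<^sub>\<infinity>k. a k * cis (freq k \<bullet> x))"
    unfolding trig_def .
  then show ?thesis unfolding fourier_series_def by (rule tendsto_Re)
qed

text \<open>An infinite sum that does not exist takes the default value 0. Thanks to this the later
  bounds and measurability statements hold for every realisation, including the null set where the
  series diverges.\<close>

lemma fourier_series_unbounded: "\<not> fourier_bounded a \<Longrightarrow> fourier_series a x = 0"
  by (simp add: fourier_series_def fourier_bounded_iff_summable[of a x] infsum_not_exists)

lemma abs_fourier_series_le:
  assumes "\<And>N. (\<Sum>k\<in>fbox N. cmod (a k)) \<le> B"
  shows "\<bar>fourier_series a x\<bar> \<le> B"
proof (cases "fourier_bounded a")
  case True
  have "(\<lambda>N. \<bar>Re (trig (fbox N) a x)\<bar>) \<longlonglongrightarrow> \<bar>fourier_series a x\<bar>"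
    by (intro tendsto_rabs fourier_series_tendsto True)
  moreover have "\<bar>Re (trig (fbox N) a x)\<bar> \<le> B" for N
    by (rule order_trans[OF abs_Re_le_cmod order_trans[OF cmod_trig_le assms]])
  ultimately show ?thesis by (intro LIMSEQ_le_const2) auto
next
  case False
  have "0 \<le> B" using order_trans[OF sum_nonneg assms[of 0]] by simp
  then show ?thesis using fourier_series_unbounded[OF False] by simp
qed

lemma fourier_series_bounded: "\<exists>B. \<forall>x. \<bar>fourier_series a x\<bar> \<le> B"
proof (cases "fourier_bounded a")
  case True
  then obtain B :: nat where B: "\<And>N. (\<Sum>k\<in>fbox N. cmod (a k)) \<le> real B"
    unfolding fourier_bounded_def by blast
  show ?thesis by (intro exI[of _ "real B"] allI abs_fourier_series_le[OF B])
next
  case False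
  then show ?thesis by (intro exI[of _ 0]) (simp add: fourier_series_unbounded)
qed

section \<open>Random Fourier series with summable deterministic coefficients\<close>

context
  fixes M :: "'w measure" and \<xi> :: "int \<times> int \<Rightarrow> 'w \<Rightarrow> complex" and c :: "int \<times> int \<Rightarrow> complex" and Cs :: real
  assumes M: "prob_space M" and \<xi>: "white_noise M \<xi>" and c0: "c 0 = 0"
    and Cs: "\<And>N. (\<Sum>k\<in>fbox N. cmod (c k)) \<le> Cs"
begin

interpretation prob_space M by (rule M)

lemma xi_measurable [measurable]: "\<xi> k \<in> borel_measurable M"
  using \<xi> unfolding white_noise_def by blast

text \<open>Pointwise limit of jointly measurable truncations, each set to 0 on the measurable event
  of divergence; this agrees with the default value of the series.\<close>

lemma random_fourier_series_measurable:
  "(\<lambda>(\<omega>, x). fourier_series (\<lambda>k. c k * \<xi> k \<omega>) x) \<in> borel_measurable (M \<Otimes>\<^sub>M borel)"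
proof -
  let ?b = "\<lambda>\<omega>. fourier_bounded (\<lambda>k. c k * \<xi> k \<omega>)"
  have bm[measurable]: "Measurable.pred M ?b"
    unfolding fourier_bounded_def by measurable
  let ?f = "\<lambda>N p. if ?b (fst p) then Re (trig (fbox N) (\<lambda>k. c k * \<xi> k (fst p)) (snd p)) else 0"
  have "(\<lambda>p. fourier_series (\<lambda>k. c k * \<xi> k (fst p)) (snd p)) \<in> borel_measurable (M \<Otimes>\<^sub>M borel)"
  proof (rule borel_measurable_LIMSEQ_metric[where f = ?f])
    show "?f N \<in> borel_measurable (M \<Otimes>\<^sub>M borel)" for N
      unfolding trig_def by measurable
    fix p
    show "(\<lambda>N. ?f N p) \<longlonglongrightarrow> fourier_series (\<lambda>k. c k * \<xi> k (fst p)) (snd p)"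
    proof (cases "?b (fst p)")
      case True
      then show ?thesis using fourier_series_tendsto[OF True, of "snd p"] by simp
    next
      case False
      then show ?thesis using fourier_series_unbounded[OF False, of "snd p"] by simp
    qed
  qed
  then show ?thesis by (simp only: case_prod_unfold)
qed

lemma white_noise_second_moment:
  assumes "k \<noteq> 0"
  shows "(\<integral>\<^sup>+ \<omega>. ennreal ((cmod (\<xi> k \<omega>))\<^sup>2) \<partial>M) = 1"
proof -
  have g: "std_complex_gaussian M (\<xi> k)" using \<xi> assms unfolding white_noise_def by blast
  then have U: "distributed M lborel (\<lambda>\<omega>. Re (\<xi> k \<omega>)) (normal_density 0 (1 / sqrt 2))"
    and V: "distributed M lborel (\<lambda>\<omega>. Im (\<xi> k \<omega>)) (normal_density 0 (1 / sqrt 2))"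
    unfolding std_complex_gaussian_def by blast+
  note mu = normal_half_moments[OF U] and mv = normal_half_moments[OF V]
  have "(\<integral>\<^sup>+ \<omega>. ennreal ((cmod (\<xi> k \<omega>))\<^sup>2) \<partial>M) = ennreal (expectation (\<lambda>\<omega>. (Re (\<xi> k \<omega>))\<^sup>2 + (Im (\<xi> k \<omega>))\<^sup>2))"
    unfolding cmod_power2 using mu(1)[of 2] mv(1)[of 2] by (intro nn_integral_eq_integral) auto
  also have "expectation (\<lambda>\<omega>. (Re (\<xi> k \<omega>))\<^sup>2 + (Im (\<xi> k \<omega>))\<^sup>2) = 1"
    using mu(1)[of 2] mv(1)[of 2] mu(3) mv(3) by simp
  finally show ?thesis by simp
qed

text \<open>Cauchy-Schwarz with weights |c k| bounds the squared absolute sum by \<open>Cs\<close>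
  times the sum of |c k| |\<xi> k|^2, whose expectation is at most \<open>Cs\<close>; monotone
  convergence removes the truncation. The bound is uniform in \<open>x\<close>.\<close>

lemma random_fourier_series_second_moment:
  "(\<integral>\<^sup>+ \<omega>. ennreal ((fourier_series (\<lambda>k. c k * \<xi> k \<omega>) x)\<^sup>2) \<partial>M) \<le> ennreal (Cs\<^sup>2)"
proof -
  define S where "S N \<omega> = (\<Sum>k\<in>fbox N. cmod (c k * \<xi> k \<omega>))" for N \<omega>
  have Sm[measurable]: "S N \<in> borel_measurable M" for N unfolding S_def[abs_def] by measurable
  have S0: "S N \<omega> \<ge> 0" for N \<omega> unfolding S_def by (intro sum_nonneg) simp
  have Cs0: "Cs \<ge> 0" using order_trans[OF sum_nonneg Cs[of 0]] by simp
  have mono: "incseq (\<lambda>N \<omega>. ennreal ((S N \<omega>)\<^sup>2))"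
  proof (intro incseq_SucI le_funI ennreal_leI power_mono S0)
    fix N \<omega> show "S N \<omega> \<le> S (Suc N) \<omega>"
      unfolding S_def by (intro sum_mono2 fbox_mono) auto
  qed
  have ES: "(\<integral>\<^sup>+ \<omega>. ennreal ((S N \<omega>)\<^sup>2) \<partial>M) \<le> ennreal (Cs\<^sup>2)" for N
  proof -
    have le: "(S N \<omega>)\<^sup>2 \<le> Cs * (\<Sum>k\<in>fbox N. cmod (c k) * (cmod (\<xi> k \<omega>))\<^sup>2)" for \<omega>
    proof -
      have "S N \<omega> = (\<Sum>k\<in>fbox N. sqrt (cmod (c k)) * (sqrt (cmod (c k)) * cmod (\<xi> k \<omega>)))"
        unfolding S_def by (intro sum.cong) (simp_all add: norm_mult mult.assoc[symmetric])
      then have "(S N \<omega>)\<^sup>2 \<le> (\<Sum>k\<in>fbox N. (sqrt (cmod (c k)))\<^sup>2) * (\<Sum>k\<in>fbox N. (sqrt (cmod (c k)) * cmod (\<xi> k \<omega>))\<^sup>2)"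
        using Cauchy_Schwarz_ineq_sum[of "\<lambda>k. sqrt (cmod (c k))" "\<lambda>k. sqrt (cmod (c k)) * cmod (\<xi> k \<omega>)" "fbox N"] by simp
      also have "\<dots> = (\<Sum>k\<in>fbox N. cmod (c k)) * (\<Sum>k\<in>fbox N. cmod (c k) * (cmod (\<xi> k \<omega>))\<^sup>2)"
        by (simp add: power_mult_distrib)
      also have "\<dots> \<le> Cs * (\<Sum>k\<in>fbox N. cmod (c k) * (cmod (\<xi> k \<omega>))\<^sup>2)"
        by (intro mult_right_mono Cs sum_nonneg) auto
      finally show ?thesis .
    qed
    have "(\<integral>\<^sup>+ \<omega>. ennreal ((S N \<omega>)\<^sup>2) \<partial>M) \<le> (\<integral>\<^sup>+ \<omega>. ennreal Cs * (\<Sum>k\<in>fbox N. ennreal (cmod (c k)) * ennreal ((cmod (\<xi> k \<omega>))\<^sup>2)) \<partial>M)"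
    proof (rule nn_integral_mono)
      fix \<omega>
      have "ennreal ((S N \<omega>)\<^sup>2) \<le> ennreal (Cs * (\<Sum>k\<in>fbox N. cmod (c k) * (cmod (\<xi> k \<omega>))\<^sup>2))"
        by (rule ennreal_leI[OF le])
      also have "\<dots> = ennreal Cs * ennreal (\<Sum>k\<in>fbox N. cmod (c k) * (cmod (\<xi> k \<omega>))\<^sup>2)"
        by (rule ennreal_mult'[OF Cs0])
      also have "ennreal (\<Sum>k\<in>fbox N. cmod (c k) * (cmod (\<xi> k \<omega>))\<^sup>2) = (\<Sum>k\<in>fbox N. ennreal (cmod (c k)) * ennreal ((cmod (\<xi> k \<omega>))\<^sup>2))"
        by (subst sum_ennreal[symmetric]) (simp_all add: ennreal_mult'[OF norm_ge_zero])
      finally show "ennreal ((S N \<omega>)\<^sup>2) \<le> ennreal Cs * (\<Sum>k\<in>fbox N. ennreal (cmod (c k)) * ennreal ((cmod (\<xi> k \<omega>))\<^sup>2))" .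
    qed
    also have "\<dots> = ennreal Cs * (\<Sum>k\<in>fbox N. ennreal (cmod (c k)) * (\<integral>\<^sup>+ \<omega>. ennreal ((cmod (\<xi> k \<omega>))\<^sup>2) \<partial>M))"
      by (simp add: nn_integral_cmult nn_integral_sum)
    also have "\<dots> = ennreal Cs * (\<Sum>k\<in>fbox N. ennreal (cmod (c k)))"
    proof (intro arg_cong[where f = "(*) (ennreal Cs)"] sum.cong refl)
      fix k
      show "ennreal (cmod (c k)) * (\<integral>\<^sup>+ \<omega>. ennreal ((cmod (\<xi> k \<omega>))\<^sup>2) \<partial>M) = ennreal (cmod (c k))"
        \<comment> \<open>The second moment is available for nonzero frequencies; at 0 the
          coefficient \<open>c 0\<close> vanishes.\<close>
        by (cases "k = 0") (simp_all add: c0 white_noise_second_moment)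
    qed
    also have "\<dots> = ennreal Cs * ennreal (\<Sum>k\<in>fbox N. cmod (c k))"
      by (subst sum_ennreal) simp_all
    also have "\<dots> \<le> ennreal Cs * ennreal Cs"
      by (intro mult_left_mono ennreal_leI Cs) simp
    also have "\<dots> = ennreal (Cs\<^sup>2)" using Cs0 by (simp add: ennreal_mult power2_eq_square)
    finally show ?thesis .
  qed
  have "(\<integral>\<^sup>+ \<omega>. ennreal ((fourier_series (\<lambda>k. c k * \<xi> k \<omega>) x)\<^sup>2) \<partial>M) \<le> (\<integral>\<^sup>+ \<omega>. (SUP N. ennreal ((S N \<omega>)\<^sup>2)) \<partial>M)"
  proof (rule nn_integral_mono)
    fix \<omega>
    let ?a = "\<lambda>k. c k * \<xi> k \<omega>"
    show "ennreal ((fourier_series ?a x)\<^sup>2) \<le> (SUP N. ennreal ((S N \<omega>)\<^sup>2))"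
    proof (cases "fourier_bounded ?a")
      case True
      show ?thesis
      proof (rule LIMSEQ_le_const2)
        show "(\<lambda>N. ennreal ((Re (trig (fbox N) ?a x))\<^sup>2)) \<longlonglongrightarrow> ennreal ((fourier_series ?a x)\<^sup>2)"
          by (intro tendsto_ennrealI tendsto_power fourier_series_tendsto True)
        have "ennreal ((Re (trig (fbox N) ?a x))\<^sup>2) \<le> (SUP N. ennreal ((S N \<omega>)\<^sup>2))" for N
        proof -
          have "\<bar>Re (trig (fbox N) ?a x)\<bar> \<le> S N \<omega>"
            unfolding S_def by (rule order_trans[OF abs_Re_le_cmod cmod_trig_le])
          then have "(Re (trig (fbox N) ?a x))\<^sup>2 \<le> (S N \<omega>)\<^sup>2"
            using power_mono[of "\<bar>Re (trig (fbox N) ?a x)\<bar>" "S N \<omega>" 2] by simp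
          then have "ennreal ((Re (trig (fbox N) ?a x))\<^sup>2) \<le> ennreal ((S N \<omega>)\<^sup>2)" by (rule ennreal_leI)
          also have "\<dots> \<le> (SUP N. ennreal ((S N \<omega>)\<^sup>2))" by (rule SUP_upper) simp
          finally show ?thesis .
        qed
        then show "\<exists>N. \<forall>n\<ge>N. ennreal ((Re (trig (fbox n) ?a x))\<^sup>2) \<le> (SUP N. ennreal ((S N \<omega>)\<^sup>2))" by blast
      qed
    qed (simp add: fourier_series_unbounded)
  qed
  also have "\<dots> = (SUP N. \<integral>\<^sup>+ \<omega>. ennreal ((S N \<omega>)\<^sup>2) \<partial>M)"
    by (rule nn_integral_monotone_convergence_SUP[OF mono]) measurable
  also have "\<dots> \<le> ennreal (Cs\<^sup>2)" by (rule SUP_least) (rule ES)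
  finally show ?thesis .
qed

end

lemma fnorm_ge_1: "k \<noteq> 0 \<Longrightarrow> 1 \<le> fnorm k"
proof -
  assume k: "k \<noteq> 0"
  obtain m b where b: "b \<in> Basis" "2 ^ m \<le> \<bar>freq k \<bullet> b\<bar>" using dyadic_index[OF k] by metis
  then show ?thesis
    using abs_inner_le_fnorm[OF b(1), of k] one_le_power[of "2 :: real" m] by linarith
qed

text \<open>Deterministic factor multiplying the noise in the coefficients of the derivative of the
  mollified field in direction \<open>b\<close>.\<close>

definition grad_coeff :: "(real \<times> real \<Rightarrow> real) \<Rightarrow> real \<Rightarrow> real \<times> real \<Rightarrow> int \<times> int \<Rightarrow> complex" where
  "grad_coeff \<rho> \<epsilon> b k = \<i> * complex_of_real (freq k \<bullet> b) * (green_coeff k *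
     (LINT y|lborel. complex_of_real (\<rho> y) * cis (- (\<epsilon> * (freq k \<bullet> y)))))"

lemma grad_X_eps_sq_eq:
  "grad_X_eps_sq \<xi> \<rho> \<epsilon> \<omega> x = (\<Sum>b\<in>Basis. (fourier_series (\<lambda>k. grad_coeff \<rho> \<epsilon> b k * \<xi> k \<omega>) x)\<^sup>2)"
  unfolding grad_X_eps_sq_def mollify_def X_coeff_eq grad_coeff_def by (simp only: mult_ac)

lemma grad_coeff_0: "grad_coeff \<rho> \<epsilon> b 0 = 0"
  by (simp add: grad_coeff_def)

text \<open>One power of |k| from the derivative against two from the inverse Laplacian and two from
  the mollifier leaves |k|^(-3), which is summable in the plane. The 8 comes from 1 + |k| \<le> 2
  |k|.\<close>

lemma grad_coeff_summable:
  assumes \<rho>: "mollifier \<rho>" and \<epsilon>: "\<epsilon> > 0"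
  shows "\<exists>Cs. \<forall>b\<in>Basis. \<forall>N. (\<Sum>k\<in>fbox N. cmod (grad_coeff \<rho> \<epsilon> b k)) \<le> Cs"
proof -
  from mollifier_decay[OF \<rho> \<epsilon>] obtain C where C: "C \<ge> 0" and decay: "\<forall>k. k \<noteq> 0 \<longrightarrow>
    cmod (LINT y|lborel. complex_of_real (\<rho> y) * cis (- (\<epsilon> * (freq k \<bullet> y)))) \<le> C / (fnorm k)\<^sup>2"
    by (elim exE conjE)
  obtain D where D: "\<And>F. finite F \<Longrightarrow> (\<Sum>k\<in>F. 1 / (1 + fnorm k) ^ 3) \<le> D"
    using sum_inverse_cube_bounded by blast
  have le: "cmod (grad_coeff \<rho> \<epsilon> b k) \<le> 8 * C * (1 / (1 + fnorm k) ^ 3)" if b: "b \<in> Basis" for b k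
  proof (cases "k = 0")
    case True
    then show ?thesis using C by (simp add: grad_coeff_0)
  next
    case False
    note k1 = fnorm_ge_1[OF False]
    let ?r = "LINT y|lborel. complex_of_real (\<rho> y) * cis (- (\<epsilon> * (freq k \<bullet> y)))"
    have "cmod (green_coeff k) = 1 / (fnorm k)\<^sup>2" using False by (simp add: green_coeff_def norm_divide norm_power)
    then have "cmod (grad_coeff \<rho> \<epsilon> b k) = \<bar>freq k \<bullet> b\<bar> * (1 / (fnorm k)\<^sup>2 * cmod ?r)"
      by (simp add: grad_coeff_def norm_mult)
    also have "\<dots> \<le> fnorm k * (1 / (fnorm k)\<^sup>2 * (C / (fnorm k)\<^sup>2))"
      by (intro mult_mono mult_left_mono abs_inner_le_fnorm b decay[rule_format, OF False]) auto
    also have "\<dots> = C / fnorm k ^ 3"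
      using k1 by (simp add: field_simps eval_nat_numeral)
    also have "\<dots> = 8 * C * (1 / (2 * fnorm k) ^ 3)" by (simp add: power_mult_distrib)
    also have "\<dots> \<le> 8 * C * (1 / (1 + fnorm k) ^ 3)"
      using C k1 by (intro mult_left_mono divide_left_mono power_mono mult_pos_pos zero_less_power) auto
    finally show ?thesis .
  qed
  have "(\<Sum>k\<in>fbox N. cmod (grad_coeff \<rho> \<epsilon> b k)) \<le> 8 * C * D" if b: "b \<in> Basis" for b N
  proof -
    have "(\<Sum>k\<in>fbox N. cmod (grad_coeff \<rho> \<epsilon> b k)) \<le> 8 * C * (\<Sum>k\<in>fbox N. 1 / (1 + fnorm k) ^ 3)"
      unfolding sum_distrib_left by (intro sum_mono le b)
    also have "\<dots> \<le> 8 * C * D" using C D by (intro mult_left_mono) auto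
    finally show ?thesis .
  qed
  then show ?thesis by blast
qed

text \<open>At fixed \<epsilon> the mollified Wick square is a bounded function for every
  realisation: the gradient is a bounded Fourier series and the subtracted expectation is bounded by
  the second-moment estimate. Joint measurability is needed for its random coefficients.\<close>

lemma wick_eps_properties:
  assumes M: "prob_space M" and \<xi>: "white_noise M \<xi>" and \<rho>: "mollifier \<rho>" and \<epsilon>: "\<epsilon> > 0"
  shows wick_eps_measurable: "(\<lambda>(\<omega>, x). wick_eps M \<xi> \<rho> \<epsilon> \<omega> x) \<in> borel_measurable (M \<Otimes>\<^sub>M borel)"
    and wick_eps_L2: "\<And>\<omega>. \<omega> \<in> space M \<Longrightarrow> wick_eps M \<xi> \<rho> \<epsilon> \<omega> \<in> L2"
proof -
  interpret prob_space M by fact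
  from grad_coeff_summable[OF \<rho> \<epsilon>] obtain Cs
    where Cs: "\<forall>b\<in>Basis. \<forall>N. (\<Sum>k\<in>fbox N. cmod (grad_coeff \<rho> \<epsilon> b k)) \<le> Cs" by (elim exE)
  let ?f = "\<lambda>b \<omega> x. fourier_series (\<lambda>k. grad_coeff \<rho> \<epsilon> b k * \<xi> k \<omega>) x"
  have fm[measurable]: "(\<lambda>(\<omega>, x). ?f b \<omega> x) \<in> borel_measurable (M \<Otimes>\<^sub>M borel)" if "b \<in> Basis" for b
    by (rule random_fourier_series_measurable[OF M \<xi> grad_coeff_0 Cs[rule_format, OF that]])
  let ?g = "grad_X_eps_sq \<xi> \<rho> \<epsilon>"
  have gm: "(\<lambda>p. ?g (fst p) (snd p)) \<in> borel_measurable (M \<Otimes>\<^sub>M borel)"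
    unfolding grad_X_eps_sq_eq
    by (intro borel_measurable_sum borel_measurable_power) (use fm in \<open>simp add: case_prod_unfold\<close>)
  then have gm'[measurable]: "(\<lambda>(\<omega>, x). ?g \<omega> x) \<in> borel_measurable (M \<Otimes>\<^sub>M borel)"
    by (simp only: case_prod_unfold)
  define m where "m x = expectation (\<lambda>\<omega>. ?g \<omega> x)" for x
  have mm[measurable]: "m \<in> borel_measurable borel"
    unfolding m_def[abs_def]
  proof (rule borel_measurable_lebesgue_integral)
    show "(\<lambda>(x, \<omega>). ?g \<omega> x) \<in> borel_measurable (borel \<Otimes>\<^sub>M M)" by measurable
  qed
  have g0: "?g \<omega> x \<ge> 0" for \<omega> x unfolding grad_X_eps_sq_eq by (intro sum_nonneg) simp
  \<comment> \<open>Two directions, each contributing at most the square of the total coefficient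
    mass.\<close>
  have mb: "\<bar>m x\<bar> \<le> 2 * Cs\<^sup>2" for x
  proof -
    have green_coeff: "(\<lambda>\<omega>. ?g \<omega> x) \<in> borel_measurable M" by measurable
    have "m x = enn2real (\<integral>\<^sup>+ \<omega>. ennreal (?g \<omega> x) \<partial>M)"
      unfolding m_def using green_coeff g0 by (intro integral_eq_nn_integral) auto
    also have "\<dots> \<le> enn2real (ennreal (2 * Cs\<^sup>2))"
    proof (rule enn2real_mono)
      have fx: "(\<lambda>\<omega>. ?f b \<omega> x) \<in> borel_measurable M" if "b \<in> Basis" for b
        using fm[OF that] by measurable
      have "(\<integral>\<^sup>+ \<omega>. ennreal (?g \<omega> x) \<partial>M) = (\<integral>\<^sup>+ \<omega>. (\<Sum>b\<in>Basis. ennreal ((?f b \<omega> x)\<^sup>2)) \<partial>M)"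
        unfolding grad_X_eps_sq_eq by (subst sum_ennreal) simp_all
      also have "\<dots> = (\<Sum>b\<in>Basis. \<integral>\<^sup>+ \<omega>. ennreal ((?f b \<omega> x)\<^sup>2) \<partial>M)"
        using fx by (intro nn_integral_sum) measurable
      also have "\<dots> \<le> (\<Sum>b\<in>(Basis :: (real \<times> real) set). ennreal (Cs\<^sup>2))"
      proof (rule sum_mono)
        fix b :: "real \<times> real" assume b: "b \<in> Basis"
        show "(\<integral>\<^sup>+ \<omega>. ennreal ((?f b \<omega> x)\<^sup>2) \<partial>M) \<le> ennreal (Cs\<^sup>2)"
          by (rule random_fourier_series_second_moment[where c = "grad_coeff \<rho> \<epsilon> b", OF M \<xi> grad_coeff_0 Cs[rule_format, OF b]])
      qed
      also have "\<dots> = ennreal (2 * Cs\<^sup>2)" by (simp add: ennreal_mult'')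
      finally show "(\<integral>\<^sup>+ \<omega>. ennreal (?g \<omega> x) \<partial>M) \<le> ennreal (2 * Cs\<^sup>2)" .
    qed simp
    also have "\<dots> = 2 * Cs\<^sup>2" by simp
    finally have "m x \<le> 2 * Cs\<^sup>2" .
    moreover have "0 \<le> m x" unfolding m_def using g0 by (intro Bochner_Integration.integral_nonneg)
    ultimately show ?thesis by simp
  qed
  have w: "wick_eps M \<xi> \<rho> \<epsilon> \<omega> x = ?g \<omega> x - m x" for \<omega> x by (simp add: wick_eps_def m_def)
  show wm: "(\<lambda>(\<omega>, x). wick_eps M \<xi> \<rho> \<epsilon> \<omega> x) \<in> borel_measurable (M \<Otimes>\<^sub>M borel)"
    unfolding w by measurable
  fix \<omega> assume \<omega>: "\<omega> \<in> space M"
  have "\<forall>b. \<exists>B. \<forall>x. \<bar>?f b \<omega> x\<bar> \<le> B" by (intro allI fourier_series_bounded)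
  from choice[OF this] obtain B where B: "\<forall>b x. \<bar>?f b \<omega> x\<bar> \<le> B b" by (elim exE)
  define D where "D = (\<Sum>b\<in>(Basis :: (real \<times> real) set). (B b)\<^sup>2) + 2 * Cs\<^sup>2"
  have wb: "\<bar>wick_eps M \<xi> \<rho> \<epsilon> \<omega> x\<bar> \<le> D" for x
  proof -
    have "?g \<omega> x \<le> (\<Sum>b\<in>(Basis :: (real \<times> real) set). (B b)\<^sup>2)"
      unfolding grad_X_eps_sq_eq
    proof (rule sum_mono)
      fix b :: "real \<times> real"
      show "(?f b \<omega> x)\<^sup>2 \<le> (B b)\<^sup>2"
        using power_mono[OF B[rule_format, of b x] abs_ge_zero, of 2] by (simp only: power2_abs)
    qed
    then show ?thesis using g0[of \<omega> x] mb[of x] unfolding w D_def by linarith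
  qed
  have "(\<lambda>x. wick_eps M \<xi> \<rho> \<epsilon> \<omega> x) \<in> borel_measurable borel"
    using measurable_compose[OF measurable_Pair1'[OF \<omega>] wm] by simp
  moreover have "integrable torus (\<lambda>x. (wick_eps M \<xi> \<rho> \<epsilon> \<omega> x)\<^sup>2)"
  proof (rule integrable_torus_bounded[where B = "D\<^sup>2"])
    show "(\<lambda>x. (wick_eps M \<xi> \<rho> \<epsilon> \<omega> x)\<^sup>2) \<in> borel_measurable borel"
      using calculation by (rule borel_measurable_power)
    show "norm ((wick_eps M \<xi> \<rho> \<epsilon> \<omega> x)\<^sup>2) \<le> D\<^sup>2" for x
      using power_mono[OF wb[of x] abs_ge_zero, of 2] by simp
  qed
  ultimately show "wick_eps M \<xi> \<rho> \<epsilon> \<omega> \<in> L2" unfolding L2_def by simp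
qed

lemma wick_coeff_measurable:
  assumes M: "prob_space M" and \<xi>: "white_noise M \<xi>" and \<rho>: "mollifier \<rho>" and \<epsilon>: "\<epsilon> > 0"
  shows "(\<lambda>\<omega>. fourier_coeff (wick_eps M \<xi> \<rho> \<epsilon> \<omega>) k) \<in> borel_measurable M"
proof -
  note [measurable] = wick_eps_measurable[OF assms]
  show ?thesis
    unfolding fourier_coeff_def
    by (rule torus.borel_measurable_lebesgue_integral) measurable
qed

text \<open>Reduces the uncountable supremum in the Besov norm to a countable one, which preserves
  measurability in the realisation.\<close>

lemma SUP_continuous_dense:
  fixes f :: "'a :: {second_countable_topology} \<Rightarrow> real"
  assumes f: "continuous_on UNIV f" and D: "\<And>S. open S \<Longrightarrow> S \<noteq> {} \<Longrightarrow> \<exists>d\<in>D. d \<in> S"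
  shows "(SUP x. ennreal (f x)) = (SUP x\<in>D. ennreal (f x))"
proof (rule antisym)
  show "(SUP x. ennreal (f x)) \<le> (SUP x\<in>D. ennreal (f x))"
  proof (rule SUP_least, rule dense_le)
    fix x y assume y: "y < ennreal (f x)"
    have "open {z. y < ennreal (f z)}"
    proof -
      have "continuous_on UNIV (\<lambda>z. ennreal (f z))"
        using f by (intro continuous_on_ennreal)
      from open_vimage[OF open_greaterThan[of y] this] show ?thesis
        by (simp add: vimage_def)
    qed
    moreover have "{z. y < ennreal (f z)} \<noteq> {}" using y by blast
    ultimately obtain d where d: "d \<in> D" "y < ennreal (f d)" using D[of "{z. y < ennreal (f z)}"] by blast
    have "y \<le> ennreal (f d)" using d(2) by (rule less_imp_le)
    also have "\<dots> \<le> (SUP x\<in>D. ennreal (f x))" using d(1) by (rule SUP_upper)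
    finally show "y \<le> (SUP x\<in>D. ennreal (f x))" .
  qed
  show "(SUP x\<in>D. ennreal (f x)) \<le> (SUP x. ennreal (f x))"
    by (rule SUP_subset_mono) auto
qed

lemma besov_norm_measurable:
  assumes T[measurable]: "\<And>k. (\<lambda>\<omega>. T \<omega> k) \<in> borel_measurable M"
  shows "(\<lambda>\<omega>. besov_norm \<phi> \<theta> \<alpha> (T \<omega>)) \<in> borel_measurable M"
proof -
  obtain D :: "(real \<times> real) set" where D: "countable D" "\<And>S. open S \<Longrightarrow> S \<noteq> {} \<Longrightarrow> \<exists>d\<in>D. d \<in> S"
    by (rule countable_dense_setE) blast
  have eq: "(SUP x. ennreal (cmod (lp_block \<phi> \<theta> n U x))) = (SUP x\<in>D. ennreal (cmod (lp_block \<phi> \<theta> n U x)))" for n U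
    unfolding lp_block_eq_trig
    by (rule SUP_continuous_dense[OF continuous_on_norm[OF continuous_trig] D(2)])
  show ?thesis
    unfolding besov_norm_def eq
    by (intro borel_measurable_SUP borel_measurable_times_ennreal D(1) measurable_const)
       (auto simp: lp_block_def)
qed

text \<open>\<open>W\<close> is the mollified Wick square, an L2 function, minus a difference whose
  Besov norm is at most 1 off an event of small probability. Both parts have the required growth,
  and one good \<epsilon> per realisation suffices.\<close>

theorem W_growth:
  assumes M: "prob_space M" and \<xi>: "white_noise M \<xi>" and \<rho>: "mollifier \<rho>" and d: "dyadic_partition \<phi> \<theta>"
    and W: "is_wick_square \<phi> \<theta> M \<xi> \<rho> W"
  shows "AE \<omega> in M. \<exists>C. coeff_growth (W \<omega>) C"
proof -
  interpret prob_space M by fact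
  have Wm: "(\<lambda>\<omega>. W \<omega> k) \<in> borel_measurable M" for k
    using W unfolding is_wick_square_def random_distribution_def by blast
  let ?D = "\<lambda>\<epsilon> \<omega> k. fourier_coeff (wick_eps M \<xi> \<rho> \<epsilon> \<omega>) k - W \<omega> k"
  define A where "A \<epsilon> = {\<omega> \<in> space M. besov_norm \<phi> \<theta> (- 1 / 32) (?D \<epsilon> \<omega>) > ennreal 1}" for \<epsilon>
  have lim: "((\<lambda>\<epsilon>. measure M (A \<epsilon>)) \<longlongrightarrow> 0) (at_right 0)"
  proof -
    \<comment> \<open>The choice \<kappa> = 1/64 produces the order -1/32 for which the block count
      was budgeted.\<close>
    have "- 2 * (1 / 64) = (- 1 / 32 :: real)" by simp
    moreover have "((\<lambda>\<epsilon>. measure M {\<omega> \<in> space M. besov_norm \<phi> \<theta> (- 2 * (1 / 64)) (?D \<epsilon> \<omega>) > ennreal 1}) \<longlongrightarrow> 0) (at_right 0)"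
      using W[unfolded is_wick_square_def, THEN conjunct2, rule_format, of "1 / 64" 1] by simp
    ultimately show ?thesis unfolding A_def by simp
  qed
  define e where "e n = 1 / real (Suc n)" for n
  have e: "e n > 0" for n by (simp add: e_def)
  have Am: "A (e n) \<in> sets M" for n
  proof -
    have "(\<lambda>\<omega>. besov_norm \<phi> \<theta> (- 1 / 32) (?D (e n) \<omega>)) \<in> borel_measurable M"
      by (intro besov_norm_measurable borel_measurable_diff wick_coeff_measurable[OF M \<xi> \<rho> e] Wm)
    then show ?thesis unfolding A_def by (rule borel_measurable_less[OF measurable_const, simplified])
  qed
  have "filterlim e (at_right 0) sequentially"
    unfolding filterlim_at
    using LIMSEQ_inverse_real_of_nat e by (auto simp: e_def[abs_def] inverse_eq_divide intro!: always_eventually)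
  from filterlim_compose[OF lim this] have lim': "(\<lambda>n. measure M (A (e n))) \<longlonglongrightarrow> 0" .
  have good: "\<exists>C. coeff_growth (W \<omega>) C" if \<omega>: "\<omega> \<in> space M" "\<omega> \<notin> A (e n)" for \<omega> n
  proof -
    have "besov_norm \<phi> \<theta> (- 1 / 32) (?D (e n) \<omega>) \<le> ennreal 1"
      using \<omega> unfolding A_def by (simp add: not_less)
    then obtain C where C: "coeff_growth (?D (e n) \<omega>) C"
      by (rule coeff_growth_besov[OF d]) simp_all
    have "wick_eps M \<xi> \<rho> (e n) \<omega> \<in> L2" by (rule wick_eps_L2[OF M \<xi> \<rho> e \<omega>(1)])
    from coeff_growth_diff[OF coeff_growth_L2[OF this] C]
    show ?thesis by (intro exI) simp
  qed
  \<comment> \<open>The probabilities merely tend to 0, but the event of failing for all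
    \<open>n\<close> is contained in each single bad event.\<close>
  have "(\<Inter>n. A (e n)) \<in> null_sets M"
  proof (rule null_setsI)
    have "measure M (\<Inter>n. A (e n)) \<le> measure M (A (e n))" for n
      using Am by (intro finite_measure_mono) auto
    then have "measure M (\<Inter>n. A (e n)) \<le> 0"
      by (intro LIMSEQ_le_const[OF lim']) blast
    then have "measure M (\<Inter>n. A (e n)) = 0" using measure_nonneg[of M "\<Inter>n. A (e n)"] by linarith
    then show "emeasure M (\<Inter>n. A (e n)) = 0" by (simp add: emeasure_eq_measure)
    show "(\<Inter>n. A (e n)) \<in> sets M" using Am by (intro sets.countable_INT) auto
  qed
  from AE_not_in[OF this] AE_space show ?thesis
  proof eventually_elim
    case (elim \<omega>)
    then obtain n where "\<omega> \<notin> A (e n)" by blast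
    then show ?case using good elim by blast
  qed
qed

section \<open>The Anderson form\<close>

theorem proposition2p2:
  fixes M :: "'w measure"
    and \<xi> :: "int \<times> int \<Rightarrow> 'w \<Rightarrow> complex"
    and X :: "'w \<Rightarrow> real \<times> real \<Rightarrow> real"
    and W :: "'w \<Rightarrow> distribution"
    and \<rho> \<phi> \<theta> :: "real \<times> real \<Rightarrow> real"
  assumes "prob_space M"
    and "white_noise M \<xi>"
    and "is_X M \<xi> X"
    and "mollifier \<rho>"
    and "dyadic_partition \<phi> \<theta>"
    and "is_wick_square \<phi> \<theta> M \<xi> \<rho> W"
  shows "AE \<omega> in M.
     (\<exists>C>0. \<forall>u1\<in>form_domain (X \<omega>). \<forall>u2\<in>form_domain (X \<omega>).
        \<bar>anderson_form \<phi> \<theta> (X \<omega>) (W \<omega>) (Re (\<xi> 0 \<omega>)) u1 u2\<bar>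
          \<le> C * form_norm (X \<omega>) u1 * form_norm (X \<omega>) u2) \<and>
     (\<exists>\<delta>>0. \<exists>C'>0. \<forall>u\<in>form_domain (X \<omega>).
        anderson_form \<phi> \<theta> (X \<omega>) (W \<omega>) (Re (\<xi> 0 \<omega>)) u u + C' * (L2_norm u)\<^sup>2
          \<ge> \<delta> * (form_norm (X \<omega>) u)\<^sup>2)"
proof -
  have "AE \<omega> in M. \<exists>Xt R K. regular_field (X \<omega>) Xt R K"
    by (rule X_regular) fact+
  moreover have "AE \<omega> in M. \<exists>C. coeff_growth (W \<omega>) C"
    by (rule W_growth) fact+
  ultimately show ?thesis
  proof eventually_elim
    case (elim \<omega>)
    then obtain Xt R K CW where "regular_field (X \<omega>) Xt R K" "coeff_growth (W \<omega>) CW"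
      by (elim exE)
    \<comment> \<open>The realisation is frozen here; the constants produced below are random only
      through \<open>R\<close>, \<open>K\<close>, \<open>CW\<close>, \<open>W \<omega>\<close> and
      the value of the zero mode.\<close>
    then interpret anderson_data \<phi> \<theta> "X \<omega>" Xt "W \<omega>" R K CW "Re (\<xi> 0 \<omega>)"
      using \<open>dyadic_partition \<phi> \<theta>\<close> unfolding regular_field_def by unfold_locales blast+
    show ?case
      by (rule conjI[OF continuity coercivity])
  qed
qed

end
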